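(* Let $D\subset\overline{\mathbb C}$ be an unbounded domain, with $\infty\in D$, whose boundary is a convex polygonal line (the boundary of a bounded convex quadrilateral) with vertices $z_1,z_2,z_3,z_4\in\mathbb C$, listed in the order in which they occur when $\partial D$ is traversed with $D$ on the left. Let the interior angles of $D$ at $z_1,z_2,z_3,z_4$ be, respectively, $(1+\alpha)\pi,\ (1+\beta)\pi,\ (1+\gamma)\pi,\ (1+\delta)\pi$, where $\alpha,\beta,\gamma,\delta\in(0,1)$ and $\alpha+\beta+\gamma+\delta=2$. Let $Q=(D;z_1,z_2,z_3,z_4)$, let $r\in(0,1)$ be the unique solution of $$\mathrm{Mod}(Q)=\frac{K(r')}{K(r)},\qquad r'=\sqrt{1-r^2},$$ and put $t=1/r^2$. Let $z_0=x_0+iy_0$ be the unique solution in the upper half plane $\mathbb H=\{z:\operatorname{Im}z>0\}$ of $$\frac{\alpha}{z_0}+\frac{\beta}{z_0-1}+\frac{\gamma}{z_0-t}=\frac{1}{i y_0},$$ and let $f$ be the conformal mapping of $\mathbb H$ onto $D$ given by $$f(z)=C\int_0^z\frac{\zeta^\alpha(\zeta-1)^\beta(\zeta-t)^\gamma}{(\zeta-z_0)^2(\zeta-\overline{z_0})^2}\,d\zeta+z_1,\qquad C=(z_2-z_1)\left(\int_0^1\frac{\zeta^\alpha(\zeta-1)^\beta(\zeta-t)^\gamma}{(\zeta-z_0)^2(\zeta-\overline{z_0})^2}\,d\zeta\right)^{-1}.$$ Define $$\psi(z)=\frac{F(r,\arcsin\sqrt z)}{K(r)},\qquad z\in\mathbb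 H.$$ Then the potential function $u$ of the quadrilateral $Q$ is equal to $\operatorname{Re}\,(\psi\circ f^{-1})$ on $D$. Moreover, $$u(\infty)=\operatorname{Re}\,\psi(z_0).$$
   Context: A quadrilateral $Q=(D;z_1,z_2,z_3,z_4)$ is a Jordan domain $D$ in the extended complex plane $\overline{\mathbb C}$ together with four boundary points $z_1,z_2,z_3,z_4$ occurring in this order when $\partial D$ is traversed with $D$ on the left. Modulus: there is a unique $h>0$ for which there exists a conformal mapping of $D$ onto the open rectangle $(0,1)\times(0,h)$ whose homeomorphic extension $\overline D\to[0,1]\times[0,h]$ sends $z_1,z_2,z_3,z_4$ to $0,\,1,\,1+ih,\,ih$, respectively. One sets $\mathrm{Mod}(Q)=h$. Potential function: the potential function of $Q$ is the unique harmonic function $u:D\to(0,1)$ (harmonic also at $\infty$ when $\infty\in D$) solving the mixed Dirichlet–Neumann problem: $\Delta u=0$ in $D$; $u=0$ on the open boundary arc $(z_4,z_1)$; $u=1$ on the open boundary arc $(z_2,z_3)$; $\partial u/\partial n=0$ on the open boundary arcs $(z_1,z_2)$ and $(z_3,z_4)$, where $\partial/\partial n$ is the normal derivative. Here $u(\infty)=\lim_{|z|\to\infty}u(z)$. Elliptic integrals: $$K(r)=\int_0^1\frac{dx}{\sqrt{(1-x^2)(1-r^2x^2)}},\qquad F(r,\varphi)=\int_0^\varphi\frac{d\theta}{\sqrt{1-r^2\sin^2\theta}}=\int_0^{\sin\varphi}\frac{ds}{\sqrt{(1-s^2)(1-r^2s^2)}}.$$ Thus, for $z\in\mathbb H$,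 $F(r,\arcsin\sqrt z)=\int_0^{\sqrt z}\frac{ds}{\sqrt{(1-s^2)(1-r^2s^2)}}$, where $\sqrt z$ is taken in the open first quadrant, the integration path lies in the first quadrant, and the branch of the integrand is the analytic one equal to $1$ at $s=0$. In the formula for $f$, the powers $\zeta^\alpha,(\zeta-1)^\beta,(\zeta-t)^\gamma$ denote analytic branches in $\mathbb H$ (extended continuously to the real line; the constant $C$ makes $f$ independent of the choice), and the integral is taken along any path in $\mathbb H$ from $0$ to $z$ avoiding $z_0$; $f$ is meromorphic in $\mathbb H$ with a pole at $z_0$. It is a known prior result that the equation for $z_0$ has exactly one solution in $\mathbb H$ and that the function $f$ given by this formula is a conformal mapping of $\mathbb H$ onto $D$ (with value $\infty$ at the pole $z_0$). *)

theory Defs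
  imports "HOL-Complex_Analysis.Complex_Analysis"
begin

section \<open>The extended complex plane\<close>

type_synonym ecomplex = "complex option"

abbreviation infty :: ecomplex where "infty \<equiv> None"

abbreviation sphere_top :: "ecomplex topology" where
  "sphere_top \<equiv> Alexandroff_compactification euclidean"

text \<open>\<open>Some\<close> and the map \<open>w \<mapsto> 1/w\<close> (with \<open>0 \<mapsto> \<infinity>\<close>) are the two standard
  parametrisations of the Riemann sphere. Holomorphy and harmonicity are tested in both of them,
  so that the second one accounts for the behaviour at \<open>\<infinity>\<close>.\<close>

definition sphere_inv :: "complex \<Rightarrow> ecomplex" where
  "sphere_inv w = (if w = 0 then infty else Some (1 / w))"

definition holomorphic_from_sphere :: "(ecomplex \<Rightarrow> complex) \<Rightarrow> ecomplex set \<Rightarrow> bool" where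
  "holomorphic_from_sphere g D \<longleftrightarrow>
     (\<lambda>z. g (Some z)) holomorphic_on (Some -` D) \<and>
     (\<lambda>w. g (sphere_inv w)) holomorphic_on (sphere_inv -` D)"

definition holomorphic_into_sphere :: "(complex \<Rightarrow> ecomplex) \<Rightarrow> complex set \<Rightarrow> bool" where
  "holomorphic_into_sphere f A \<longleftrightarrow>
     (\<forall>z\<in>A. \<exists>g. g analytic_on {z} \<and>
        ((\<forall>\<^sub>F w in nhds z. f w = Some (g w)) \<or> (\<forall>\<^sub>F w in nhds z. f w = sphere_inv (g w))))"

definition conformal_into_sphere :: "(complex \<Rightarrow> ecomplex) \<Rightarrow> complex set \<Rightarrow> ecomplex set \<Rightarrow> bool" where
  "conformal_into_sphere f A D \<longleftrightarrow> holomorphic_into_sphere f A \<and> bij_betw f A D"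

definition conformal_from_sphere :: "(ecomplex \<Rightarrow> complex) \<Rightarrow> ecomplex set \<Rightarrow> complex set \<Rightarrow> bool" where
  "conformal_from_sphere g D A \<longleftrightarrow> holomorphic_from_sphere g D \<and> bij_betw g D A"

definition harmonic_plane :: "(complex \<Rightarrow> real) \<Rightarrow> complex set \<Rightarrow> bool" where
  "harmonic_plane u S \<longleftrightarrow>
     (\<exists>ux uy uxx uxy uyx uyy.
        (\<forall>z\<in>S.
           (u has_derivative (\<lambda>h. ux z * Re h + uy z * Im h)) (at z) \<and>
           (ux has_derivative (\<lambda>h. uxx z * Re h + uxy z * Im h)) (at z) \<and>
           (uy has_derivative (\<lambda>h. uyx z * Re h + uyy z * Im h)) (at z) \<and>
           uxx z + uyy z = 0) \<and>
        continuous_on S uxx \<and> continuous_on S uxy \<and> continuous_on S uyx \<and> continuous_on S uyy)"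

definition harmonic_sphere :: "(ecomplex \<Rightarrow> real) \<Rightarrow> ecomplex set \<Rightarrow> bool" where
  "harmonic_sphere u D \<longleftrightarrow>
     harmonic_plane (\<lambda>z. u (Some z)) (Some -` D) \<and>
     harmonic_plane (\<lambda>w. u (sphere_inv w)) (sphere_inv -` D)"

section \<open>Quadrilaterals\<close>

definition is_modulus ::
    "ecomplex set \<Rightarrow> complex \<Rightarrow> complex \<Rightarrow> complex \<Rightarrow> complex \<Rightarrow> real \<Rightarrow> bool" where
  "is_modulus D z1 z2 z3 z4 h \<longleftrightarrow> h > 0 \<and>
     (\<exists>g. conformal_from_sphere g D (box 0 (Complex 1 h)) \<and>
          homeomorphic_map (subtopology sphere_top (sphere_top closure_of D))
            (top_of_set (cbox 0 (Complex 1 h))) g \<and>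
          g (Some z1) = 0 \<and> g (Some z2) = 1 \<and>
          g (Some z3) = Complex 1 h \<and> g (Some z4) = Complex 0 h)"

definition quad_modulus ::
    "ecomplex set \<Rightarrow> complex \<Rightarrow> complex \<Rightarrow> complex \<Rightarrow> complex \<Rightarrow> real" where
  "quad_modulus D z1 z2 z3 z4 = (THE h. is_modulus D z1 z2 z3 z4 h)"

definition convex_polygon_exterior ::
    "ecomplex set \<Rightarrow> complex \<Rightarrow> complex \<Rightarrow> complex \<Rightarrow> complex \<Rightarrow> bool" where
  "convex_polygon_exterior D z1 z2 z3 z4 \<longleftrightarrow>
     openin sphere_top D \<and> connectedin sphere_top D \<and> infty \<in> D \<and>
     (let P = closed_segment z1 z2 \<union> closed_segment z2 z3 \<union> closed_segment z3 z4 \<union> closed_segment z4 z1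
      in sphere_top frontier_of D = Some ` P \<and> P = frontier (convex hull {z1, z2, z3, z4}))"

text \<open>\<open>interior_angle D p v q \<theta>\<close>: the domain \<open>D\<close> has interior angle \<open>\<theta>\<close> at its boundary vertex
  \<open>v\<close>, where \<open>p\<close> and \<open>q\<close> are the preceding and the following vertex when the boundary is traversed
  with \<open>D\<close> on the left. Thus, near \<open>v\<close>, the domain is the sector swept out by rotating the ray from
  \<open>v\<close> to \<open>q\<close> counterclockwise by \<open>\<theta>\<close>, which brings it onto the ray from \<open>v\<close> to \<open>p\<close>. In particular
  the predicate fixes the orientation of the boundary.\<close>

definition interior_angle ::
    "ecomplex set \<Rightarrow> complex \<Rightarrow> complex \<Rightarrow> complex \<Rightarrow> real \<Rightarrow> bool" where
  "interior_angle D p v q \<theta> \<longleftrightarrow>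
     0 < \<theta> \<and> \<theta> < 2 * pi \<and> q \<noteq> v \<and>
     (\<exists>\<rho>>0. p - v = of_real \<rho> * cis \<theta> * (q - v)) \<and>
     (\<exists>\<epsilon>>0. \<forall>s \<phi>. 0 < s \<and> s < \<epsilon> \<and> 0 \<le> \<phi> \<and> \<phi> < 2 * pi \<longrightarrow>
        (Some (v + of_real s * cis \<phi> * (q - v)) \<in> D \<longleftrightarrow> 0 < \<phi> \<and> \<phi> < \<theta>))"

text \<open>The potential function of a quadrilateral whose four boundary arcs are straight segments.
  Boundary values are limits from inside \<open>D\<close>. On a segment from \<open>a\<close> to \<open>b\<close> the vector
  \<open>\<i> * (b - a)\<close> is normal to the boundary; its length and sign are irrelevant for the homogeneous
  Neumann condition.\<close>

definition potential_function ::
    "ecomplex set \<Rightarrow> complex \<Rightarrow> complex \<Rightarrow> complex \<Rightarrow> complex \<Rightarrow> (ecomplex \<Rightarrow> real) \<Rightarrow> bool" where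
  "potential_function D z1 z2 z3 z4 u \<longleftrightarrow>
     harmonic_sphere u D \<and> (\<forall>w\<in>D. 0 < u w \<and> u w < 1) \<and>
     (\<forall>p\<in>open_segment z4 z1. ((\<lambda>z. u (Some z)) \<longlongrightarrow> 0) (at p within Some -` D)) \<and>
     (\<forall>p\<in>open_segment z2 z3. ((\<lambda>z. u (Some z)) \<longlongrightarrow> 1) (at p within Some -` D)) \<and>
     (\<forall>(a, b)\<in>{(z1, z2), (z3, z4)}. \<forall>p\<in>open_segment a b.
        ((\<lambda>z. frechet_derivative (\<lambda>z. u (Some z)) (at z) (\<i> * (b - a))) \<longlongrightarrow> 0) (at p within Some -` D))"

section \<open>Elliptic integrals and the mapping formula\<close>

definition ellK :: "real \<Rightarrow> real" where
  "ellK r = integral {0..1} (\<lambda>x. 1 / sqrt ((1 - x^2) * (1 - r^2 * x^2)))"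

text \<open>If \<open>s\<close> lies in the open first quadrant then \<open>1 - s\<^sup>2\<close> and \<open>1 - r\<^sup>2 s\<^sup>2\<close> lie in the lower
  half plane, so the product of the two principal roots is the analytic branch of the root of the
  product which equals 1 at 0. (The principal root of the product would be the wrong branch.)\<close>

definition ellF :: "real \<Rightarrow> complex \<Rightarrow> complex" where
  "ellF r \<phi> = contour_integral (linepath 0 (sin \<phi>))
     (\<lambda>s. 1 / (csqrt (1 - s^2) * csqrt (1 - of_real (r^2) * s^2)))"

definition psi :: "real \<Rightarrow> complex \<Rightarrow> complex" where
  "psi r z = ellF r (Arcsin (csqrt z)) / of_real (ellK r)"

definition upper_half_plane :: "complex set" where
  "upper_half_plane = {z. Im z > 0}"

text \<open>The principal powers are analytic in the upper half plane, and since the principal argument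
  takes values in \<open>(-\<pi>, \<pi>]\<close>, their values on the real line are the continuous extension
  from the upper half plane.\<close>

definition sc_integrand ::
    "real \<Rightarrow> real \<Rightarrow> real \<Rightarrow> real \<Rightarrow> complex \<Rightarrow> complex \<Rightarrow> complex" where
  "sc_integrand \<alpha> \<beta> \<gamma> t z0 \<zeta> =
     \<zeta> powr of_real \<alpha> * (\<zeta> - 1) powr of_real \<beta> * (\<zeta> - of_real t) powr of_real \<gamma> /
     ((\<zeta> - z0)^2 * (\<zeta> - cnj z0)^2)"

end

theory Submission
  imports Defs
begin

text \<open>On each of the four real intervals cut out by \<open>0, 1, t\<close> the integrand of \<open>f\<close> has constant
  argument, and at these points the argument jumps by the turning angles of the quadrilateral. Since
  \<open>f\<close> maps the half plane onto \<open>D\<close>, the real axis is mapped into the polygon; hence the image of the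
  real axis can change direction only at a vertex, so that \<open>f t = z3\<close> and \<open>f \<infinity> = z4\<close>, and each interval
  is mapped onto one side.

  The function \<open>Re \<psi>\<close> lies between 0 and 1: after the substitution \<open>s = sin \<theta>\<close> the real part of \<open>F\<close>
  increases along horizontal and decreases along vertical lines of a half strip. Its boundary
  behaviour is explicit, so \<open>Re (\<psi> \<circ> f\<^sup>-\<^sup>1)\<close> is a potential function.

  For uniqueness write \<open>u \<circ> f = Re H\<close>. By reflection \<open>H'\<close> extends continuously to the real axis without
  \<open>0, 1, t\<close>, with imaginary values on the Dirichlet and real values on the Neumann intervals. So
  \<open>H'\<^sup>2 z (z - 1) (z - t)\<close> extends to the plane with nonnegative values on the real axis; boundedness of
  \<open>Re H\<close> gives \<open>|H'| = O(1 / Im z)\<close>, which limits the growth at the exceptional points, and the product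
  must be constant. The same holds for \<open>\<psi>'\<close>, so \<open>H\<close> is an affine function of \<open>\<psi>\<close>, and the Dirichlet
  data identify \<open>Re H\<close> with \<open>Re \<psi>\<close>.\<close>

section \<open>Reflection across the real axis\<close>

text \<open>The square of \<open>H'\<close> is what makes the reflections fit together. Across a
  Dirichlet interval \<open>H'\<close> continues by minus the conjugate, across a Neumann interval
  by the conjugate, so \<open>H'\<close> itself would become multivalued around 0, 1, t, whereas its
  square has a single continuation. The growth bound still permits simple poles at 0, 1, t and
  linear growth at infinity; each of these would make the product change sign on the real axis, and
  nonnegativity excludes them. In this way no condition at the vertices beyond 0 < u < 1 enters. The
  boundary conditions are pointwise limits and say nothing about the conjugate function or about
  continuity of the gradient. Hence reflection has to start from the limits of an imaginary part
  alone. Moreover these limits are taken in D, and they can be moved to the half plane and back only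
  once f is known to be continuous up to the sides (for uniqueness) and its inverse as well (for
  existence).\<close>

lemma mem_upper_half_plane [simp]: "z \<in> upper_half_plane \<longleftrightarrow> Im z > 0"
  by (simp add: upper_half_plane_def)

lemma open_upper_half_plane [simp, intro]: "open upper_half_plane"
  by (simp add: upper_half_plane_def open_halfspace_Im_gt)

lemma convex_upper_half_plane [simp, intro]: "convex upper_half_plane"
  by (simp add: upper_half_plane_def convex_halfspace_Im_gt)

lemma at_within_upper_half_plane_neq_bot:
  assumes "open S" "of_real x \<in> S"
  shows "at (of_real x) within (S \<inter> upper_half_plane) \<noteq> bot"
proof -
  obtain e where e: "e > 0" "ball (of_real x) e \<subseteq> S"
    using assms by (meson open_contains_ball)
  have "\<exists>y\<in>S \<inter> upper_half_plane. y \<noteq> of_real x \<and> dist y (of_real x) < d" if "d > 0" for d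
  proof (rule bexI[of _ "Complex x (min d e / 2)"])
    have "dist (Complex x (min d e / 2)) (of_real x) = min d e / 2"
      using that e by (simp add: dist_norm complex_norm complex_of_real_def complex_diff)
    then show "Complex x (min d e / 2) \<noteq> of_real x \<and> dist (Complex x (min d e / 2)) (of_real x) < d"
      using that e by (auto simp: complex_of_real_def)
    have "Complex x (min d e / 2) \<in> ball (of_real x) e"
      using \<open>dist _ _ = _\<close> that e by (simp add: dist_commute)
    then show "Complex x (min d e / 2) \<in> S \<inter> upper_half_plane"
      using that e by auto
  qed
  then show ?thesis
    by (subst trivial_limit_within) (auto simp: islimpt_approachable)
qed

lemma deriv_in_Reals:
  assumes hol: "f holomorphic_on A" "open A" and x: "of_real x \<in> A"
    and real: "\<And>y. of_real y \<in> A \<Longrightarrow> Im (f (of_real y)) = 0"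
  shows "Im (deriv f (of_real x)) = 0"
proof -
  have "(f has_field_derivative deriv f (of_real x)) (at (of_real x))"
    using hol x holomorphic_derivI by blast
  then have "((\<lambda>y. f (of_real y)) has_vector_derivative deriv f (of_real x)) (at x)"
    by (rule has_vector_derivative_real_field)
  then have 1: "((\<lambda>y. Im (f (of_real y))) has_real_derivative Im (deriv f (of_real x))) (at x)"
    unfolding has_real_derivative_iff_has_vector_derivative by (rule bounded_linear.has_vector_derivative[OF bounded_linear_Im])
  have "open ((of_real :: real \<Rightarrow> complex) -` A)"
    by (intro open_vimage \<open>open A\<close>) (auto intro: continuous_intros)
  then have ev: "\<forall>\<^sub>F y in nhds x. of_real y \<in> A"
    using x eventually_nhds_in_open[of "of_real -` A" x] by simp
  have "((\<lambda>y. 0) has_real_derivative Im (deriv f (of_real x))) (at x)"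
    using 1 by (rule DERIV_cong_ev[THEN iffD1, OF refl _ refl, rotated]) (use ev real in \<open>auto elim: eventually_mono\<close>)
  then show ?thesis
    using DERIV_unique DERIV_const by blast
qed

text \<open>Mean value inequality for the imaginary part alone: nothing is assumed about
  \<open>Re n\<close>, whose behaviour near the real axis is unknown. It is applied at small heights
  \<open>y\<close>, which then tend to 0.\<close>

lemma abs_Im_diff_le:
  fixes M n :: "complex \<Rightarrow> complex"
  assumes der: "\<And>s. s \<in> closed_segment a b \<Longrightarrow> (M has_field_derivative n (Complex s y)) (at (Complex s y))"
    and le: "\<And>s. s \<in> closed_segment a b \<Longrightarrow> \<bar>Im (n (Complex s y))\<bar> \<le> e"
  shows "\<bar>Im (M (Complex a y)) - Im (M (Complex b y))\<bar> \<le> e * \<bar>a - b\<bar>"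
proof -
  have d: "((\<lambda>s. Im (M (Complex s y))) has_real_derivative Im (n (Complex s y))) (at s within closed_segment a b)"
    if "s \<in> closed_segment a b" for s
  proof -
    have "((\<lambda>s. Complex s y) has_vector_derivative 1) (at s within closed_segment a b)"
      unfolding Complex_eq by (auto intro!: derivative_eq_intros)
    then have "((M \<circ> (\<lambda>s. Complex s y)) has_vector_derivative 1 * n (Complex s y)) (at s within closed_segment a b)"
      using der[OF that] by (intro field_vector_diff_chain_within) (auto intro: has_field_derivative_at_within)
    then show ?thesis
      unfolding has_real_derivative_iff_has_vector_derivative o_def
      using bounded_linear.has_vector_derivative[OF bounded_linear_Im] by fastforce
  qed
  have "norm (Im (M (Complex a y)) - Im (M (Complex b y))) \<le> e * norm (a - b)"
    by (rule field_differentiable_bound[OF convex_closed_segment d]) (use le in auto)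
  then show ?thesis by simp
qed

text \<open>Only \<open>Im n\<close> has boundary values, so \<open>n\<close> cannot be reflected
  directly. Its primitive is Lipschitz and extends continuously to the diameter, where the imaginary
  part turns out to be constant; after subtraction of that constant the primitive is reflected, and
  \<open>N\<close> is the derivative of the result.\<close>

lemma schwarz_reflection_bounded:
  fixes x0 R :: real
  assumes "R > 0" and hol: "n holomorphic_on (ball (of_real x0) R \<inter> upper_half_plane)"
    and bdd: "\<And>z. z \<in> ball (of_real x0) R \<inter> upper_half_plane \<Longrightarrow> norm (n z) \<le> B"
    and lim: "\<And>x. \<bar>x - x0\<bar> < R \<Longrightarrow> ((\<lambda>z. Im (n z)) \<longlongrightarrow> 0) (at (of_real x) within upper_half_plane)"
  obtains N where "N holomorphic_on ball (of_real x0) R"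
    "\<And>z. z \<in> ball (of_real x0) R \<Longrightarrow> Im z > 0 \<Longrightarrow> N z = n z"
    "\<And>x. of_real x \<in> ball (of_real x0 :: complex) R \<Longrightarrow> Im (N (of_real x)) = 0"
proof -
  define Bl where "Bl = ball (of_real x0 :: complex) R"
  define S where "S = Bl \<inter> upper_half_plane"
  have S: "open S" "convex S" unfolding S_def Bl_def by (auto intro: convex_Int)
  have holS: "n holomorphic_on S" using hol by (simp add: S_def Bl_def)
  obtain M where M: "\<And>z. z \<in> S \<Longrightarrow> (M has_field_derivative n z) (at z within S)"
    using holomorphic_convex_primitive'[OF S(2,1) holS] by metis
  have M': "(M has_field_derivative n z) (at z)" if "z \<in> S" for z
    using M[OF that] at_within_open[OF that S(1)] by simp
  have Lip: "norm (M z - M w) \<le> B * norm (z - w)" if "z \<in> S" "w \<in> S" for z w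
    by (rule field_differentiable_bound[OF S(2) M]) (use that bdd in \<open>auto simp: S_def Bl_def\<close>)
  have uc: "uniformly_continuous_on S M"
    unfolding uniformly_continuous_on_def
  proof (intro allI impI)
    fix e :: real assume e: "e > 0"
    show "\<exists>d>0. \<forall>x\<in>S. \<forall>x'\<in>S. dist x' x < d \<longrightarrow> dist (M x') (M x) < e"
    proof (intro exI[of _ "e / (\<bar>B\<bar> + 1)"] conjI ballI impI)
      show "e / (\<bar>B\<bar> + 1) > 0" using e by simp
      fix x x' assume "x \<in> S" "x' \<in> S" "dist x' x < e / (\<bar>B\<bar> + 1)"
      then have "norm (M x' - M x) \<le> B * norm (x' - x)" "(\<bar>B\<bar> + 1) * norm (x' - x) < e"
        using Lip by (auto simp: dist_norm field_simps)
      moreover have "B * norm (x' - x) \<le> (\<bar>B\<bar> + 1) * norm (x' - x)"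
        by (intro mult_right_mono) auto
      ultimately show "dist (M x') (M x) < e" by (simp add: dist_norm)
    qed
  qed
  have "\<exists>g. uniformly_continuous_on (closure S) g \<and> (\<forall>x\<in>S. M x = g x)"
    by (rule uniformly_continuous_on_extension_on_closure[OF uc]) auto
  then obtain Mb where Mb: "uniformly_continuous_on (closure S) Mb" "\<And>z. z \<in> S \<Longrightarrow> M z = Mb z"
    by blast
  have real_in: "of_real x \<in> Bl \<longleftrightarrow> \<bar>x - x0\<bar> < R" for x
    by (simp add: Bl_def dist_norm abs_minus_commute flip: of_real_diff)
  have cl: "Bl \<inter> {z. 0 \<le> Im z} \<subseteq> closure S"
  proof
    fix z assume z: "z \<in> Bl \<inter> {z. 0 \<le> Im z}"
    have "closure (Bl \<inter> upper_half_plane) \<supseteq> Bl \<inter> closure upper_half_plane"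
      by (simp add: Bl_def open_Int_closure_subset)
    moreover have "z \<in> closure upper_half_plane"
      using z closure_halfspace_gt[of "\<i>" 0] by (auto simp: upper_half_plane_def inner_complex_def)
    ultimately show "z \<in> closure S" using z by (auto simp: S_def)
  qed
  have contMb: "continuous_on (Bl \<inter> {z. 0 \<le> Im z}) Mb"
    using Mb(1) cl continuous_on_subset uniformly_continuous_imp_continuous by blast
  have limMb: "((\<lambda>y. Mb (Complex x y)) \<longlongrightarrow> Mb (of_real x)) (at_right 0)" if x: "\<bar>x - x0\<bar> < R" for x
  proof -
    have "(Mb \<longlongrightarrow> Mb (of_real x)) (at (of_real x) within (Bl \<inter> {z. 0 \<le> Im z}))"
      using contMb x real_in by (auto simp: continuous_on_def)
    moreover have "filterlim (\<lambda>y. Complex x y) (at (of_real x) within (Bl \<inter> {z. 0 \<le> Im z})) (at_right 0)"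
      unfolding filterlim_at
    proof
      have "((\<lambda>y. Complex x y) \<longlongrightarrow> Complex x 0) (at_right 0)"
        unfolding Complex_eq by (auto intro!: tendsto_eq_intros)
      then have t: "((\<lambda>y. Complex x y) \<longlongrightarrow> of_real x) (at_right 0)" by (simp add: complex_of_real_def)
      then show "((\<lambda>y. Complex x y) \<longlongrightarrow> of_real x) (at_right 0)" .
      have "\<forall>\<^sub>F y in at_right 0. Complex x y \<in> Bl"
        using topological_tendstoD[OF t, of Bl] x real_in by (auto simp: Bl_def)
      moreover have "\<forall>\<^sub>F y in at_right 0. (0::real) < y"
        by (simp add: eventually_at_right_less)
      ultimately show "\<forall>\<^sub>F y in at_right 0. Complex x y \<in> Bl \<inter> {z. 0 \<le> Im z} \<and> Complex x y \<noteq> of_real x"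
        by eventually_elim (auto simp: complex_eq_iff)
    qed
    ultimately show ?thesis by (rule filterlim_compose)
  qed
  \<comment> \<open>The difference quotient on the real axis is the limit of those at height
    \<open>v\<close>; there the increment of the imaginary part is at most \<open>e\<close> times
    the length, since \<open>Im n\<close> is below \<open>e\<close> near \<open>x\<close>.\<close>
  have dz: "((\<lambda>x. Im (Mb (of_real x))) has_real_derivative 0) (at x)" if x: "\<bar>x - x0\<bar> < R" for x
    unfolding has_field_derivative_def has_derivative_at_alt
  proof (intro conjI allI impI)
    show "bounded_linear ((*) (0::real))" by (rule bounded_linear_mult_right)
    fix e :: real assume e: "e > 0"
    have "\<forall>\<^sub>F z in at (of_real x) within upper_half_plane. \<bar>Im (n z)\<bar> < e"
      using tendstoD[OF lim[OF x] e] by simp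
    then obtain d0 where d0: "d0 > 0" "\<And>z. Im z > 0 \<Longrightarrow> dist z (of_real x) < d0 \<Longrightarrow> \<bar>Im (n z)\<bar> < e"
      unfolding eventually_at by (metis complex_of_real_def complex.sel(2) less_irrefl mem_upper_half_plane)
    obtain d1 where d1: "d1 > 0" "ball (of_real x) d1 \<subseteq> Bl"
      using x real_in Bl_def by (meson open_ball open_contains_ball)
    \<comment> \<open>Half the radius: the points \<open>Complex s v\<close> used below lie within
      \<open>2 * d\<close> of \<open>x\<close>.\<close>
    define d where "d = min d0 d1 / 2"
    have d: "d > 0" using d0 d1 by (simp add: d_def)
    show "\<exists>d>0. \<forall>y. norm (y - x) < d \<longrightarrow>
       norm (Im (Mb (of_real y)) - Im (Mb (of_real x)) - 0 * (y - x)) \<le> e * norm (y - x)"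
    proof (intro exI[of _ d] conjI d allI impI)
      fix y assume y: "norm (y - x) < d"
      have near: "dist (Complex s v) (of_real x) < 2 * d" if "s \<in> closed_segment y x" "0 < v" "v < d" for s v
      proof -
        have "norm (Complex (s - x) v) \<le> \<bar>s - x\<bar> + \<bar>v\<bar>" by (metis cmod_le complex.sel)
        moreover have "\<bar>s - x\<bar> < d" using that(1) y by (auto simp: closed_segment_eq_real_ivl split: if_splits)
        ultimately show ?thesis using that by (simp add: dist_norm complex_of_real_def complex_diff)
      qed
      have inS: "Complex s v \<in> S" "\<bar>Im (n (Complex s v))\<bar> < e" if "s \<in> closed_segment y x" "0 < v" "v < d" for s v
      proof -
        have "Complex s v \<in> ball (of_real x) d1" "dist (Complex s v) (of_real x) < d0"
          using near[OF that] by (auto simp: d_def dist_commute)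
        then show "Complex s v \<in> S" "\<bar>Im (n (Complex s v))\<bar> < e"
          using d1 d0(2) that by (auto simp: S_def)
      qed
      have yR: "\<bar>y - x0\<bar> < R"
      proof -
        have xy: "\<bar>x - y\<bar> < d1"
          using y d0(1) d1(1) unfolding d_def by (simp add: abs_minus_commute)
        have "(of_real y :: complex) \<in> ball (of_real x) d1"
          using xy by (simp add: dist_norm flip: of_real_diff)
        then show ?thesis using d1 real_in by blast
      qed
      have "\<bar>Im (Mb (of_real y)) - Im (Mb (of_real x))\<bar> \<le> e * \<bar>y - x\<bar>"
      proof (rule tendsto_le[OF trivial_limit_at_right_real tendsto_const])
        show "((\<lambda>v. \<bar>Im (Mb (Complex y v)) - Im (Mb (Complex x v))\<bar>) \<longlongrightarrow>
           \<bar>Im (Mb (of_real y)) - Im (Mb (of_real x))\<bar>) (at_right 0)"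
          by (intro tendsto_intros limMb x yR)
        have "\<forall>\<^sub>F v in at_right 0. v < d" "\<forall>\<^sub>F v in at_right 0. (0::real) < v"
          using d by (auto simp: eventually_at_right_less eventually_at_right_field)
        then show "\<forall>\<^sub>F v in at_right 0. \<bar>Im (Mb (Complex y v)) - Im (Mb (Complex x v))\<bar> \<le> e * \<bar>y - x\<bar>"
        proof eventually_elim
          case (elim v)
          have "\<bar>Im (M (Complex y v)) - Im (M (Complex x v))\<bar> \<le> e * \<bar>y - x\<bar>"
            by (rule abs_Im_diff_le[where n = n]) (use inS elim M' in \<open>auto intro: less_imp_le\<close>)
          then show ?case using Mb(2) inS(1)[of y v] inS(1)[of x v] elim by simp
        qed
      qed
      then show "norm (Im (Mb (of_real y)) - Im (Mb (of_real x)) - 0 * (y - x)) \<le> e * norm (y - x)"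
        by simp
    qed
  qed
  define c where "c = Im (Mb (of_real x0))"
  have const: "Im (Mb (of_real x)) = c" if x: "\<bar>x - x0\<bar> < R" for x
  proof -
    have "\<exists>k. \<forall>x\<in>ball x0 R. Im (Mb (of_real x)) = k"
      by (rule has_field_derivative_zero_constant)
        (use dz in \<open>auto intro: has_field_derivative_at_within simp: dist_real_def abs_minus_commute\<close>)
    then show ?thesis using x assms(1) by (auto simp: c_def dist_real_def abs_minus_commute)
  qed
  define M1 where "M1 = (\<lambda>z. Mb z - \<i> * of_real c)"
  define M2 where "M2 = (\<lambda>z. if 0 \<le> Im z then M1 z else cnj (M1 (cnj z)))"
  have M2S: "M2 z = M z - \<i> * of_real c" if "z \<in> S" for z
    using that Mb(2) by (auto simp: M2_def M1_def S_def)
  have holM2: "M2 holomorphic_on Bl"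
    unfolding M2_def
  proof (rule Schwarz_reflection)
    show "open Bl" by (simp add: Bl_def)
    show "cnj ` Bl \<subseteq> Bl"
    proof
      fix w assume "w \<in> cnj ` Bl"
      then obtain z where z: "w = cnj z" "z \<in> Bl" by auto
      have "norm (of_real x0 - cnj z) = norm (of_real x0 - z)"
        by (metis complex_cnj_complex_of_real complex_cnj_diff complex_mod_cnj)
      then show "w \<in> Bl" using z by (simp add: Bl_def dist_norm)
    qed
    have "M holomorphic_on S"
      using M by (auto simp: holomorphic_on_def field_differentiable_def)
    then have "Mb holomorphic_on S" by (rule holomorphic_transform) (rule Mb(2))
    then show "M1 holomorphic_on Bl \<inter> {z. 0 < Im z}"
      unfolding M1_def S_def upper_half_plane_def by (intro holomorphic_intros)
    show "continuous_on (Bl \<inter> {z. 0 \<le> Im z}) M1"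
      unfolding M1_def by (intro continuous_intros contMb)
    show "M1 z \<in> \<real>" if "z \<in> Bl" and zR: "z \<in> \<real>" for z
    proof -
      obtain x where x: "z = of_real x" using zR by (auto elim: Reals_cases)
      then have "Im (Mb z) = c" using that(1) const real_in by blast
      then show ?thesis by (simp add: M1_def complex_is_Real_iff)
    qed
  qed
  show ?thesis
  proof (rule that[of "deriv M2"])
    show "deriv M2 holomorphic_on ball (of_real x0) R"
      using holM2 by (auto simp: Bl_def intro: holomorphic_deriv)
    show "deriv M2 z = n z" if "z \<in> ball (of_real x0) R" "Im z > 0" for z
    proof (rule DERIV_imp_deriv)
      have z: "z \<in> S" using that by (simp add: S_def Bl_def)
      have "((\<lambda>z. M z - \<i> * of_real c) has_field_derivative n z) (at z)"
        using M'[OF z] by (auto intro!: derivative_eq_intros)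
      then show "(M2 has_field_derivative n z) (at z)"
        by (rule has_field_derivative_transform_within_open[OF _ S(1) z]) (simp add: M2S)
    qed
    show "Im (deriv M2 (of_real x)) = 0" if "of_real x \<in> ball (of_real x0 :: complex) R" for x
    proof (rule deriv_in_Reals[OF holM2])
      show "Im (M2 (of_real y)) = 0" if "of_real y \<in> Bl" for y
        using const that real_in by (simp add: M2_def M1_def)
    qed (use that in \<open>auto simp: Bl_def\<close>)
  qed
qed

text \<open>Near \<open>x0\<close> the function \<open>m\<close> takes values in a horizontal strip
  of width less than pi, but \<open>Re m\<close> may be unbounded. The function \<open>n\<close>,
  which is tanh of m/2, is bounded and has an imaginary part no larger in modulus. After reflection
  the inverse of tanh leads back, provided that the reflected function stays strictly inside the
  unit disc.\<close>

lemma schwarz_reflection_Im: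
  fixes x0 R :: real
  assumes "R > 0" and hol: "m holomorphic_on upper_half_plane"
    and lim: "\<And>x. \<bar>x - x0\<bar> < R \<Longrightarrow> ((\<lambda>z. Im (m z)) \<longlongrightarrow> 0) (at (of_real x) within upper_half_plane)"
  obtains N \<rho> where "\<rho> > 0" "\<rho> \<le> R" "N holomorphic_on ball (of_real x0) \<rho>"
    "\<And>z. z \<in> ball (of_real x0) \<rho> \<Longrightarrow> Im z > 0 \<Longrightarrow> N z = m z"
    "\<And>x. of_real x \<in> ball (of_real x0 :: complex) \<rho> \<Longrightarrow> Im (N (of_real x)) = 0"
proof -
  have "\<forall>\<^sub>F z in at (of_real x0) within upper_half_plane. \<bar>Im (m z)\<bar> < 1"
    using tendstoD[OF lim, of x0 1] assms(1) by simp
  then obtain d where d: "d > 0" "\<And>z. Im z > 0 \<Longrightarrow> dist z (of_real x0) < d \<Longrightarrow> \<bar>Im (m z)\<bar> < 1"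
    unfolding eventually_at by (metis complex_of_real_def complex.sel(2) less_irrefl mem_upper_half_plane)
  define \<rho> where "\<rho> = min d R"
  have \<rho>: "\<rho> > 0" "\<rho> \<le> R" "\<rho> \<le> d" using d assms by (auto simp: \<rho>_def)
  define Bl where "Bl = ball (of_real x0 :: complex) \<rho>"
  have Bl: "open Bl" "connected Bl" by (auto simp: Bl_def)
  have real_in: "of_real x \<in> Bl \<longleftrightarrow> \<bar>x - x0\<bar> < \<rho>" for x
    by (simp add: Bl_def dist_norm abs_minus_commute flip: of_real_diff)
  have Im1: "\<bar>Im (m z)\<bar> < 1" if "z \<in> Bl" "Im z > 0" for z
    using d(2)[of z] that \<rho> by (auto simp: Bl_def dist_commute)
  have Re_exp: "Re (exp (m z)) > 0" if "z \<in> Bl" "Im z > 0" for z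
  proof -
    have "cos (Im (m z)) > 0"
      using Im1[OF that] pi_gt3 by (intro cos_gt_zero_pi) auto
    then show ?thesis by (simp add: Re_exp)
  qed
  txt \<open>A Moebius transformation after the exponential turns \<open>m\<close> into a bounded function.\<close>
  define n where "n = (\<lambda>z. (exp (m z) - 1) / (exp (m z) + 1))"
  have ne: "exp (m z) + 1 \<noteq> 0" if "z \<in> Bl" "Im z > 0" for z
    using Re_exp[OF that] by (metis add.commute add_pos_pos complex_Re_numeral less_irrefl one_complex.sel(1) plus_complex.sel(1) zero_complex.sel(1) zero_less_one)
  have n_less: "norm (n z) < 1" if "z \<in> Bl" "Im z > 0" for z
  proof -
    have "(norm (exp (m z) - 1))\<^sup>2 < (norm (exp (m z) + 1))\<^sup>2"
      using Re_exp[OF that] unfolding cmod_power2 by (simp add: power2_eq_square algebra_simps)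
    then have "norm (exp (m z) - 1) < norm (exp (m z) + 1)"
      by (meson norm_ge_zero power2_less_imp_less)
    then show ?thesis
      using ne[OF that] by (simp add: n_def norm_divide)
  qed
  have Im_n: "\<bar>Im (n z)\<bar> \<le> \<bar>Im (m z)\<bar>" if "z \<in> Bl" "Im z > 0" for z
  proof -
    define w where "w = exp (m z)"
    have w: "Re w > 0" "w + 1 \<noteq> 0" using Re_exp ne that by (auto simp: w_def)
    have "Im (n z) = 2 * Im w / (norm (w + 1))\<^sup>2"
      unfolding n_def w_def[symmetric]
      unfolding cmod_power2 by (simp add: Im_divide algebra_simps)
    then have eq: "\<bar>Im (n z)\<bar> = 2 * \<bar>Im w\<bar> / (norm (w + 1))\<^sup>2"
      by (simp add: abs_mult)
    \<comment> \<open>The factor 2 |w| / |w + 1|^2 that governs \<open>Im n\<close> is at most 1: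
      first the arithmetic-geometric mean inequality, then \<open>Re w > 0\<close>.\<close>
    have "2 * norm w \<le> 1 + (norm w)\<^sup>2"
      using sum_squares_bound[of "norm w" 1] by simp
    also have "\<dots> \<le> (norm (w + 1))\<^sup>2"
      using w unfolding cmod_power2 by (simp add: power2_eq_square algebra_simps)
    finally have le: "2 * norm w \<le> (norm (w + 1))\<^sup>2" .
    have "\<bar>Im w\<bar> = norm w * \<bar>sin (Im (m z))\<bar>"
      by (simp add: w_def Im_exp abs_mult)
    also have "\<dots> \<le> norm w * \<bar>Im (m z)\<bar>"
      by (intro mult_left_mono abs_sin_x_le_abs_x) auto
    finally have "2 * \<bar>Im w\<bar> \<le> 2 * norm w * \<bar>Im (m z)\<bar>" by simp
    also have "\<dots> \<le> (norm (w + 1))\<^sup>2 * \<bar>Im (m z)\<bar>"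
      using le by (intro mult_right_mono) auto
    finally show ?thesis
      using w(2) unfolding eq by (simp add: divide_simps mult.commute)
  qed
  have holn: "n holomorphic_on (Bl \<inter> upper_half_plane)"
    unfolding n_def using ne by (intro holomorphic_intros holomorphic_on_subset[OF hol]) auto
  have limn: "((\<lambda>z. Im (n z)) \<longlongrightarrow> 0) (at (of_real x) within upper_half_plane)" if "\<bar>x - x0\<bar> < \<rho>" for x
  proof (rule Lim_null_comparison)
    have "\<bar>x - x0\<bar> < R" using that \<rho> by simp
    from tendsto_rabs[OF lim[OF this]]
    show "((\<lambda>z. \<bar>Im (m z)\<bar>) \<longlongrightarrow> 0) (at (of_real x) within upper_half_plane)" by simp
    have "\<forall>\<^sub>F z in at (of_real x) within upper_half_plane. z \<in> Bl"
      using that real_in Bl(1) eventually_at_topological by blast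
    moreover have "\<forall>\<^sub>F z in at (of_real x) within upper_half_plane. z \<in> upper_half_plane"
      by (auto simp: eventually_at_filter)
    ultimately show "\<forall>\<^sub>F z in at (of_real x) within upper_half_plane. norm (Im (n z)) \<le> \<bar>Im (m z)\<bar>"
      by eventually_elim (use Im_n in auto)
  qed
  obtain N0 where N0: "N0 holomorphic_on Bl" "\<And>z. z \<in> Bl \<Longrightarrow> Im z > 0 \<Longrightarrow> N0 z = n z"
    "\<And>x. of_real x \<in> Bl \<Longrightarrow> Im (N0 (of_real x)) = 0"
    using schwarz_reflection_bounded[OF \<rho>(1) holn[unfolded Bl_def] _ limn, of 1] n_less
    unfolding Bl_def by (metis IntE less_imp_le mem_upper_half_plane)
  \<comment> \<open>\<open>N0\<close> is controlled only above and on the diameter. Below, it is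
    replaced by its mirror image, which carries the bound by 1 to the lower half.\<close>
  define N where "N = (\<lambda>z. if 0 \<le> Im z then N0 z else cnj (N0 (cnj z)))"
  have cnj_in: "cnj z \<in> Bl" if "z \<in> Bl" for z
  proof -
    have "norm (of_real x0 - cnj z) = norm (of_real x0 - z)"
      by (metis complex_cnj_complex_of_real complex_cnj_diff complex_mod_cnj)
    then show ?thesis using that by (simp add: Bl_def dist_norm)
  qed
  have holN: "N holomorphic_on Bl"
    unfolding N_def
  proof (rule Schwarz_reflection)
    show "N0 z \<in> \<real>" if "z \<in> Bl" and zR: "z \<in> \<real>" for z
    proof -
      obtain x where x: "z = of_real x" using zR by (auto elim: Reals_cases)
      then show ?thesis using that(1) N0(3) by (simp add: complex_is_Real_iff)
    qed
  qed (use Bl N0 cnj_in in \<open>auto intro: holomorphic_on_subset continuous_on_subset holomorphic_on_imp_continuous_on\<close>)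
  have N_up: "N z = n z" if "z \<in> Bl" "Im z > 0" for z
    using that N0(2) by (simp add: N_def)
  have N_real: "Im (N (of_real x)) = 0" if "of_real x \<in> Bl" for x
    using that N0(3) by (simp add: N_def)
  have less_nonreal: "norm (N z) < 1" if "z \<in> Bl" "Im z \<noteq> 0" for z
  proof (cases "Im z > 0")
    case True then show ?thesis using that n_less N_up by simp
  next
    case False
    then have "norm (N z) = norm (N0 (cnj z))" using that by (simp add: N_def)
    also have "\<dots> < 1" using n_less[of "cnj z"] N0(2)[of "cnj z"] cnj_in that False by simp
    finally show ?thesis .
  qed
  have le: "norm (N (of_real x)) \<le> 1" if x: "of_real x \<in> Bl" for x
  proof (rule tendsto_upperbound)
    have "isCont N (of_real x)"
      using holN Bl x holomorphic_on_imp_continuous_on continuous_on_eq_continuous_at by blast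
    then show "((\<lambda>z. norm (N z)) \<longlongrightarrow> norm (N (of_real x))) (at (of_real x) within (Bl \<inter> upper_half_plane))"
      unfolding isCont_def by (intro tendsto_norm) (rule tendsto_within_subset[OF _ subset_UNIV])
    show "\<forall>\<^sub>F z in at (of_real x) within (Bl \<inter> upper_half_plane). norm (N z) \<le> 1"
      using less_nonreal by (auto simp: eventually_at_filter intro!: always_eventually less_imp_le)
    show "at (of_real x) within (Bl \<inter> upper_half_plane) \<noteq> bot"
      by (rule at_within_upper_half_plane_neq_bot) (use Bl x in auto)
  qed
  \<comment> \<open>Strictness at real points: modulus 1 there would, by the maximum principle, make
    \<open>N\<close> constant, against the strict bound at a point above the diameter.\<close>
  have less: "norm (N z) < 1" if z: "z \<in> Bl" for z
  proof (rule ccontr)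
    assume "\<not> norm (N z) < 1"
    then have "Im z = 0" using less_nonreal z by blast
    have all: "norm (N w) \<le> 1" if "w \<in> Bl" for w
    proof (cases "Im w = 0")
      case True then have "w = of_real (Re w)" by (simp add: complex_eq_iff)
      then show ?thesis using le that by metis
    qed (use less_nonreal that in force)
    have "N constant_on Bl"
      by (rule maximum_modulus_principle[OF holN Bl(1,2) Bl(1) order.refl z])
        (use all \<open>\<not> norm (N z) < 1\<close> in force)
    then obtain k where k: "\<And>w. w \<in> Bl \<Longrightarrow> N w = k" by (auto simp: constant_on_def)
    have "Complex x0 (\<rho>/2) \<in> Bl"
      using \<rho> by (simp add: Bl_def dist_norm complex_of_real_def complex_diff complex_norm)
    then have "norm k < 1" using k less_nonreal[of "Complex x0 (\<rho>/2)"] \<rho> by force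
    then show False using k z \<open>\<not> norm (N z) < 1\<close> by simp
  qed
  \<comment> \<open>The inverse Moebius map sends the unit disc into the right half plane, so the
    principal logarithm taken below is holomorphic.\<close>
  have pos: "Re ((1 + N z) / (1 - N z)) > 0" if z: "z \<in> Bl" for z
  proof -
    have "1 - N z \<noteq> 0" using less[OF z] by auto
    moreover have "(Re (N z))\<^sup>2 + (Im (N z))\<^sup>2 < 1"
      using less[OF z] by (metis cmod_power2 norm_ge_zero one_power2 power2_less_imp_less power_strict_mono zero_less_numeral pos2)
    moreover have "Re ((1 + N z) / (1 - N z)) = (1 - ((Re (N z))\<^sup>2 + (Im (N z))\<^sup>2)) / (norm (1 - N z))\<^sup>2"
      unfolding cmod_power2 Re_divide by (simp add: power2_eq_square algebra_simps)
    ultimately show ?thesis by simp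
  qed
  show ?thesis
  proof (rule that[of \<rho> "\<lambda>z. Ln ((1 + N z) / (1 - N z))"])
    have ne1: "1 - N z \<noteq> 0" if "z \<in> Bl" for z using less[OF that] by auto
    have "(1 + N z) / (1 - N z) \<notin> \<real>\<^sub>\<le>\<^sub>0" if "z \<in> Bl" for z
      using pos[OF that] by (auto simp: complex_nonpos_Reals_iff)
    then show "(\<lambda>z. Ln ((1 + N z) / (1 - N z))) holomorphic_on ball (of_real x0) \<rho>"
      unfolding Bl_def[symmetric] using ne1 by (intro holomorphic_intros holN) auto
    show "Ln ((1 + N z) / (1 - N z)) = m z" if "z \<in> ball (of_real x0) \<rho>" "Im z > 0" for z
    proof -
      have z: "z \<in> Bl" using that by (simp add: Bl_def)
      have "(1 + N z) / (1 - N z) = exp (m z)"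
      proof -
        have w: "exp (m z) + 1 \<noteq> 0" using ne[OF z that(2)] .
        have "1 + n z = 2 * exp (m z) / (exp (m z) + 1)" "1 - n z = 2 / (exp (m z) + 1)"
          using w by (simp_all add: n_def divide_simps)
        then show ?thesis using w by (simp add: N_up[OF z that(2)])
      qed
      moreover have "Ln (exp (m z)) = m z"
        using Im1[OF z that(2)] pi_gt3 by (intro Ln_exp) auto
      ultimately show ?thesis by simp
    qed
    show "Im (Ln ((1 + N (of_real x)) / (1 - N (of_real x)))) = 0"
      if "of_real x \<in> ball (of_real x0 :: complex) \<rho>" for x
    proof -
      have x: "of_real x \<in> Bl" using that by (simp add: Bl_def)
      define v where "v = (1 + N (of_real x)) / (1 - N (of_real x))"
      have "Im v = 0" using N_real[OF x] by (simp add: v_def Im_divide)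
      then have "v = of_real (Re v)" by (simp add: complex_eq_iff)
      moreover have "Re v > 0" using pos[OF x] by (simp add: v_def)
      ultimately have "Im (Ln v) = 0" by (metis Im_complex_of_real Ln_of_real)
      then show ?thesis by (simp add: v_def)
    qed
  qed (use \<rho> in auto)
qed

section \<open>A Liouville theorem for squares that are real on the real axis\<close>

text \<open>The bound \<open>A / (Im z)\<^sup>2\<close> gives no control near the real axis. A
  polynomial factor that vanishes at the two real points of the circle compensates the blow-up
  there, and the maximum principle carries the resulting bound into the disc.\<close>

lemma Im_square_bound_local:
  fixes q :: "complex \<Rightarrow> complex" and x \<rho> A :: real
  assumes "\<rho> > 0" and hol: "q holomorphic_on cball (of_real x) \<rho>"
    and le: "\<And>z. z \<in> cball (of_real x) \<rho> \<Longrightarrow> Im z \<noteq> 0 \<Longrightarrow> norm (q z) \<le> A / (Im z)\<^sup>2"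
    and z: "dist z (of_real x) \<le> \<rho> / 2"
  shows "norm (q z) \<le> 64 * A / (9 * \<rho>\<^sup>2)"
proof -
  define g where "g = (\<lambda>w. q w * ((w - of_real x)\<^sup>2 - of_real (\<rho>\<^sup>2))\<^sup>2)"
  have A: "A \<ge> 0"
  proof -
    define w where "w = of_real x + \<i> * of_real \<rho>"
    have "norm (q w) \<le> A / (Im w)\<^sup>2"
      using \<open>\<rho> > 0\<close> by (intro le) (auto simp: w_def dist_norm norm_mult)
    then have "0 \<le> A / (Im w)\<^sup>2" using norm_ge_zero order_trans by blast
    then show ?thesis using \<open>\<rho> > 0\<close> by (simp add: w_def zero_le_divide_iff)
  qed
  txt \<open>On the circle of radius \<open>\<rho>\<close> about \<open>x\<close> the quadratic factor equals \<open>2 \<rho> |Im w|\<close> in modulus.\<close>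
  have sphere: "norm (g w) \<le> 4 * A * \<rho>\<^sup>2" if w: "w \<in> frontier (cball (of_real x) \<rho>)" for w
  proof -
    have wn: "norm (w - of_real x) = \<rho>" using w by (simp add: dist_norm norm_minus_commute)
    define v where "v = w - of_real x"
    have "v * cnj v = of_real (\<rho>\<^sup>2)" using wn complex_norm_square[of v] by (simp add: v_def)
    then have "v\<^sup>2 - of_real (\<rho>\<^sup>2) = v * (v - cnj v)" by (simp add: power2_eq_square algebra_simps)
    also have "v - cnj v = of_real (2 * Im w) * \<i>" by (simp add: complex_eq_iff v_def)
    finally have n: "norm (v\<^sup>2 - of_real (\<rho>\<^sup>2)) = \<rho> * (2 * \<bar>Im w\<bar>)"
      using wn by (simp add: norm_mult v_def)
    have ng: "norm (g w) = norm (q w) * (\<rho> * (2 * \<bar>Im w\<bar>))\<^sup>2"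
      using n by (simp add: g_def norm_mult norm_power v_def)
    show ?thesis
    proof (cases "Im w = 0")
      case False
      have "norm (g w) \<le> A / (Im w)\<^sup>2 * (\<rho> * (2 * \<bar>Im w\<bar>))\<^sup>2"
        unfolding ng using le[OF _ False] w \<open>\<rho> > 0\<close> by (intro mult_right_mono) auto
      also have "\<dots> = 4 * A * \<rho>\<^sup>2" using False by (simp add: power_mult_distrib)
      finally show ?thesis .
    qed (use A ng in auto)
  qed
  have gz: "norm (g z) \<le> 4 * A * \<rho>\<^sup>2"
  proof (rule maximum_modulus_frontier[of g "cball (of_real x) \<rho>"])
    have "g holomorphic_on cball (of_real x) \<rho>" unfolding g_def by (intro holomorphic_intros hol)
    then show "g holomorphic_on interior (cball (of_real x) \<rho>)"
      "continuous_on (closure (cball (of_real x) \<rho>)) g"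
      by (auto intro: holomorphic_on_subset holomorphic_on_imp_continuous_on)
  qed (use sphere z \<open>\<rho> > 0\<close> in \<open>auto simp: dist_commute\<close>)
  have "norm ((z - of_real x)\<^sup>2) \<le> (\<rho>/2)\<^sup>2"
    unfolding norm_power using z by (intro power_mono) (auto simp: dist_norm)
  moreover have "norm (of_real (\<rho>\<^sup>2) :: complex) - norm ((z - of_real x)\<^sup>2) \<le> norm ((z - of_real x)\<^sup>2 - of_real (\<rho>\<^sup>2))"
    by (metis norm_minus_commute norm_triangle_ineq2)
  \<comment> \<open>In the concentric disc of half the radius the factor is, before squaring, at
    least (1 - 1/4) \<rho>^2; together with \<open>4 * A * \<rho>\<^sup>2\<close> this gives the
    constant 4 / (3/4)^2 = 64/9.\<close>
  ultimately have "3/4 * \<rho>\<^sup>2 \<le> norm ((z - of_real x)\<^sup>2 - of_real (\<rho>\<^sup>2))"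
    by (simp add: power_divide norm_power)
  then have "norm (q z) * (3/4 * \<rho>\<^sup>2)\<^sup>2 \<le> norm (g z)"
    unfolding g_def norm_mult norm_power by (intro mult_left_mono power_mono) auto
  with gz have "norm (q z) * (3/4 * \<rho>\<^sup>2)\<^sup>2 \<le> 4 * A * \<rho>\<^sup>2" by linarith
  then show ?thesis using \<open>\<rho> > 0\<close> by (simp add: divide_simps power2_eq_square) 
qed

text \<open>Trades the distance to the real axis for the distance to \<open>c\<close>. Points well
  off the axis satisfy the bound directly, with constant 16; the others lie in a disc centred on the
  axis to which the local estimate applies, with constant 64 * 4 / 9 < 29.\<close>

lemma Im_square_bound_punctured:
  fixes q :: "complex \<Rightarrow> complex" and c A :: real
  assumes "z \<noteq> of_real c"
    and hol: "q holomorphic_on {w. norm (z - of_real c) / 4 \<le> norm (w - of_real c) \<and> norm (w - of_real c) \<le> 2 * norm (z - of_real c)}"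
      (is "q holomorphic_on ?S")
    and le: "\<And>z. Im z \<noteq> 0 \<Longrightarrow> norm (q z) \<le> A / (Im z)\<^sup>2"
  shows "norm (q z) \<le> 29 * A / (norm (z - of_real c))\<^sup>2"
proof -
  define R where "R = norm (z - of_real c)"
  have R: "R > 0" using assms(1) by (simp add: R_def)
  have A: "A \<ge> 0" using le[of \<i>] norm_ge_zero order_trans by (simp; blast)
  define x where "x = Re z"
  show ?thesis
  proof (cases "\<bar>Im z\<bar> \<ge> R / 4")
    case True
    then have Im: "Im z \<noteq> 0" using R by auto
    have "(R/4)\<^sup>2 \<le> (Im z)\<^sup>2" using True R by (metis abs_le_square_iff abs_of_nonneg divide_nonneg_nonneg less_imp_le zero_le_numeral)
    have "norm (q z) \<le> A / (Im z)\<^sup>2" using le Im by blast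
    also have "\<dots> \<le> A / (R/4)\<^sup>2" using \<open>(R/4)\<^sup>2 \<le> (Im z)\<^sup>2\<close> A R by (intro divide_left_mono mult_pos_pos) (auto simp: Im)
    also have "\<dots> = 16 * A / R\<^sup>2" by (simp add: power_divide)
    also have "\<dots> \<le> 29 * A / R\<^sup>2" using A by (intro divide_right_mono) auto
    finally show ?thesis by (simp add: R_def)
  next
    case False
    have "R \<le> \<bar>x - c\<bar> + \<bar>Im z\<bar>" using cmod_le[of "z - of_real c"] by (simp add: R_def x_def)
    then have x1: "\<bar>x - c\<bar> \<ge> 3/4 * R" using False by simp
    have x2: "\<bar>x - c\<bar> \<le> R" using abs_Re_le_cmod[of "z - of_real c"] by (simp add: R_def x_def)
    \<comment> \<open>Since |x - c| lies between 3R/4 and R, points of this disc have distance from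
      \<open>c\<close> between |x - c| / 3 >= R/4 and 5 |x - c| / 3 < 2R. Moreover \<rho> >= R/2, so
      that \<open>z\<close> lies within \<rho>/2 of \<open>x\<close>.\<close>
    define \<rho> where "\<rho> = 2 * \<bar>x - c\<bar> / 3"
    have \<rho>: "\<rho> > 0" "\<rho> \<ge> R / 2" using x1 R by (auto simp: \<rho>_def)
    have sub: "cball (of_real x) \<rho> \<subseteq> ?S"
    proof
      fix w :: complex assume "w \<in> cball (of_real x) \<rho>"
      then have w: "norm (w - of_real x) \<le> \<rho>" by (simp add: dist_norm norm_minus_commute)
      have n: "norm (of_real x - of_real c :: complex) = \<bar>x - c\<bar>" by (metis norm_of_real of_real_diff)
      have "norm (w - of_real c) \<le> norm (w - of_real x) + norm (of_real x - of_real c :: complex)"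
        by (metis diff_add_cancel add_diff_eq norm_triangle_ineq)
      moreover have "norm (of_real x - of_real c :: complex) \<le> norm (of_real x - w) + norm (w - of_real c)"
        by (metis diff_add_cancel add_diff_eq norm_triangle_ineq)
      ultimately show "w \<in> ?S" using w x1 x2 R unfolding n \<rho>_def R_def[symmetric]
        by (simp add: norm_minus_commute)
    qed
    have "norm (q z) \<le> 64 * A / (9 * \<rho>\<^sup>2)"
    proof (rule Im_square_bound_local[OF \<rho>(1) holomorphic_on_subset[OF hol sub]])
      have "z - of_real x = \<i> * of_real (Im z)" by (simp add: complex_eq_iff x_def)
      then have "dist z (of_real x) = \<bar>Im z\<bar>" by (simp add: dist_norm norm_mult)
      then show "dist z (of_real x) \<le> \<rho> / 2" using False \<rho> by simp
    qed (use le in auto)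
    also have "\<dots> \<le> 64 * A / (9 * (R/2)\<^sup>2)"
      using A \<rho> R by (intro divide_left_mono mult_left_mono power_mono mult_pos_pos) auto
    also have "\<dots> \<le> 29 * A / R\<^sup>2"
      using A R by (simp add: power_divide divide_simps)
    finally show ?thesis by (simp add: R_def)
  qed
qed

text \<open>Boundedness of \<open>(z - c) * W z\<close> leaves at most a simple pole, with residue
  \<open>g c\<close>. On the real axis \<open>g\<close> has the sign of \<open>x - c\<close> or
  vanishes, so the residue is both nonnegative and nonpositive, hence 0.\<close>

lemma nonneg_on_Reals_removable:
  fixes W :: "complex \<Rightarrow> complex" and c d K :: real
  assumes "d > 0" and hol: "W holomorphic_on ball (of_real c) d - {of_real c}"
    and bdd: "\<And>z. z \<in> ball (of_real c) d - {of_real c} \<Longrightarrow> norm ((z - of_real c) * W z) \<le> K"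
    and pos: "\<And>x. x \<noteq> c \<Longrightarrow> \<bar>x - c\<bar> < d \<Longrightarrow> Im (W (of_real x)) = 0 \<and> Re (W (of_real x)) \<ge> 0"
  shows "W \<in> O[at (of_real c)](\<lambda>_. 1)"
proof -
  define B where "B = ball (of_real c :: complex) d"
  have cB: "of_real c \<in> interior B" using \<open>d > 0\<close> by (simp add: B_def)
  have 1: "(\<lambda>z. (z - of_real c) * W z) holomorphic_on B - {of_real c}"
    unfolding B_def by (intro holomorphic_intros hol)
  have "\<forall>\<^sub>F z in at (of_real c). norm ((z - of_real c) * W z) \<le> K"
    unfolding eventually_at using bdd \<open>d > 0\<close> by (intro exI[of _ d]) (auto simp: dist_commute)
  then obtain g where g: "g holomorphic_on B" "\<And>z. z \<in> B - {of_real c} \<Longrightarrow> g z = (z - of_real c) * W z"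
    using holomorphic_on_extend_bounded[OF 1 cB] by blast
  have cont: "isCont g (of_real c)"
    using g(1) \<open>d > 0\<close> by (metis B_def centre_in_ball continuous_on_eq_continuous_at holomorphic_on_imp_continuous_on open_ball)
  have lim: "((\<lambda>x. g (of_real x)) \<longlongrightarrow> g (of_real c)) (at c within S)" for S
    by (rule isCont_tendsto_compose[OF cont]) (auto intro!: tendsto_intros)
  have val: "g (of_real x) = of_real ((x - c) * Re (W (of_real x)))" if "\<bar>x - c\<bar> < d" "x \<noteq> c" for x
  proof -
    have "(of_real x :: complex) \<in> B - {of_real c}"
      using that by (auto simp: B_def dist_norm abs_minus_commute simp flip: of_real_diff)
    then show ?thesis using g(2) pos[OF that(2,1)] by (simp add: complex_eq_iff)
  qed
  have ev: "\<forall>\<^sub>F x in at c within S. \<bar>x - c\<bar> < d \<and> x \<noteq> c" for S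
    unfolding eventually_at using \<open>d > 0\<close> by (auto simp: dist_real_def)
  have "\<forall>\<^sub>F x in at_right c. c < x" "\<forall>\<^sub>F x in at_left c. x < c"
    by (auto simp: eventually_at_filter)
  have "Re (g (of_real c)) \<ge> 0"
  proof (rule tendsto_lowerbound[OF tendsto_Re[OF lim]])
    show "\<forall>\<^sub>F x in at_right c. 0 \<le> Re (g (of_real x))"
      using ev[of "{c<..}"] \<open>\<forall>\<^sub>F x in at_right c. c < x\<close>
      by eventually_elim (use val pos in \<open>auto intro!: mult_nonneg_nonneg\<close>)
  qed auto
  moreover have "Re (g (of_real c)) \<le> 0"
  proof (rule tendsto_upperbound[OF tendsto_Re[OF lim]])
    show "\<forall>\<^sub>F x in at_left c. Re (g (of_real x)) \<le> 0"
      using ev[of "{..<c}"] \<open>\<forall>\<^sub>F x in at_left c. x < c\<close>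
      by eventually_elim (use val pos in \<open>auto intro!: mult_nonpos_nonneg\<close>)
  qed auto
  moreover have "Im (g (of_real c)) = 0"
  proof (rule tendsto_unique[OF _ tendsto_Im[OF lim[of UNIV]]])
    show "((\<lambda>x. Im (g (of_real x))) \<longlongrightarrow> 0) (at c)"
      by (rule tendsto_eventually) (use ev[of UNIV] val in \<open>auto elim!: eventually_mono\<close>)
  qed auto
  ultimately have "g (of_real c) = 0" by (simp add: complex_eq_iff)
  have "\<forall>\<^sub>F z in at (of_real c). g z = (z - of_real c) * W z"
    unfolding eventually_at using g(2) \<open>d > 0\<close> by (intro exI[of _ d]) (auto simp: B_def dist_commute)
  then have "((\<lambda>z. (z - of_real c) * W z) \<longlongrightarrow> 0) (at (of_real c))"
    using cont \<open>g (of_real c) = 0\<close> unfolding isCont_def by (auto elim: Lim_transform_eventually)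
  then obtain g' where g': "g' holomorphic_on B" "\<And>z. z \<in> B - {of_real c} \<Longrightarrow> g' z = W z"
    using holomorphic_on_extend_lim[OF hol[folded B_def] cB] by blast
  have "W \<in> O[at (of_real c)](\<lambda>_. 1) \<longleftrightarrow> g' \<in> O[at (of_real c)](\<lambda>_. 1)"
  proof (rule landau_o.big.in_cong)
    show "\<forall>\<^sub>F z in at (of_real c). W z = g' z"
      unfolding eventually_at using g'(2) \<open>d > 0\<close> by (intro exI[of _ d]) (auto simp: B_def dist_commute)
  qed
  moreover have "isCont g' (of_real c)"
    using g'(1) \<open>d > 0\<close> by (metis B_def centre_in_ball continuous_on_eq_continuous_at holomorphic_on_imp_continuous_on open_ball)
  ultimately show ?thesis
    by (auto simp: isCont_def intro!: bigoI_tendsto[where c = "g' (of_real c)"])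
qed

text \<open>The extensions \<open>N\<close> of \<open>h\<close> may be real on one interval and
  imaginary on the next; their squares are real on all of them, so one reflected function
  \<open>q\<close> covers the plane without 0, 1, t. Multiplied by the cubic it is nonnegative on
  the real axis; the growth bounds leave a linear polynomial, and nonnegativity a constant.\<close>

lemma square_eq_const_by_reflection:
  fixes h :: "complex \<Rightarrow> complex" and t B :: real
  assumes "1 < t" and hol: "h holomorphic_on upper_half_plane"
    and bdd: "\<And>z. Im z > 0 \<Longrightarrow> norm (h z) \<le> B / Im z"
    and ext: "\<And>x. x \<notin> {0, 1, t} \<Longrightarrow> \<exists>\<rho>>0. \<exists>N. continuous_on (ball (of_real x) \<rho> \<inter> {z. 0 \<le> Im z}) N \<and>
        (\<forall>z\<in>ball (of_real x) \<rho>. Im z > 0 \<longrightarrow> N z = h z) \<and>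
        Im ((N (of_real x))\<^sup>2) = 0 \<and> 0 \<le> Re ((N (of_real x))\<^sup>2) * (x * (x - 1) * (x - t))"
  obtains b where "b \<ge> 0" "\<And>z. Im z > 0 \<Longrightarrow> (h z)\<^sup>2 * (z * (z - 1) * (z - of_real t)) = of_real b"
proof -
  define X :: "complex set" where "X = {0, 1, of_real t}"
  define p :: "complex \<Rightarrow> complex" where "p = (\<lambda>z. z * (z - 1) * (z - of_real t))"
  \<comment> \<open>Taking limits as boundary values avoids a choice among the extensions
    \<open>N\<close>. At 0, 1, t the limit need not exist, and nothing is claimed there.\<close>
  define q0 where "q0 = (\<lambda>z. if Im z > 0 then (h z)\<^sup>2 else Lim (at z within upper_half_plane) (\<lambda>z. (h z)\<^sup>2))"
  have q0_eq: "q0 (of_real y) = (N (of_real y))\<^sup>2"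
    if N: "continuous_on (ball (of_real x) \<rho> \<inter> {z. 0 \<le> Im z}) N"
      "\<forall>z\<in>ball (of_real x) \<rho>. Im z > 0 \<longrightarrow> N z = h z" and y: "of_real y \<in> ball (of_real x :: complex) \<rho>"
    for x y \<rho> N
  proof -
    have op: "open (ball (of_real x :: complex) \<rho>)" by simp
    have "(N \<longlongrightarrow> N (of_real y)) (at (of_real y) within ball (of_real x) \<rho> \<inter> {z. 0 \<le> Im z})"
      using N(1) y by (auto simp: continuous_on_def)
    then have "(N \<longlongrightarrow> N (of_real y)) (at (of_real y) within ball (of_real x) \<rho> \<inter> upper_half_plane)"
      by (rule tendsto_within_subset) auto
    moreover have "at (of_real y) within ball (of_real x) \<rho> \<inter> upper_half_plane = at (of_real y) within upper_half_plane"
      by (rule at_within_nhd[OF y op]) auto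
    ultimately have "(N \<longlongrightarrow> N (of_real y)) (at (of_real y) within upper_half_plane)" by simp
    then have "((\<lambda>z. (N z)\<^sup>2) \<longlongrightarrow> (N (of_real y))\<^sup>2) (at (of_real y) within upper_half_plane)"
      by (rule tendsto_power)
    moreover have "\<forall>\<^sub>F z in at (of_real y) within upper_half_plane. (N z)\<^sup>2 = (h z)\<^sup>2"
      unfolding eventually_at_topological using N(2) y op by (intro exI[of _ "ball (of_real x) \<rho>"]) auto
    ultimately have "((\<lambda>z. (h z)\<^sup>2) \<longlongrightarrow> (N (of_real y))\<^sup>2) (at (of_real y) within upper_half_plane)"
      by (rule Lim_transform_eventually)
    then show ?thesis
      using at_within_upper_half_plane_neq_bot[of UNIV y] by (simp add: q0_def tendsto_Lim)
  qed
  have realX: "of_real x \<in> X \<longleftrightarrow> x \<in> {0, 1, t}" for x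
    by (auto simp: X_def)
  have real_q0: "Im (q0 (of_real x)) = 0" "0 \<le> Re (q0 (of_real x)) * (x * (x - 1) * (x - t))"
    if xX: "x \<notin> {0, 1, t}" for x
  proof -
    obtain \<rho> N where "\<rho> > 0" "continuous_on (ball (of_real x) \<rho> \<inter> {z. 0 \<le> Im z}) N"
        "\<forall>z\<in>ball (of_real x) \<rho>. Im z > 0 \<longrightarrow> N z = h z"
        "Im ((N (of_real x))\<^sup>2) = 0 \<and> 0 \<le> Re ((N (of_real x))\<^sup>2) * (x * (x - 1) * (x - t))"
      using ext[OF xX] by blast
    then show "Im (q0 (of_real x)) = 0" "0 \<le> Re (q0 (of_real x)) * (x * (x - 1) * (x - t))"
      using q0_eq[of x \<rho> N x] by auto
  qed
  have cont: "continuous_on (- X \<inter> {z. 0 \<le> Im z}) q0"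
    unfolding continuous_on_eq_continuous_within
  proof
    fix z assume z: "z \<in> - X \<inter> {z. 0 \<le> Im z}"
    show "continuous (at z within - X \<inter> {z. 0 \<le> Im z}) q0"
    proof (cases "Im z > 0")
      case True
      have "continuous_on upper_half_plane (\<lambda>z. (h z)\<^sup>2)"
        by (intro continuous_intros holomorphic_on_imp_continuous_on hol)
      then have "continuous_on upper_half_plane q0"
        by (rule continuous_on_eq) (simp add: q0_def)
      then show ?thesis
        using True by (metis continuous_at_imp_continuous_at_within continuous_on_eq_continuous_at
            mem_upper_half_plane open_upper_half_plane)
    next
      case False
      then have zr: "z = of_real (Re z)" using z by (simp add: complex_eq_iff)
      then have "of_real (Re z) \<notin> X" using z by (metis IntD1 ComplD)
      then have "Re z \<notin> {0, 1, t}" using realX by blast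
      from ext[OF this] obtain \<rho> N where N: "\<rho> > 0" "continuous_on (ball z \<rho> \<inter> {z. 0 \<le> Im z}) N"
        "\<forall>w\<in>ball z \<rho>. Im w > 0 \<longrightarrow> N w = h w"
        using zr by auto
      have eq: "(N w)\<^sup>2 = q0 w" if w: "w \<in> ball z \<rho> \<inter> {z. 0 \<le> Im z}" for w
      proof (cases "Im w > 0")
        case True then show ?thesis using N(3) w by (simp add: q0_def)
      next
        case False
        then have "w = of_real (Re w)" using w by (simp add: complex_eq_iff)
        then show ?thesis using q0_eq[of "Re z" \<rho> N "Re w"] N zr w by (metis IntD1)
      qed
      have "continuous_on (ball z \<rho> \<inter> {z. 0 \<le> Im z}) (\<lambda>w. (N w)\<^sup>2)"
        by (intro continuous_intros N)
      then have "continuous_on (ball z \<rho> \<inter> {z. 0 \<le> Im z}) q0"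
        by (rule continuous_on_eq) (rule eq)
      then have "continuous (at z within ball z \<rho> \<inter> {z. 0 \<le> Im z}) q0"
        using N(1) z by (simp add: continuous_on_eq_continuous_within)
      then have "continuous (at z within ball z \<rho> \<inter> (- X \<inter> {z. 0 \<le> Im z})) q0"
        by (rule continuous_within_subset) auto
      moreover have "at z within ball z \<rho> \<inter> (- X \<inter> {z. 0 \<le> Im z}) = at z within (- X \<inter> {z. 0 \<le> Im z})"
        by (rule at_within_nhd[of z "ball z \<rho>"]) (use N(1) in auto)
      ultimately show ?thesis by simp
    qed
  qed
  define q where "q = (\<lambda>z. if 0 \<le> Im z then q0 z else cnj (q0 (cnj z)))"
  have "closed X" unfolding X_def by (intro finite_imp_closed) auto
  have holq: "q holomorphic_on - X"
    unfolding q_def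
  proof (rule Schwarz_reflection[OF _ _ _ cont])
    show "open (- X)" using \<open>closed X\<close> by auto
    show "cnj ` (- X) \<subseteq> - X" by (auto simp: X_def) (metis complex_cnj_cnj complex_cnj_complex_of_real complex_cnj_one complex_cnj_zero)+
    have "(\<lambda>z. (h z)\<^sup>2) holomorphic_on - X \<inter> {z. 0 < Im z}"
      by (intro holomorphic_intros holomorphic_on_subset[OF hol]) auto
    then show "q0 holomorphic_on - X \<inter> {z. 0 < Im z}"
      by (rule holomorphic_transform) (simp add: q0_def)
    show "q0 z \<in> \<real>" if "z \<in> - X" and zR: "z \<in> \<real>" for z
    proof -
      obtain x where "z = of_real x" using zR by (auto elim: Reals_cases)
      then show ?thesis using that(1) realX real_q0(1)[of x] by (auto simp: complex_is_Real_iff)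
    qed
  qed
  have q_le: "norm (q z) \<le> B\<^sup>2 / (Im z)\<^sup>2" if "Im z \<noteq> 0" for z
  proof -
    have *: "norm (q0 z) \<le> B\<^sup>2 / (Im z)\<^sup>2" if "Im z > 0" for z
      using power_mono[OF bdd[OF that], of 2] that by (simp add: q0_def norm_power power_divide)
    show ?thesis using that *[of z] *[of "cnj z"] by (cases "Im z > 0") (auto simp: q_def)
  qed
  define W where "W = (\<lambda>z. q z * p z)"
  have W_real: "Im (W (of_real x)) = 0" "0 \<le> Re (W (of_real x))" if "x \<notin> {0, 1, t}" for x
  proof -
    have "p (of_real x) = of_real (x * (x - 1) * (x - t))" by (simp add: p_def)
    then show "Im (W (of_real x)) = 0" "0 \<le> Re (W (of_real x))"
      using real_q0[OF that] by (simp_all add: W_def q_def)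
  qed
  have q_point: "norm (q z) \<le> 29 * B\<^sup>2 / (norm (z - of_real c))\<^sup>2"
    if "z \<noteq> of_real c" "{w. norm (z - of_real c) / 4 \<le> norm (w - of_real c) \<and> norm (w - of_real c) \<le> 2 * norm (z - of_real c)} \<inter> X = {}"
    for z c
    by (rule Im_square_bound_punctured[OF that(1) holomorphic_on_subset[OF holq]]) (use that(2) q_le in auto)
  have bigo: "W \<in> O[at x](\<lambda>_. 1)" if "x \<in> X" for x
  proof -
    obtain c where c: "x = of_real c" "c \<in> {0, 1, t}" using \<open>x \<in> X\<close> by (auto simp: X_def)
    \<comment> \<open>The least distance between two of the points 0, 1, t. For \<open>z\<close>
      within d/2 of \<open>c\<close>, the annulus of the growth estimate reaches out to twice the
      distance of \<open>z\<close>, so it meets none of them.\<close>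
    define d where "d = min 1 (t - 1)"
    have d: "d > 0" "d \<le> 1" using \<open>1 < t\<close> by (auto simp: d_def)
    have sep: "norm (w - of_real c) \<ge> d" if wX: "w \<in> X" "w \<noteq> of_real c" for w
    proof -
      obtain e where e: "w = of_real e" "e \<in> {0, 1, t}" using wX(1) by (auto simp: X_def)
      have "d \<le> \<bar>e - c\<bar>" using e wX(2) c(2) \<open>1 < t\<close> by (auto simp: d_def)
      then show ?thesis by (simp add: e(1) flip: of_real_diff)
    qed
    define p' where "p' = (\<lambda>z. \<Prod>y\<in>X - {of_real c}. z - y)"
    have pp: "p z = (z - of_real c) * p' z" for z
    proof -
      have "p z = (\<Prod>y\<in>X. z - y)" using \<open>1 < t\<close> by (simp add: p_def X_def)
      also have "\<dots> = (z - of_real c) * p' z"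
        unfolding p'_def using \<open>x \<in> X\<close> c by (subst prod.remove[of X "of_real c"]) (auto simp: X_def)
      finally show ?thesis .
    qed
    have "continuous_on (cball (of_real c) d) p'" unfolding p'_def by (intro continuous_intros)
    then have "bounded (p' ` cball (of_real c) d)"
      by (intro compact_imp_bounded compact_continuous_image) auto
    then obtain K where K: "\<And>z. z \<in> cball (of_real c) d \<Longrightarrow> norm (p' z) \<le> K"
      unfolding bounded_iff by blast
    have "W \<in> O[at (of_real c)](\<lambda>_. 1)"
    proof (rule nonneg_on_Reals_removable)
      show "d / 2 > 0" using d by simp
      show "W holomorphic_on ball (of_real c) (d / 2) - {of_real c}"
        unfolding W_def p_def
      proof (intro holomorphic_intros holomorphic_on_subset[OF holq] subsetI)
        fix z :: complex assume z: "z \<in> ball (of_real c) (d / 2) - {of_real c}"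
        show "z \<in> - X" using sep[of z] z d by (auto simp: dist_norm norm_minus_commute)
      qed
      show "norm ((z - of_real c) * W z) \<le> 29 * B\<^sup>2 * K" if z: "z \<in> ball (of_real c) (d / 2) - {of_real c}" for z
      proof -
        have zc: "z \<noteq> of_real c" "norm (z - of_real c) < d / 2" using z by (auto simp: dist_norm norm_minus_commute)
        have q: "norm (q z) \<le> 29 * B\<^sup>2 / (norm (z - of_real c))\<^sup>2"
        proof (rule q_point[OF zc(1)])
          have False if "w \<in> X" "norm (z - of_real c) / 4 \<le> norm (w - of_real c)"
            "norm (w - of_real c) \<le> 2 * norm (z - of_real c)" for w
          proof -
            have "w \<noteq> of_real c" using that(2) zc(1) by auto
            then show False using sep[OF that(1)] that(3) zc(2) by simp
          qed
          then show "{w. norm (z - of_real c) / 4 \<le> norm (w - of_real c) \<and> norm (w - of_real c) \<le> 2 * norm (z - of_real c)} \<inter> X = {}"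
            by blast
        qed
        have "norm ((z - of_real c) * W z) = norm (q z) * (norm (z - of_real c))\<^sup>2 * norm (p' z)"
          by (simp add: W_def pp norm_mult power2_eq_square)
        also have "\<dots> \<le> 29 * B\<^sup>2 * norm (p' z)"
          using q zc(1) by (intro mult_right_mono) (auto simp: field_simps)
        also have "\<dots> \<le> 29 * B\<^sup>2 * K"
          using K[of z] z d by (intro mult_left_mono) auto
        finally show ?thesis .
      qed
      show "Im (W (of_real x)) = 0 \<and> 0 \<le> Re (W (of_real x))" if "x \<noteq> c" "\<bar>x - c\<bar> < d / 2" for x
      proof -
        have "x \<notin> {0, 1, t}"
        proof
          assume "x \<in> {0, 1, t}"
          then have "(of_real x :: complex) \<in> X" "(of_real x :: complex) \<noteq> of_real c" using realX that by auto
          from sep[OF this] show False using that d by (simp flip: of_real_diff)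
        qed
        then show ?thesis using W_real by blast
      qed
    qed
    then show ?thesis using c by simp
  qed
  have "W holomorphic_on UNIV - X"
    unfolding W_def p_def by (intro holomorphic_intros holomorphic_on_subset[OF holq]) auto
  then obtain G where G: "G holomorphic_on UNIV" "\<And>z. z \<notin> X \<Longrightarrow> G z = W z"
    using removable_singularities[of X UNIV W] bigo by (auto simp: X_def)
  \<comment> \<open>For |z| >= 4t + 1 the inner radius |z|/4 of the annulus about 0 exceeds t, so
    all three points are avoided. The cubic is at most 4 |z|^3 in modulus, whence 116 = 4 *
    29.\<close>
  have G_le: "norm (G z) \<le> 116 * B\<^sup>2 * norm z ^ 1" if z: "4 * t + 1 \<le> norm z" for z
  proof -
    have zX: "z \<notin> X" using z \<open>1 < t\<close> by (auto simp: X_def)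
    have z0: "z \<noteq> 0" using z \<open>1 < t\<close> by auto
    have q: "norm (q z) \<le> 29 * B\<^sup>2 / (norm (z - of_real 0))\<^sup>2"
      by (rule q_point) (use z z0 \<open>1 < t\<close> in \<open>auto simp: X_def\<close>)
    have "norm (z - 1) \<le> 2 * norm z" using norm_triangle_ineq4[of z 1] z \<open>1 < t\<close> by simp
    moreover have "norm (z - of_real t) \<le> 2 * norm z" using norm_triangle_ineq4[of z "of_real t"] z \<open>1 < t\<close> by simp
    ultimately have le: "norm z * norm (z - 1) * norm (z - of_real t) \<le> norm z * (2 * norm z) * (2 * norm z)"
      by (intro mult_mono) auto
    have "norm (W z) \<le> 29 * B\<^sup>2 / (norm z)\<^sup>2 * (norm z * (2 * norm z) * (2 * norm z))"
      unfolding W_def p_def norm_mult by (rule mult_mono[OF _ le]) (use q in auto)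
    also have "\<dots> = 116 * B\<^sup>2 * norm z ^ 1" using z0 by (simp add: field_simps power2_eq_square)
    finally show ?thesis using G(2) zX by simp
  qed
  define a b where "a = deriv G 0" and "b = G 0"
  have lin: "G z = b + a * z" for z
    using Liouville_polynomial[OF G(1) G_le, where \<xi> = z] by (simp add: a_def b_def)
  have G_real: "Im b + Im a * x = 0" "0 \<le> Re b + Re a * x" if "x \<notin> {0, 1, t}" for x
  proof -
    have "W (of_real x) = b + a * of_real x" using G(2) realX that lin by metis
    then show "Im b + Im a * x = 0" "0 \<le> Re b + Re a * x" using W_real[OF that] by simp_all
  qed
  have "Im b + Im a * (-1) = 0" "Im b + Im a * (-2) = 0" using \<open>1 < t\<close> by (intro G_real; simp)+
  then have Im0: "Im a = 0" "Im b = 0" by simp_all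
  have Rea: "Re a = 0"
  proof (rule ccontr)
    assume ne: "Re a \<noteq> 0"
    \<comment> \<open>Chosen such that \<open>Re b + Re a * x\<close> is negative while |x| > t,
      which keeps \<open>x\<close> away from 0, 1, t.\<close>
    define x where "x = (- Re b - (t + 1) * \<bar>Re a\<bar> - \<bar>Re b\<bar> - 1) / Re a"
    have x: "Re a * x = - Re b - (t + 1) * \<bar>Re a\<bar> - \<bar>Re b\<bar> - 1" using ne by (simp add: x_def)
    have "\<bar>Re a\<bar> * \<bar>x\<bar> = Re b + (t + 1) * \<bar>Re a\<bar> + \<bar>Re b\<bar> + 1"
    proof -
      have "\<bar>Re a\<bar> * \<bar>x\<bar> = \<bar>Re a * x\<bar>" by (simp add: abs_mult)
      moreover have "(t + 1) * \<bar>Re a\<bar> \<ge> 0" using \<open>1 < t\<close> by simp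
      ultimately show ?thesis unfolding x by linarith
    qed
    then have "\<bar>Re a\<bar> * \<bar>x\<bar> > \<bar>Re a\<bar> * t" using ne by (simp add: algebra_simps)
    then have "\<bar>x\<bar> > t" by (simp add: mult_less_cancel_left)
    then have "x \<notin> {0, 1, t}" using \<open>1 < t\<close> by auto
    from G_real(2)[OF this] x have "0 \<le> - ((t + 1) * \<bar>Re a\<bar>) - \<bar>Re b\<bar> - 1" by linarith
    moreover have "(t + 1) * \<bar>Re a\<bar> \<ge> 0" using \<open>1 < t\<close> by simp
    ultimately show False by linarith
  qed
  show ?thesis
  proof (rule that[of "Re b"])
    show "0 \<le> Re b" using G_real(2)[of "-1"] Rea \<open>1 < t\<close> by simp
    show "(h z)\<^sup>2 * (z * (z - 1) * (z - of_real t)) = of_real (Re b)" if "Im z > 0" for z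
    proof -
      have "z \<notin> X" using that by (auto simp: X_def)
      then have "W z = b" using G(2) lin Im0 Rea by (metis add.right_neutral complex_eq_iff mult_zero_left zero_complex.sel)
      then show ?thesis using that Im0 by (simp add: W_def p_def q_def q0_def complex_eq_iff)
    qed
  qed
qed

section \<open>The incomplete elliptic integral\<close>

lemma csqrt_Re_pos:
  assumes "z \<notin> \<real>\<^sub>\<le>\<^sub>0"
  shows "0 < Re (csqrt z)"
proof (rule ccontr)
  assume "\<not> 0 < Re (csqrt z)"
  then have "Re (csqrt z) = 0" using Re_csqrt[of z] by simp
  then have "Re ((csqrt z)\<^sup>2) \<le> 0" "Im ((csqrt z)\<^sup>2) = 0"
    unfolding Re_power2 Im_power2 by simp_all
  then show False using assms by (simp add: complex_nonpos_Reals_iff)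
qed

text \<open>The substitution s = sin \<theta> cancels the factor
  \<open>csqrt (1 - s\<^sup>2)\<close>: the branch point s = 1 becomes the regular point \<theta> =
  pi/2, and the boundary interval from 1 to 1/r^2 becomes part of a vertical edge.\<close>

definition F_integrand :: "real \<Rightarrow> complex \<Rightarrow> complex" where
  "F_integrand r \<theta> = 1 / csqrt (1 - of_real (r\<^sup>2) * (sin \<theta>)\<^sup>2)"

text \<open>The half-open strip on which Legendre's form of the integrand of \<open>F\<close> has no branch point.
  Its right edge ends at the preimage of \<open>1/r\<close> under the sine.\<close>

definition F_strip :: "real \<Rightarrow> complex set" where
  "F_strip r = {\<theta>. - (pi/2) < Re \<theta> \<and> Re \<theta> \<le> pi/2 \<and> (Re \<theta> = pi/2 \<longrightarrow> \<bar>Im \<theta>\<bar> < arcosh (1/r))}"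

lemma Re_sin_cosh: "Re (sin z) = sin (Re z) * cosh (Im z)"
  and Im_sin_sinh: "Im (sin z) = cos (Re z) * sinh (Im z)"
  by (simp_all add: Re_sin Im_sin cosh_def sinh_def)

lemma Re_cos_cosh: "Re (cos z) = cos (Re z) * cosh (Im z)"
  by (simp add: Re_cos cosh_def)

lemma cosh_less_iff_less_arcosh:
  assumes "x > (1::real)"
  shows "cosh y < x \<longleftrightarrow> \<bar>y\<bar> < arcosh x"
proof -
  have "cosh y = cosh \<bar>y\<bar>" by simp
  moreover have "x = cosh (arcosh x)" "arcosh x \<ge> 0" using assms by auto
  ultimately show ?thesis by (metis abs_ge_zero cosh_real_nonneg_less_iff)
qed

text \<open>On the cut, r sin z would be real and at least 1 in modulus. On the right edge the sine
  equals cosh (Im z) < 1/r; elsewhere in the strip it is real only at real points, where it is at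
  most 1 in modulus.\<close>

lemma F_radicand_notin_nonpos_Reals:
  assumes r: "0 < r" "r < 1" and z: "z \<in> F_strip r"
  shows "1 - of_real (r\<^sup>2) * (sin z)\<^sup>2 \<notin> \<real>\<^sub>\<le>\<^sub>0"
proof
  assume *: "1 - of_real (r\<^sup>2) * (sin z)\<^sup>2 \<in> \<real>\<^sub>\<le>\<^sub>0"
  define a b where "a = Re (sin z)" and "b = Im (sin z)"
  have Re: "1 \<le> r\<^sup>2 * (a\<^sup>2 - b\<^sup>2)" and Im: "r\<^sup>2 * (2 * a * b) = 0"
    using * by (auto simp: complex_nonpos_Reals_iff a_def b_def power2_eq_square)
  have "b = 0"
  proof (rule ccontr)
    assume "b \<noteq> 0"
    then have "a = 0" using Im r by simp
    then have "1 \<le> - (r * b)\<^sup>2" using Re by (simp add: power_mult_distrib)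
    then show False using zero_le_power2[of "r * b"] by linarith
  qed
  then have "1\<^sup>2 \<le> (r * a)\<^sup>2" using Re by (simp add: power_mult_distrib)
  then have "1 \<le> \<bar>r * a\<bar>" by (metis abs_le_square_iff abs_one)
  then have ra: "1 \<le> r * \<bar>a\<bar>" using r by (simp add: abs_mult)
  show False
  proof (cases "Re z = pi / 2")
    case True
    then have "cosh (Im z) < 1 / r"
      using z r cosh_less_iff_less_arcosh[of "1/r" "Im z"] by (simp add: F_strip_def)
    then show False using ra r True by (simp add: a_def Re_sin_cosh field_simps)
  next
    case False
    then have "cos (Re z) > 0" using z by (intro cos_gt_zero_pi) (auto simp: F_strip_def)
    then have "Im z = 0" using \<open>b = 0\<close> by (simp add: b_def Im_sin_sinh)
    then have "\<bar>a\<bar> \<le> 1" by (simp add: a_def Re_sin_cosh)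
    then have "r * \<bar>a\<bar> \<le> r * 1" using r by (intro mult_left_mono) auto
    then show False using ra r by linarith
  qed
qed

text \<open>Convexity provides a primitive up to the edge. A proper convex combination meets the
  right edge only if both points lie on it, and there the height bound is preserved.\<close>

lemma convex_F_strip: "convex (F_strip r)"
  unfolding convex_alt
proof (intro ballI allI impI)
  fix x y :: complex and u :: real
  assume xy: "x \<in> F_strip r" "y \<in> F_strip r" and u: "0 \<le> u \<and> u \<le> 1"
  show "(1 - u) *\<^sub>R x + u *\<^sub>R y \<in> F_strip r"
  proof (cases "u = 0 \<or> u = 1")
    case True then show ?thesis using xy by auto
  next
    case False
    then have u: "0 < u" "u < 1" using u by auto
    have 1: "(1 - u) * - (pi/2) + u * - (pi/2) < (1 - u) * Re x + u * Re y"
      using u xy by (intro add_strict_mono mult_strict_left_mono) (auto simp: F_strip_def)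
    have 2: "(1 - u) * Re x + u * Re y \<le> (1 - u) * (pi/2) + u * (pi/2)"
      using u xy by (intro add_mono mult_left_mono) (auto simp: F_strip_def)
    have 3: "\<bar>(1 - u) * Im x + u * Im y\<bar> < arcosh (1/r)" if eq: "(1 - u) * Re x + u * Re y = pi/2"
    proof -
      have "(1 - u) * (pi/2 - Re x) + u * (pi/2 - Re y) = pi/2 - ((1 - u) * Re x + u * Re y)"
        by (simp add: field_simps)
      then have "(1 - u) * (pi/2 - Re x) + u * (pi/2 - Re y) = 0" using eq by simp
      moreover have "(1 - u) * (pi/2 - Re x) \<ge> 0" "u * (pi/2 - Re y) \<ge> 0"
        using u xy by (auto simp: F_strip_def)
      ultimately have "(1 - u) * (pi/2 - Re x) = 0" "u * (pi/2 - Re y) = 0" by linarith+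
      then have "Re x = pi/2" "Re y = pi/2" using u by auto
      then have "\<bar>Im x\<bar> < arcosh (1/r)" "\<bar>Im y\<bar> < arcosh (1/r)" using xy by (auto simp: F_strip_def)
      then have "(1 - u) * \<bar>Im x\<bar> + u * \<bar>Im y\<bar> < (1 - u) * arcosh (1/r) + u * arcosh (1/r)"
        using u by (intro add_strict_mono mult_strict_left_mono) auto
      moreover have "\<bar>(1 - u) * Im x + u * Im y\<bar> \<le> (1 - u) * \<bar>Im x\<bar> + u * \<bar>Im y\<bar>"
        using u abs_triangle_ineq[of "(1 - u) * Im x" "u * Im y"] by (simp add: abs_mult)
      ultimately show ?thesis by (simp add: algebra_simps)
    qed
    have "(1 - u) * - (pi/2) + u * - (pi/2) = - (pi/2)" "(1 - u) * (pi/2) + u * (pi/2) = pi/2"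
      by (simp_all add: field_simps)
    then show ?thesis using 1 2 3 by (simp add: F_strip_def)
  qed
qed

definition F_open_strip :: "complex set" where
  "F_open_strip = {\<theta>. - (pi/2) < Re \<theta> \<and> Re \<theta> < pi/2}"

lemma F_open_strip_subset: "F_open_strip \<subseteq> F_strip r"
  by (auto simp: F_open_strip_def F_strip_def)

lemma open_F_open_strip: "open F_open_strip"
proof -
  have "F_open_strip = {\<theta>. - (pi/2) < Re \<theta>} \<inter> {\<theta>. Re \<theta> < pi/2}" by (auto simp: F_open_strip_def)
  then show ?thesis by (metis open_Int open_halfspace_Re_gt open_halfspace_Re_lt)
qed

text \<open>Derivatives are taken within the strip so that they include the right edge, on which
  \<open>F\<close> has to be evaluated.\<close>

lemma F_primitive:
  assumes r: "0 < r" "r < 1"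
  obtains F where "F 0 = 0"
    "\<And>z. z \<in> F_strip r \<Longrightarrow> (F has_field_derivative F_integrand r z) (at z within F_strip r)"
proof -
  have diff: "F_integrand r field_differentiable at z" if z: "z \<in> F_strip r" for z
    unfolding F_integrand_def[abs_def] field_differentiable_def
    by (rule exI, (rule derivative_eq_intros refl)+) (use F_radicand_notin_nonpos_Reals[OF r z] in \<open>auto simp del: csqrt.simps\<close>)
  then have cont: "continuous_on (F_strip r) (F_integrand r)"
    by (intro continuous_at_imp_continuous_on ballI field_differentiable_imp_continuous_at)
  have "\<exists>g. \<forall>z\<in>F_strip r. (g has_field_derivative F_integrand r z) (at z within F_strip r)"
  proof (rule holomorphic_convex_primitive[OF convex_F_strip, of "{}" r "F_integrand r"])
    fix z assume "z \<in> interior (F_strip r) - {}"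
    then show "F_integrand r field_differentiable at z" using diff interior_subset by blast
  qed (use cont in auto)
  then obtain g where g: "\<And>z. z \<in> F_strip r \<Longrightarrow> (g has_field_derivative F_integrand r z) (at z within F_strip r)"
    by blast
  show ?thesis
    by (rule that[of "\<lambda>z. g z - g 0"]) (auto intro!: derivative_eq_intros g)
qed

lemma Re_along_horizontal:
  assumes "(F has_field_derivative D) (at (Complex s y))"
  shows "((\<lambda>s. Re (F (Complex s y))) has_real_derivative Re D) (at s)"
proof -
  have "((\<lambda>s. Complex s y) has_vector_derivative 1) (at s)"
    unfolding Complex_eq by (auto intro!: derivative_eq_intros)
  from field_vector_diff_chain_at[OF this assms]
  have "((\<lambda>s. F (Complex s y)) has_vector_derivative D) (at s)" by (simp add: o_def)
  then show ?thesis
    unfolding has_real_derivative_iff_has_vector_derivative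
    by (rule bounded_linear.has_vector_derivative[OF bounded_linear_Re])
qed

lemma Re_along_vertical:
  assumes "(F has_field_derivative D) (at (Complex x s) within S)" "(\<lambda>s. Complex x s) ` T \<subseteq> S"
  shows "((\<lambda>s. Re (F (Complex x s))) has_real_derivative - Im D) (at s within T)"
proof -
  have "((\<lambda>s. Complex x s) has_vector_derivative \<i>) (at s within T)"
    unfolding Complex_eq by (auto intro!: derivative_eq_intros)
  from field_vector_diff_chain_within[OF this has_field_derivative_subset[OF assms]]
  have "((\<lambda>s. F (Complex x s)) has_vector_derivative \<i> * D) (at s within T)" by (simp add: o_def)
  from bounded_linear.has_vector_derivative[OF bounded_linear_Re this] show ?thesis
    unfolding has_real_derivative_iff_has_vector_derivative by simp
qed

section \<open>Monotonicity of the real part of the elliptic integral\<close>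

locale elliptic_primitive =
  fixes r :: real and F :: "complex \<Rightarrow> complex"
  assumes r: "0 < r" "r < 1" and F0: "F 0 = 0"
    and F_within: "\<And>z. z \<in> F_strip r \<Longrightarrow> (F has_field_derivative F_integrand r z) (at z within F_strip r)"
begin

lemma F_at: "z \<in> F_open_strip \<Longrightarrow> (F has_field_derivative F_integrand r z) (at z)"
  using F_within[of z] F_open_strip_subset[of r] open_F_open_strip
  by (metis at_within_open has_field_derivative_subset subsetD)

lemma F_cont: "continuous_on (F_strip r) F"
  using F_within by (meson DERIV_continuous continuous_on_eq_continuous_within)

lemma Re_F_integrand_pos:
  assumes "z \<in> F_strip r"
  shows "0 < Re (F_integrand r z)"
proof -
  define w where "w = csqrt (1 - of_real (r\<^sup>2) * (sin z)\<^sup>2)"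
  have "Re w > 0"
    unfolding w_def by (rule csqrt_Re_pos[OF F_radicand_notin_nonpos_Reals[OF r assms]])
  moreover have "Re (1 / w) = Re w / (norm w)\<^sup>2" by (simp add: Re_divide cmod_power2)
  moreover have "w \<noteq> 0" using \<open>Re w > 0\<close> by auto
  ultimately show ?thesis unfolding F_integrand_def w_def[symmetric] by simp
qed

text \<open>The root \<open>w\<close> has positive real part, so \<open>Im w\<close> has the sign of
  \<open>Im (w\<^sup>2)\<close>; taking the reciprocal reverses it.\<close>

lemma Im_F_integrand:
  assumes "z \<in> F_strip r"
  shows "Re (sin z) * Im (sin z) = 0 \<Longrightarrow> Im (F_integrand r z) = 0"
    and "Re (sin z) * Im (sin z) > 0 \<Longrightarrow> Im (F_integrand r z) > 0"
proof -
  define w where "w = csqrt (1 - of_real (r\<^sup>2) * (sin z)\<^sup>2)"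
  have pos: "Re w > 0"
    unfolding w_def by (rule csqrt_Re_pos[OF F_radicand_notin_nonpos_Reals[OF r assms]])
  have "w\<^sup>2 = 1 - of_real (r\<^sup>2) * (sin z)\<^sup>2" by (simp add: w_def)
  then have "Im (w\<^sup>2) = - (r\<^sup>2 * (2 * (Re (sin z) * Im (sin z))))"
    by (simp add: Im_power2)
  then have Im: "Re w * Im w = - (r\<^sup>2 * (Re (sin z) * Im (sin z)))"
    unfolding Im_power2 by (simp only: mult.left_commute[of "r\<^sup>2" 2] mult.assoc)
  have eq: "Im (F_integrand r z) = - Im w / (norm w)\<^sup>2"
    unfolding F_integrand_def w_def[symmetric] by (simp add: Im_divide cmod_power2)
  show "Im (F_integrand r z) = 0" if "Re (sin z) * Im (sin z) = 0"
    using Im pos that by (simp add: eq)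
  show "Im (F_integrand r z) > 0" if "Re (sin z) * Im (sin z) > 0"
  proof -
    have "Re w * Im w < 0" using Im that r by simp
    then have "Im w < 0" using pos by (simp add: mult_less_0_iff)
    moreover have "w \<noteq> 0" using pos by auto
    ultimately show ?thesis by (simp add: eq divide_neg_pos)
  qed
qed

text \<open>On the imaginary axis the sine is imaginary and the integrand real, so a vertical step
  changes only \<open>Im F\<close>.\<close>

lemma Re_F_imaginary: "Re (F (Complex 0 y)) = 0"
proof -
  have "\<exists>c. \<forall>s\<in>UNIV. Re (F (Complex 0 s)) = c"
  proof (rule has_field_derivative_zero_constant)
    fix s :: real
    have z: "Complex 0 s \<in> F_open_strip" by (simp add: F_open_strip_def)
    have "Im (F_integrand r (Complex 0 s)) = 0"
      using F_open_strip_subset[of r] z by (intro Im_F_integrand) (auto simp: Re_sin_cosh)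
    then show "((\<lambda>s. Re (F (Complex 0 s))) has_real_derivative 0) (at s within UNIV)"
      using Re_along_vertical[OF F_at[OF z], of UNIV] by simp
  qed auto
  then show ?thesis using F0 by (metis Complex_eq_0 UNIV_I zero_complex.sel(1))
qed

lemma Re_F_pos:
  assumes "0 < x" "x < pi/2"
  shows "0 < Re (F (Complex x y))"
proof -
  have "Re (F (Complex 0 y)) < Re (F (Complex x y))"
  proof (rule DERIV_pos_imp_increasing[OF assms(1)])
    fix s assume "0 \<le> s" "s \<le> x"
    then have z: "Complex s y \<in> F_open_strip" using assms by (simp add: F_open_strip_def)
    show "\<exists>d. ((\<lambda>s. Re (F (Complex s y))) has_real_derivative d) (at s) \<and> 0 < d"
      using Re_along_horizontal[OF F_at[OF z]] Re_F_integrand_pos z F_open_strip_subset by blast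
  qed
  then show ?thesis by (simp add: Re_F_imaginary)
qed

lemma real_in_F_strip: "- (pi/2) < x \<Longrightarrow> x \<le> pi/2 \<Longrightarrow> Complex x 0 \<in> F_strip r"
  using r cosh_less_iff_less_arcosh[of "1/r" 0] by (simp add: F_strip_def)

lemma Re_F_less_half_pi:
  assumes "0 < x" "x < pi/2"
  shows "Re (F (Complex x 0)) < Re (F (Complex (pi/2) 0))"
proof (rule DERIV_pos_imp_increasing_open[OF assms(2), where f = "\<lambda>s. Re (F (Complex s 0))"])
  fix s assume "x < s" "s < pi/2"
  then have z: "Complex s 0 \<in> F_open_strip" using assms by (simp add: F_open_strip_def)
  show "\<exists>d. ((\<lambda>s. Re (F (Complex s 0))) has_real_derivative d) (at s) \<and> 0 < d"
    using Re_along_horizontal[OF F_at[OF z]] Re_F_integrand_pos z F_open_strip_subset by blast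
next
  show "continuous_on {x..pi/2} (\<lambda>s. Re (F (Complex s 0)))"
  proof (rule continuous_on_Re, rule continuous_on_compose2[OF F_cont])
    show "continuous_on {x..pi/2} (\<lambda>s. Complex s 0)"
      unfolding Complex_eq by (intro continuous_intros)
  qed (use assms real_in_F_strip in auto)
qed

text \<open>Two moves: going down to the real axis cannot decrease \<open>Re F\<close>, and going
  right along it to pi/2 increases it strictly.\<close>

lemma Re_F_less:
  assumes "0 < x" "x < pi/2" "0 < y"
  shows "Re (F (Complex x y)) < Re (F (Complex (pi/2) 0))"
proof -
  have "Re (F (Complex x y)) \<le> Re (F (Complex x 0))"
  proof (rule DERIV_nonpos_imp_nonincreasing[where f = "\<lambda>s. Re (F (Complex x s))"])
    fix s assume s: "0 \<le> s" "s \<le> y"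
    then have z: "Complex x s \<in> F_open_strip" using assms by (simp add: F_open_strip_def)
    have "cos x > 0" "sin x > 0" using assms by (auto intro!: cos_gt_zero sin_gt_zero)
    then have "Re (sin (Complex x s)) * Im (sin (Complex x s)) \<ge> 0"
      using s by (simp add: Re_sin_cosh Im_sin_sinh)
    then have "Im (F_integrand r (Complex x s)) \<ge> 0"
      using Im_F_integrand[of "Complex x s"] z F_open_strip_subset[of r] by (metis less_eq_real_def subsetD)
    then show "\<exists>d. ((\<lambda>s. Re (F (Complex x s))) has_real_derivative d) (at s) \<and> d \<le> 0"
      using Re_along_vertical[OF F_at[OF z], of UNIV] by (intro exI) auto
  qed (use assms in auto)
  then show ?thesis using Re_F_less_half_pi[OF assms(1,2)] by linarith
qed

text \<open>The sine is real on the edge, hence so is the integrand, and vertical steps leave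
  \<open>Re F\<close> fixed.\<close>

lemma Re_F_right_edge:
  assumes "\<bar>y\<bar> < arcosh (1/r)"
  shows "Re (F (Complex (pi/2) y)) = Re (F (Complex (pi/2) 0))"
proof -
  have "\<exists>c. \<forall>s\<in>{- arcosh (1/r)<..<arcosh (1/r)}. Re (F (Complex (pi/2) s)) = c"
  proof (rule has_field_derivative_zero_constant)
    fix s assume s: "s \<in> {- arcosh (1/r)<..<arcosh (1/r)}"
    have sub: "(\<lambda>s. Complex (pi/2) s) ` {- arcosh (1/r)<..<arcosh (1/r)} \<subseteq> F_strip r"
      by (auto simp: F_strip_def)
    then have z: "Complex (pi/2) s \<in> F_strip r" using s by blast
    have "Im (F_integrand r (Complex (pi/2) s)) = 0"
      by (intro Im_F_integrand z) (simp add: Im_sin_sinh)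
    then show "((\<lambda>s. Re (F (Complex (pi/2) s))) has_real_derivative 0) (at s within {- arcosh (1/r)<..<arcosh (1/r)})"
      using Re_along_vertical[OF F_within[OF z] sub] by simp
  qed auto
  then obtain c where "\<forall>s\<in>{- arcosh (1/r)<..<arcosh (1/r)}. Re (F (Complex (pi/2) s)) = c" by blast
  moreover have "0 < arcosh (1/r)" using assms by linarith
  ultimately show ?thesis using assms by (auto simp: abs_less_iff)
qed

text \<open>The integrand is unbounded near 1, where arcsin has no derivative. Continuity of
  \<open>F\<close> up to pi/2 lets the fundamental theorem work with derivatives in the interior
  only.\<close>

lemma ellK_eq: "ellK r = Re (F (Complex (pi/2) 0))"
proof -
  let ?f = "\<lambda>x. 1 / sqrt ((1 - x\<^sup>2) * (1 - r\<^sup>2 * x\<^sup>2))"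
  have "(?f has_integral (Re (F (Complex (arcsin 1) 0)) - Re (F (Complex (arcsin 0) 0)))) {0..1}"
  proof (rule fundamental_theorem_of_calculus_interior)
    show "continuous_on {0..1} (\<lambda>x. Re (F (Complex (arcsin x) 0)))"
    proof (rule continuous_on_Re, rule continuous_on_compose2[OF F_cont])
      show "continuous_on {0..1} (\<lambda>x. Complex (arcsin x) 0)"
        unfolding Complex_eq by (intro continuous_intros) auto
      show "(\<lambda>x. Complex (arcsin x) 0) ` {0..1} \<subseteq> F_strip r"
      proof
        fix z assume "z \<in> (\<lambda>x. Complex (arcsin x) 0) ` {0..1}"
        then obtain x where x: "0 \<le> x" "x \<le> 1" "z = Complex (arcsin x) 0" by auto
        then have "0 \<le> arcsin x" "arcsin x \<le> pi/2" using arcsin_bounded[of x] arcsin_le_arcsin[of 0 x] by auto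
        moreover have "- (pi/2) < 0" by simp
          ultimately show "z \<in> F_strip r" unfolding x(3) by (intro real_in_F_strip) linarith+
      qed
    qed
    fix x :: real assume x: "x \<in> {0<..<1}"
    have "- (pi/2) < arcsin x" "arcsin x < pi/2" using arcsin_lt_bounded[of x] x by auto
    then have z: "Complex (arcsin x) 0 \<in> F_open_strip" by (simp add: F_open_strip_def)
    have pos: "1 - r\<^sup>2 * x\<^sup>2 > 0" "1 - x\<^sup>2 > 0"
    proof -
      have "x\<^sup>2 < 1" using x by (simp add: power_less_one_iff abs_square_less_1)
      moreover have "r\<^sup>2 * x\<^sup>2 \<le> 1 * x\<^sup>2" using r by (intro mult_right_mono) (auto simp: power_le_one)
      ultimately show "1 - r\<^sup>2 * x\<^sup>2 > 0" "1 - x\<^sup>2 > 0" by auto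
    qed
    have sx: "sin (Complex (arcsin x) 0) = of_real x"
      using x by (simp add: complex_eq_iff Re_sin_cosh Im_sin_sinh)
    have "1 - of_real (r\<^sup>2) * (of_real x)\<^sup>2 = (of_real (1 - r\<^sup>2 * x\<^sup>2) :: complex)" by simp
    then have "F_integrand r (Complex (arcsin x) 0) = of_real (1 / sqrt (1 - r\<^sup>2 * x\<^sup>2))"
      unfolding F_integrand_def sx using pos by (simp only: csqrt_of_real_nonneg less_imp_le) simp
    then have "((\<lambda>s. Re (F (Complex s 0))) has_real_derivative 1 / sqrt (1 - r\<^sup>2 * x\<^sup>2)) (at (arcsin x))"
      using Re_along_horizontal[OF F_at[OF z]] by simp
    from DERIV_chain2[OF this DERIV_arcsin[of x]] x
    have "((\<lambda>x. Re (F (Complex (arcsin x) 0))) has_real_derivative 1 / sqrt (1 - r\<^sup>2 * x\<^sup>2) * inverse (sqrt (1 - x\<^sup>2))) (at x)"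
      by simp
    moreover have "1 / sqrt (1 - r\<^sup>2 * x\<^sup>2) * inverse (sqrt (1 - x\<^sup>2)) = ?f x"
      unfolding real_sqrt_mult by (simp add: divide_inverse mult.commute)
    ultimately show "((\<lambda>x. Re (F (Complex (arcsin x) 0))) has_vector_derivative ?f x) (at x)"
      unfolding has_real_derivative_iff_has_vector_derivative by simp
  qed auto
  then have "integral {0..1} ?f = Re (F (Complex (arcsin 1) 0)) - Re (F (Complex (arcsin 0) 0))"
    by (rule integral_unique)
  then show ?thesis using Re_F_imaginary[of 0] by (simp add: ellK_def)
qed

lemma ellK_pos: "ellK r > 0"
  using Re_F_pos[of "pi/4" 0] Re_F_less_half_pi[of "pi/4"] by (simp add: ellK_eq)

end

section \<open>Branches of the square root and of the arcsine\<close>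

lemma csqrt_of_real_eq: "0 \<le> x \<Longrightarrow> csqrt (of_real x) = of_real (sqrt x)"
  using csqrt_of_real_nonneg[of "of_real x"] by (simp del: csqrt.simps)

lemma csqrt_upper_half_plane:
  assumes "Im z > 0"
  shows "Re (csqrt z) > 0" "Im (csqrt z) > 0"
proof -
  show Re: "Re (csqrt z) > 0"
    by (rule csqrt_Re_pos) (use assms in \<open>auto simp: complex_nonpos_Reals_iff\<close>)
  have "Im ((csqrt z)\<^sup>2) > 0" using assms by simp
  then have "Re (csqrt z) * Im (csqrt z) > 0" unfolding Im_power2 by (simp add: mult.commute del: csqrt.simps)
  then show "Im (csqrt z) > 0" using Re by (simp only: zero_less_mult_iff) linarith
qed

text \<open>The right-hand side is continuous across the negative reals, the cut of
  \<open>csqrt\<close>, and so supplies the boundary values there from above.\<close>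

lemma csqrt_eq_imaginary_unit_times:
  assumes "Im z > 0"
  shows "csqrt z = \<i> * csqrt (- z)"
proof (rule csqrt_unique)
  show "(\<i> * csqrt (- z))\<^sup>2 = z" by (simp add: power_mult_distrib del: csqrt.simps)
  define w where "w = csqrt (- z)"
  have "Re w > 0"
    unfolding w_def by (rule csqrt_Re_pos) (use assms in \<open>auto simp: complex_nonpos_Reals_iff\<close>)
  have "w\<^sup>2 = - z" by (simp add: w_def del: csqrt.simps)
  then have "Im (w\<^sup>2) < 0" using assms by simp
  then have "Re w * Im w < 0" unfolding Im_power2 by (simp add: mult.commute)
  then have "Im w < 0" using \<open>Re w > 0\<close> by (simp add: mult_less_0_iff)
  then have "0 < Re (\<i> * w)" by simp
  then show "0 < Re (\<i> * csqrt (- z)) \<or> Re (\<i> * csqrt (- z)) = 0 \<and> 0 \<le> Im (\<i> * csqrt (- z))"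
    unfolding w_def by blast
qed

text \<open>The counterpart for the radicands 1 - z and 1 - r^2 z, which lie below the axis when z
  lies above it.\<close>

lemma csqrt_lower_half_plane:
  assumes "Im z < 0"
  shows "csqrt z = - \<i> * csqrt (- z)"
  using csqrt_eq_imaginary_unit_times[of "- z"] assms by (simp del: csqrt.simps)

text \<open>The cosine is a principal root off its cut, so its real part is positive and cos (Re
  \<phi>) > 0. Together with the signs of the two parts of the sine and the range of
  \<open>Re \<phi>\<close> this singles out the half strip.\<close>

lemma Arcsin_first_quadrant:
  assumes s: "Re s > 0" "Im s > 0"
  shows "0 < Re (Arcsin s)" "Re (Arcsin s) < pi/2" "0 < Im (Arcsin s)" "cos (Arcsin s) = csqrt (1 - s\<^sup>2)"
proof -
  define \<phi> where "\<phi> = Arcsin s"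
  show cs: "cos (Arcsin s) = csqrt (1 - s\<^sup>2)" using s by (intro cos_Arcsin) auto
  have "Im (1 - s\<^sup>2) < 0" using s by (simp add: Im_power2)
  then have "Re (cos \<phi>) > 0"
    unfolding \<phi>_def cs by (intro csqrt_Re_pos) (auto simp: complex_nonpos_Reals_iff)
  then have cpos: "cos (Re \<phi>) > 0"
    using cosh_real_pos[of "Im \<phi>"] by (auto simp: Re_cos_cosh zero_less_mult_iff)
  have "sin \<phi> = s" by (simp add: \<phi>_def)
  then have "sin (Re \<phi>) * cosh (Im \<phi>) > 0" "cos (Re \<phi>) * sinh (Im \<phi>) > 0"
    using s by (auto simp flip: Re_sin_cosh Im_sin_sinh)
  then have spos: "sin (Re \<phi>) > 0" and "sinh (Im \<phi>) > 0"
    using cpos cosh_real_pos[of "Im \<phi>"] by (auto simp: zero_less_mult_iff)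
  then show "0 < Im (Arcsin s)" by (simp add: \<phi>_def)
  have b: "- pi < Re \<phi>" "Re \<phi> \<le> pi" using Re_Arcsin_bounds[of s] by (auto simp: \<phi>_def)
  have "Re \<phi> > 0"
  proof (rule ccontr)
    assume "\<not> Re \<phi> > 0"
    then have "sin (- Re \<phi>) \<ge> 0" using b by (intro sin_ge_zero) auto
    then show False using spos by simp
  qed
  moreover have "Re \<phi> < pi/2"
  proof (rule ccontr)
    assume "\<not> Re \<phi> < pi/2"
    then have "cos (Re \<phi>) \<le> cos (pi/2)" using b by (intro cos_monotone_0_pi_le) auto
    then show False using cpos by simp
  qed
  ultimately show "0 < Re (Arcsin s)" "Re (Arcsin s) < pi/2" by (auto simp: \<phi>_def)
qed

text \<open>The derivative of \<open>psi r\<close> in the upper half plane. Each of the three roots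
  is analytic there, whereas the principal root of the product would jump: for some z the arguments
  of the radicands add up to less than -pi.\<close>

definition psi_deriv :: "real \<Rightarrow> complex \<Rightarrow> complex" where
  "psi_deriv r z = 1 / (of_real (2 * ellK r) * csqrt z * csqrt (1 - z) * csqrt (1 - of_real (r\<^sup>2) * z))"

section \<open>Values of \<open>psi\<close> and of its derivative, inside and at the
  boundary\<close>

context elliptic_primitive
begin

lemma Arcsin_csqrt_in_strip: "Im z > 0 \<Longrightarrow> Arcsin (csqrt z) \<in> F_open_strip"
  using Arcsin_first_quadrant[OF csqrt_upper_half_plane] pi_gt_zero
  unfolding F_open_strip_def mem_Collect_eq by (smt (verit) field_sum_of_halves)

text \<open>\<open>F\<close> after \<open>Arcsin\<close> is a primitive of the original integrand
  along the segment from 0 to the root of \<open>z\<close>: apart from 0 the segment lies in the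
  first quadrant, where the cosine of the arcsine is the principal root.\<close>

lemma psi_eq:
  assumes z: "Im z > 0"
  shows "psi r z = F (Arcsin (csqrt z)) / of_real (ellK r)"
proof -
  define s where "s = csqrt z"
  have s: "Re s > 0" "Im s > 0" using csqrt_upper_half_plane[OF z] by (auto simp: s_def)
  let ?e = "\<lambda>s. 1 / (csqrt (1 - s\<^sup>2) * csqrt (1 - of_real (r\<^sup>2) * s\<^sup>2))"
  have "(?e has_contour_integral ((F \<circ> Arcsin) (pathfinish (linepath 0 s)) - (F \<circ> Arcsin) (pathstart (linepath 0 s)))) (linepath 0 s)"
  proof (rule contour_integral_primitive)
    fix w assume "w \<in> closed_segment 0 s"
    then obtain x where x: "0 \<le> x" "x \<le> 1" "w = of_real x * s"
      by (auto simp: closed_segment_def scaleR_conv_of_real)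
    have w: "Arcsin w \<in> F_open_strip \<and> cos (Arcsin w) = csqrt (1 - w\<^sup>2) \<and> (Im w = 0 \<longrightarrow> \<bar>Re w\<bar> < 1)"
    proof (cases "x = 0")
      case True then show ?thesis using x by (simp add: F_open_strip_def)
    next
      case False
      then have "Re w > 0" "Im w > 0" using x s by auto
      then show ?thesis using Arcsin_first_quadrant[of w] by (auto simp: F_open_strip_def)
    qed
    have "((F \<circ> Arcsin) has_field_derivative F_integrand r (Arcsin w) * inverse (cos (Arcsin w))) (at w)"
      using w by (intro DERIV_chain F_at has_field_derivative_Arcsin) auto
    moreover have "F_integrand r (Arcsin w) * inverse (cos (Arcsin w)) = ?e w"
      using w by (simp add: F_integrand_def field_simps del: csqrt.simps)
    ultimately show "((F \<circ> Arcsin) has_field_derivative ?e w) (at w within closed_segment 0 s)"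
      using has_field_derivative_at_within by metis
  qed (simp_all only: valid_path_linepath path_image_linepath subset_refl)
  then have "contour_integral (linepath 0 s) ?e = F (Arcsin s)"
    by (intro contour_integral_unique) (simp add: F0)
  then show ?thesis by (simp add: psi_def ellF_def s_def[symmetric] del: csqrt.simps)
qed

lemma psi_bounds:
  assumes z: "Im z > 0"
  shows "0 < Re (psi r z)" "Re (psi r z) < 1"
proof -
  define \<phi> where "\<phi> = Arcsin (csqrt z)"
  have \<phi>: "0 < Re \<phi>" "Re \<phi> < pi/2" "0 < Im \<phi>"
    using Arcsin_first_quadrant[OF csqrt_upper_half_plane[OF z]] by (auto simp: \<phi>_def)
  have "0 < Re (F \<phi>)" "Re (F \<phi>) < ellK r"
    using Re_F_pos[OF \<phi>(1,2), of "Im \<phi>"] Re_F_less[OF \<phi>] by (auto simp: ellK_eq)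
  then show "0 < Re (psi r z)" "Re (psi r z) < 1"
    using ellK_pos by (auto simp: psi_eq[OF z] \<phi>_def[symmetric] field_simps simp del: csqrt.simps)
qed

lemma psi_has_field_derivative:
  assumes z: "Im z > 0"
  shows "(psi r has_field_derivative psi_deriv r z) (at z)"
proof -
  note q = csqrt_upper_half_plane[OF z]
  have alg: "1 / a * (inverse b * inverse (2 * c)) / K = 1 / (2 * K * c * b * a)" for a b c K :: complex
    by (simp add: divide_simps)
  note A = Arcsin_first_quadrant[OF q]
  have "(csqrt has_field_derivative inverse (2 * csqrt z)) (at z)"
    by (rule has_field_derivative_csqrt) (use z in \<open>auto simp: complex_nonpos_Reals_iff\<close>)
  moreover have "(Arcsin has_field_derivative inverse (cos (Arcsin (csqrt z)))) (at (csqrt z))"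
    using q by (intro has_field_derivative_Arcsin) (simp del: csqrt.simps)
  ultimately have "((\<lambda>z. Arcsin (csqrt z)) has_field_derivative
      inverse (cos (Arcsin (csqrt z))) * inverse (2 * csqrt z)) (at z)"
    by (intro DERIV_chain2)
  from DERIV_chain2[OF F_at[OF Arcsin_csqrt_in_strip[OF z]] this]
  have "((\<lambda>z. F (Arcsin (csqrt z)) / of_real (ellK r)) has_field_derivative
      F_integrand r (Arcsin (csqrt z)) * (inverse (cos (Arcsin (csqrt z))) * inverse (2 * csqrt z)) / of_real (ellK r)) (at z)"
    by (rule DERIV_cdivide)
  moreover have "F_integrand r (Arcsin (csqrt z)) * (inverse (cos (Arcsin (csqrt z))) * inverse (2 * csqrt z)) / of_real (ellK r)
      = psi_deriv r z"
    unfolding A(4) F_integrand_def psi_deriv_def sin_Arcsin power2_csqrt of_real_mult of_real_numeral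
    by (rule alg)
  ultimately have "((\<lambda>z. F (Arcsin (csqrt z)) / of_real (ellK r)) has_field_derivative psi_deriv r z) (at z)" by simp
  then show ?thesis
    by (rule has_field_derivative_transform_within_open[OF _ open_upper_half_plane])
      (use z in \<open>auto simp: psi_eq simp del: csqrt.simps\<close>)
qed

text \<open>The principal root jumps at negative reals, so its continuation from above replaces it.
  This sends them to the positive imaginary axis, where \<open>Arcsin\<close> is imaginary and
  \<open>Re F\<close> vanishes.\<close>

lemma psi_tendsto_0:
  assumes x: "x < 0"
  shows "((\<lambda>z. Re (psi r z)) \<longlongrightarrow> 0) (at (of_real x) within upper_half_plane)"
proof -
  let ?w = "\<i> * csqrt (- of_real x)"
  have "csqrt (- of_real x) = of_real (sqrt (- x))"
    using x csqrt_of_real_eq[of "- x"] by (simp del: csqrt.simps)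
  then have w: "?w = \<i> * of_real (sqrt (- x))" by simp
  have contA: "isCont (\<lambda>z. Arcsin (\<i> * csqrt (- z))) (of_real x)"
  proof (rule isCont_Arcsin')
    show "isCont (\<lambda>z. \<i> * csqrt (- z)) (of_real x)"
      using x by (intro continuous_intros isCont_csqrt') auto
    show "Im ?w = 0 \<Longrightarrow> \<bar>Re ?w\<bar> < 1" unfolding w by simp
  qed
  have Re0: "Re (Arcsin ?w) = 0"
  proof -
    \<comment> \<open>\<open>Arcsin\<close> is -i times the logarithm of this number, which is real
      because the number is positive.\<close>
    define v where "v = - sqrt (- x) + sqrt (1 - x)"
    have "\<i> * ?w + csqrt (1 - ?w\<^sup>2) = of_real v"
    proof -
      have "1 - ?w\<^sup>2 = of_real (1 - x)" unfolding w using x by (simp add: power_mult_distrib flip: of_real_power)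
      then have "csqrt (1 - ?w\<^sup>2) = of_real (sqrt (1 - x))" using x csqrt_of_real_eq[of "1 - x"] by (simp only:)
      then show ?thesis unfolding w v_def by simp
    qed
    moreover have "v > 0" using x by (simp add: v_def real_sqrt_less_mono)
    ultimately show ?thesis unfolding Arcsin_def by (simp only: Ln_of_real) simp
  qed
  then have in_strip: "Arcsin ?w \<in> F_open_strip" by (simp add: F_open_strip_def del: csqrt.simps)
  have "isCont F (Arcsin ?w)" by (rule DERIV_isCont[OF F_at[OF in_strip]])
  with contA have "isCont (\<lambda>z. F (Arcsin (\<i> * csqrt (- z)))) (of_real x)" by (rule isCont_o2)
  then have "((\<lambda>z. F (Arcsin (\<i> * csqrt (- z)))) \<longlongrightarrow> F (Arcsin ?w)) (at (of_real x) within upper_half_plane)"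
    unfolding isCont_def by (rule tendsto_within_subset) simp
  then have "((\<lambda>z. Re (F (Arcsin (\<i> * csqrt (- z))) / of_real (ellK r))) \<longlongrightarrow> Re (F (Arcsin ?w) / of_real (ellK r)))
      (at (of_real x) within upper_half_plane)"
    using ellK_pos by (intro tendsto_Re tendsto_divide tendsto_const) auto
  moreover have "Re (F (Arcsin ?w) / of_real (ellK r)) = 0"
  proof -
    have "Arcsin ?w = Complex 0 (Im (Arcsin ?w))" using Re0 by (simp add: complex_eq_iff del: csqrt.simps)
    then have "Re (F (Arcsin ?w)) = 0" using Re_F_imaginary by metis
    then show ?thesis by (simp del: csqrt.simps)
  qed
  ultimately have "((\<lambda>z. Re (F (Arcsin (\<i> * csqrt (- z))) / of_real (ellK r))) \<longlongrightarrow> 0) (at (of_real x) within upper_half_plane)"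
    by (simp only:)
  then show ?thesis
  proof (rule Lim_transform_eventually)
    show "\<forall>\<^sub>F z in at (of_real x) within upper_half_plane.
       Re (F (Arcsin (\<i> * csqrt (- z))) / of_real (ellK r)) = Re (psi r z)"
      unfolding eventually_at_filter
      by (intro always_eventually allI impI) (metis csqrt_eq_imaginary_unit_times mem_upper_half_plane psi_eq)
  qed
qed

text \<open>The root of \<open>x\<close> exceeds 1 and lies on the cut of \<open>Arcsin\<close>. The
  function \<open>A\<close> continues the arcsine of the root from above; its value at
  \<open>x\<close> lies on the right edge of the strip, where \<open>Re F\<close> equals
  \<open>ellK r\<close>.\<close>

lemma psi_tendsto_1:
  assumes x: "1 < x" "x < 1 / r\<^sup>2"
  shows "((\<lambda>z. Re (psi r z)) \<longlongrightarrow> 1) (at (of_real x) within upper_half_plane)"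
proof -
  define A where "A = (\<lambda>z. - \<i> * Ln (\<i> * csqrt z - \<i> * csqrt (z - 1)))"
  define q where "q = sqrt x - sqrt (x - 1)"
  have q: "q > 0" using x by (simp add: q_def)
  have at_x: "\<i> * csqrt (of_real x) - \<i> * csqrt (of_real x - 1) = \<i> * of_real q"
  proof -
    have "csqrt (of_real x) = of_real (sqrt x)" "csqrt (of_real (x - 1)) = of_real (sqrt (x - 1))"
      using x by (auto intro!: csqrt_of_real_eq simp del: of_real_diff csqrt.simps)
    then show ?thesis by (simp add: q_def algebra_simps del: csqrt.simps)
  qed
  have A_eq: "A z = Arcsin (csqrt z)" if "Im z > 0" for z
  proof -
    have "csqrt (1 - z) = - \<i> * csqrt (- (1 - z))" by (rule csqrt_lower_half_plane) (use that in simp)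
    then have "csqrt (1 - (csqrt z)\<^sup>2) = - \<i> * csqrt (z - 1)" by simp
    then show ?thesis unfolding A_def Arcsin_def by simp
  qed
  have contA: "isCont A (of_real x)"
    unfolding A_def using x q at_x
    by (intro continuous_intros isCont_csqrt' isCont_Ln') (auto simp: complex_nonpos_Reals_iff simp del: csqrt.simps)
  have Ax: "A (of_real x) = Complex (pi/2) (- ln q)"
  proof -
    have "A (of_real x) = - \<i> * (Ln (of_real q) + \<i> * of_real (pi/2))"
      unfolding A_def at_x using q by (subst Ln_times_ii) (auto simp: Ln_of_real)
    also have "\<dots> = Complex (pi/2) (- ln q)" using q by (simp add: Ln_of_real complex_eq_iff)
    finally show ?thesis .
  qed
  \<comment> \<open>Since 1/q is the sum of the two roots, cosh (ln q) is the root of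
    \<open>x\<close>; by x < 1/r^2 the point lies below the end of the edge.\<close>
  have edge: "\<bar>- ln q\<bar> < arcosh (1/r)"
  proof -
    have "inverse q = sqrt x + sqrt (x - 1)"
    proof (rule inverse_unique)
      show "q * (sqrt x + sqrt (x - 1)) = 1" using x by (simp add: q_def algebra_simps)
    qed
    then have "cosh (- ln q) = sqrt x"
      using q by (simp add: cosh_def exp_minus) (simp add: q_def)
    also have "sqrt x < sqrt (1 / r\<^sup>2)" using x by simp
    also have "\<dots> = 1 / r" using r by (simp add: real_sqrt_divide)
    finally show ?thesis using r by (subst cosh_less_iff_less_arcosh[symmetric]) auto
  qed
  then have in_strip: "A (of_real x) \<in> F_strip r" by (simp add: Ax F_strip_def)
  have "(A \<longlongrightarrow> A (of_real x)) (at (of_real x) within upper_half_plane)"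
    using contA unfolding isCont_def by (rule tendsto_within_subset) simp
  moreover have A_in: "\<forall>\<^sub>F z in at (of_real x) within upper_half_plane. A z \<in> F_strip r"
    unfolding eventually_at_filter
    by (intro always_eventually allI impI) (metis A_eq Arcsin_csqrt_in_strip F_open_strip_subset mem_upper_half_plane subsetD)
  ultimately have "((\<lambda>z. F (A z)) \<longlongrightarrow> F (A (of_real x))) (at (of_real x) within upper_half_plane)"
    by (rule continuous_on_tendsto_compose[OF F_cont _ in_strip])
  then have lim: "((\<lambda>z. Re (F (A z) / of_real (ellK r))) \<longlongrightarrow> Re (F (A (of_real x)) / of_real (ellK r)))
      (at (of_real x) within upper_half_plane)"
    using ellK_pos by (intro tendsto_intros) auto
  have val: "Re (F (A (of_real x)) / of_real (ellK r)) = 1"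
    using Re_F_right_edge[OF edge] ellK_pos by (simp add: Ax ellK_eq)
  have ev: "\<forall>\<^sub>F z in at (of_real x) within upper_half_plane. Re (F (A z) / of_real (ellK r)) = Re (psi r z)"
    unfolding eventually_at_filter
    by (intro always_eventually allI impI) (metis A_eq mem_upper_half_plane psi_eq)
  show ?thesis using Lim_transform_eventually[OF lim ev] unfolding val .
qed

text \<open>Real boundary values of the derivative are the Neumann condition. Beyond 1/r^2 two of
  the radicands are negative, and their two factors -i combine to the real factor -1.\<close>

lemma psi_deriv_tendsto:
  assumes x: "0 < x" "x < 1 \<or> 1 / r\<^sup>2 < x"
  obtains c :: real where "(psi_deriv r \<longlongrightarrow> of_real c) (at (of_real x) within upper_half_plane)"
proof (cases "x < 1")
  case True
  have rx: "r\<^sup>2 * x < 1"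
    using mult_strict_mono[of "r\<^sup>2" 1 x 1] True x r by (simp add: power_less_one_iff)
  have "isCont (psi_deriv r) (of_real x)"
    unfolding psi_deriv_def[abs_def]
    by (intro continuous_intros isCont_csqrt')
      (use True x rx ellK_pos in \<open>auto simp: complex_nonpos_Reals_iff complex_eq_iff simp del: csqrt.simps\<close>)
  then have "(psi_deriv r \<longlongrightarrow> psi_deriv r (of_real x)) (at (of_real x) within upper_half_plane)"
    unfolding isCont_def by (rule tendsto_within_subset) simp
  moreover have "psi_deriv r (of_real x) = of_real (1 / (2 * ellK r * sqrt x * sqrt (1 - x) * sqrt (1 - r\<^sup>2 * x)))"
  proof -
    have "csqrt (of_real x) = of_real (sqrt x)" "csqrt (of_real (1 - x)) = of_real (sqrt (1 - x))"
      "csqrt (of_real (1 - r\<^sup>2 * x)) = of_real (sqrt (1 - r\<^sup>2 * x))"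
      using x True rx by (auto intro!: csqrt_of_real_eq simp del: of_real_diff csqrt.simps)
    then show ?thesis by (simp add: psi_deriv_def del: csqrt.simps)
  qed
  ultimately show ?thesis using that by metis
next
  case False
  then have x: "1 / r\<^sup>2 < x" using x by simp
  have "1 < 1 / r\<^sup>2" using r by (simp add: power_less_one_iff)
  then have x1: "1 < x" using x by simp
  have rx: "1 < r\<^sup>2 * x" using x r by (simp add: field_simps)
  define P where "P = (\<lambda>z. - 1 / (of_real (2 * ellK r) * csqrt z * csqrt (z - 1) * csqrt (of_real (r\<^sup>2) * z - 1)))"
  have "isCont P (of_real x)"
    unfolding P_def
    by (intro continuous_intros isCont_csqrt')
      (use x1 rx ellK_pos in \<open>auto simp: complex_nonpos_Reals_iff complex_eq_iff simp del: csqrt.simps\<close>)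
  then have "(P \<longlongrightarrow> P (of_real x)) (at (of_real x) within upper_half_plane)"
    unfolding isCont_def by (rule tendsto_within_subset) simp
  moreover have "\<forall>\<^sub>F z in at (of_real x) within upper_half_plane. P z = psi_deriv r z"
    unfolding eventually_at_filter
  proof (intro always_eventually allI impI)
    fix z assume "z \<in> upper_half_plane"
    then have z: "Im z > 0" by simp
    have "csqrt (1 - z) = - \<i> * csqrt (- (1 - z))" by (rule csqrt_lower_half_plane) (use z in simp)
    moreover have "csqrt (1 - of_real (r\<^sup>2) * z) = - \<i> * csqrt (- (1 - of_real (r\<^sup>2) * z))"
      by (rule csqrt_lower_half_plane) (use z r in simp)
    ultimately have prod: "csqrt (1 - z) * csqrt (1 - of_real (r\<^sup>2) * z) =
        - (csqrt (z - 1) * csqrt (of_real (r\<^sup>2) * z - 1))"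
      by (simp add: algebra_simps del: csqrt.simps of_real_power)
    show "P z = psi_deriv r z"
      unfolding P_def psi_deriv_def by (simp only: mult.assoc prod) (simp del: csqrt.simps)
  qed
  ultimately have "(psi_deriv r \<longlongrightarrow> P (of_real x)) (at (of_real x) within upper_half_plane)"
    by (rule Lim_transform_eventually)
  moreover have "P (of_real x) = of_real (- 1 / (2 * ellK r * sqrt x * sqrt (x - 1) * sqrt (r\<^sup>2 * x - 1)))"
  proof -
    have "csqrt (of_real x) = of_real (sqrt x)" "csqrt (of_real (x - 1)) = of_real (sqrt (x - 1))"
      "csqrt (of_real (r\<^sup>2 * x - 1)) = of_real (sqrt (r\<^sup>2 * x - 1))"
      using x1 rx by (auto intro!: csqrt_of_real_eq simp del: of_real_diff csqrt.simps)
    then show ?thesis by (simp add: P_def del: csqrt.simps)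
  qed
  ultimately show ?thesis using that by metis
qed

text \<open>Squaring removes the branches. The same cubic multiplies the squared derivative of an
  arbitrary solution, which permits the comparison in the uniqueness proof.\<close>

lemma psi_deriv_square:
  assumes "Im z > 0"
  shows "(psi_deriv r z)\<^sup>2 * (z * (z - 1) * (z - of_real (1 / r\<^sup>2))) = of_real (1 / (2 * ellK r * r)\<^sup>2)"
proof -
  have z: "z \<noteq> 0" "z - 1 \<noteq> 0" "z - of_real (1 / r\<^sup>2) \<noteq> 0" using assms by (auto simp: complex_eq_iff)
  have K: "of_real (2 * ellK r) \<noteq> (0::complex)" "of_real (r\<^sup>2) \<noteq> (0::complex)" using ellK_pos r by auto
  have eq: "1 - of_real (r\<^sup>2) * z = - of_real (r\<^sup>2) * (z - of_real (1 / r\<^sup>2))"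
    using K(2) by (simp add: algebra_simps del: of_real_power)
  have "(psi_deriv r z)\<^sup>2 = 1 / ((of_real (2 * ellK r))\<^sup>2 * z * (1 - z) * (1 - of_real (r\<^sup>2) * z))"
    unfolding psi_deriv_def power_divide power_mult_distrib power2_csqrt by simp
  also have "\<dots> = 1 / ((of_real (2 * ellK r))\<^sup>2 * of_real (r\<^sup>2) * (z * (z - 1) * (z - of_real (1 / r\<^sup>2))))"
    unfolding eq by (simp add: algebra_simps del: of_real_power of_real_divide)
  finally show ?thesis using z K by (simp add: power_mult_distrib)
qed

lemma psi_deriv_nonzero: "Im z > 0 \<Longrightarrow> psi_deriv r z \<noteq> 0"
  using psi_deriv_square[of z] ellK_pos r by auto

end

section \<open>Harmonic functions and the Riemann sphere\<close>

lemma second_difference_eq: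
  fixes f fx fxy :: "real \<Rightarrow> real \<Rightarrow> real"
  assumes s: "s > 0"
    and fx: "\<And>a b. a \<in> {x..x+s} \<Longrightarrow> b \<in> {y..y+s} \<Longrightarrow> ((\<lambda>a. f a b) has_real_derivative fx a b) (at a)"
    and fxy: "\<And>a b. a \<in> {x..x+s} \<Longrightarrow> b \<in> {y..y+s} \<Longrightarrow> ((\<lambda>b. fx a b) has_real_derivative fxy a b) (at b)"
  shows "\<exists>a\<in>{x..x+s}. \<exists>b\<in>{y..y+s}. f (x+s) (y+s) - f (x+s) y - f x (y+s) + f x y = s * s * fxy a b"
proof -
  have "\<exists>a. x < a \<and> a < x + s \<and>
      (f (x+s) (y+s) - f (x+s) y) - (f x (y+s) - f x y) = (x + s - x) * (fx a (y+s) - fx a y)"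
    by (rule MVT2) (use s in \<open>auto intro!: derivative_eq_intros fx\<close>)
  then obtain a where a: "x < a" "a < x + s"
    "(f (x+s) (y+s) - f (x+s) y) - (f x (y+s) - f x y) = s * (fx a (y+s) - fx a y)" by auto
  have "\<exists>b. y < b \<and> b < y + s \<and> fx a (y+s) - fx a y = (y + s - y) * fxy a b"
    by (rule MVT2) (use s a in \<open>auto intro!: fxy\<close>)
  then obtain b where "y < b" "b < y + s" "fx a (y+s) - fx a y = s * fxy a b" by auto
  then show ?thesis using a by (intro bexI[of _ a] bexI[of _ b]) auto
qed

lemma has_derivative_partials:
  fixes u :: "complex \<Rightarrow> real"
  assumes "(u has_derivative (\<lambda>h. p * Re h + q * Im h)) (at (Complex a b))"
  shows "((\<lambda>a. u (Complex a b)) has_real_derivative p) (at a)"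
    and "((\<lambda>b. u (Complex a b)) has_real_derivative q) (at b)"
proof -
  have "((\<lambda>a. Complex a b) has_derivative (\<lambda>h. of_real h)) (at a)"
    unfolding Complex_eq by (auto intro!: derivative_eq_intros)
  from has_derivative_compose[OF this assms]
  show "((\<lambda>a. u (Complex a b)) has_real_derivative p) (at a)"
    by (simp add: has_field_derivative_def mult_commute_abs)
  have "((\<lambda>b. Complex a b) has_derivative (\<lambda>h. \<i> * of_real h)) (at b)"
    unfolding Complex_eq by (auto intro!: derivative_eq_intros)
  from has_derivative_compose[OF this assms]
  show "((\<lambda>b. u (Complex a b)) has_real_derivative q) (at b)"
    by (simp add: has_field_derivative_def mult_commute_abs)
qed

text \<open>Harmonicity comes with two separate mixed derivatives. The second difference over a
  small square equals \<open>s * s\<close> times a value of either one, and by continuity both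
  values are close to those at \<open>z\<close>.\<close>

lemma mixed_partials_eq:
  fixes u :: "complex \<Rightarrow> real"
  assumes "open S" "z \<in> S"
    and u: "\<And>z. z \<in> S \<Longrightarrow> (u has_derivative (\<lambda>h. ux z * Re h + uy z * Im h)) (at z)"
    and ux: "\<And>z. z \<in> S \<Longrightarrow> (ux has_derivative (\<lambda>h. uxx z * Re h + uxy z * Im h)) (at z)"
    and uy: "\<And>z. z \<in> S \<Longrightarrow> (uy has_derivative (\<lambda>h. uyx z * Re h + uyy z * Im h)) (at z)"
    and cont: "continuous_on S uxy" "continuous_on S uyx"
  shows "uxy z = uyx z"
proof (rule ccontr)
  assume ne: "uxy z \<noteq> uyx z"
  define e where "e = \<bar>uxy z - uyx z\<bar> / 2"
  have e: "e > 0" using ne by (simp add: e_def)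
  obtain d0 where d0: "d0 > 0" "ball z d0 \<subseteq> S" using assms(1,2) open_contains_ball by blast
  obtain d1 where d1: "d1 > 0" "\<And>w. w \<in> S \<Longrightarrow> dist w z < d1 \<Longrightarrow> \<bar>uxy w - uxy z\<bar> < e"
    using cont(1) e \<open>z \<in> S\<close> unfolding continuous_on_iff dist_real_def by metis
  obtain d2 where d2: "d2 > 0" "\<And>w. w \<in> S \<Longrightarrow> dist w z < d2 \<Longrightarrow> \<bar>uyx w - uyx z\<bar> < e"
    using cont(2) e \<open>z \<in> S\<close> unfolding continuous_on_iff dist_real_def by metis
  define m where "m = min d0 (min d1 d2)"
  have m: "m \<le> d0" "m \<le> d1" "m \<le> d2" by (auto simp: m_def)
  define s where "s = m / 4"
  have s: "s > 0" using d0 d1 d2 by (simp add: s_def m_def)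
  let ?x = "Re z" and ?y = "Im z"
  have near: "dist (Complex a b) z < m" if "a \<in> {?x..?x+s}" "b \<in> {?y..?y+s}" for a b
  proof -
    have "norm (Complex a b - z) \<le> \<bar>a - ?x\<bar> + \<bar>b - ?y\<bar>" using cmod_le[of "Complex a b - z"] by simp
    also have "\<dots> \<le> 2 * s" using that by auto
    also have "\<dots> < m" using s by (simp add: s_def)
    finally show ?thesis by (simp add: dist_norm)
  qed
  have inS: "Complex a b \<in> S" if "a \<in> {?x..?x+s}" "b \<in> {?y..?y+s}" for a b
    using near[OF that] d0(2) m by (auto simp: dist_commute)
  let ?D = "u (Complex (?x+s) (?y+s)) - u (Complex (?x+s) ?y) - u (Complex ?x (?y+s)) + u (Complex ?x ?y)"
  have "\<exists>a\<in>{?x..?x+s}. \<exists>b\<in>{?y..?y+s}. ?D = s * s * uxy (Complex a b)"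
    by (rule second_difference_eq[OF s, where f = "\<lambda>a b. u (Complex a b)" and fx = "\<lambda>a b. ux (Complex a b)"])
      (use has_derivative_partials[OF u[OF inS]] has_derivative_partials[OF ux[OF inS]] in auto)
  then obtain a b where ab: "a \<in> {?x..?x+s}" "b \<in> {?y..?y+s}" "?D = s * s * uxy (Complex a b)" by blast
  have "\<exists>b\<in>{?y..?y+s}. \<exists>a\<in>{?x..?x+s}. u (Complex (?x+s) (?y+s)) - u (Complex ?x (?y+s)) - u (Complex (?x+s) ?y) + u (Complex ?x ?y)
      = s * s * uyx (Complex a b)"
    by (rule second_difference_eq[OF s, where f = "\<lambda>b a. u (Complex a b)" and fx = "\<lambda>b a. uy (Complex a b)"])
      (use has_derivative_partials[OF u[OF inS]] has_derivative_partials[OF uy[OF inS]] in auto)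
  then obtain a' b' where ab': "a' \<in> {?x..?x+s}" "b' \<in> {?y..?y+s}"
    "u (Complex (?x+s) (?y+s)) - u (Complex ?x (?y+s)) - u (Complex (?x+s) ?y) + u (Complex ?x ?y) = s * s * uyx (Complex a' b')" by blast
  have "s * s * uxy (Complex a b) = s * s * uyx (Complex a' b')" using ab(3) ab'(3) by linarith
  then have eq: "uxy (Complex a b) = uyx (Complex a' b')" using s by simp
  have "\<bar>uxy (Complex a b) - uxy z\<bar> < e" using near[OF ab(1,2)] m by (intro d1 inS ab) auto
  moreover have "\<bar>uyx (Complex a' b') - uyx z\<bar> < e" using near[OF ab'(1,2)] m by (intro d2 inS ab') auto
  ultimately show False unfolding eq e_def by (simp add: abs_if split: if_splits)
qed

text \<open>\<open>g\<close> is the complex gradient ux - i uy; symmetry of the mixed derivatives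
  and the Laplace equation are its Cauchy-Riemann equations.\<close>

lemma harmonic_plane_gradient:
  assumes "harmonic_plane u S" "open S"
  obtains g where "g holomorphic_on S" "\<And>z. z \<in> S \<Longrightarrow> (u has_derivative (\<lambda>h. Re (g z * h))) (at z)"
proof -
  obtain ux uy uxx uxy uyx uyy where
    h: "\<And>z. z \<in> S \<Longrightarrow>
           (u has_derivative (\<lambda>h. ux z * Re h + uy z * Im h)) (at z) \<and>
           (ux has_derivative (\<lambda>h. uxx z * Re h + uxy z * Im h)) (at z) \<and>
           (uy has_derivative (\<lambda>h. uyx z * Re h + uyy z * Im h)) (at z) \<and>
           uxx z + uyy z = 0"
    and cont: "continuous_on S uxy" "continuous_on S uyx"
    using assms(1) unfolding harmonic_plane_def by blast
  have sym: "uxy z = uyx z" if "z \<in> S" for z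
    by (rule mixed_partials_eq[OF assms(2) that _ _ _ cont]) (use h in blast)+
  define g where "g = (\<lambda>z. of_real (ux z) - \<i> * of_real (uy z))"
  have "(g has_field_derivative Complex (uxx z) (- uxy z)) (at z)" if z: "z \<in> S" for z
  proof -
    have "(g has_derivative (\<lambda>h. of_real (uxx z * Re h + uxy z * Im h) - \<i> * of_real (uyx z * Re h + uyy z * Im h))) (at z)"
      unfolding g_def using h[OF z] by (intro derivative_intros) auto
    moreover have "(\<lambda>h. of_real (uxx z * Re h + uxy z * Im h) - \<i> * of_real (uyx z * Re h + uyy z * Im h))
       = (*) (Complex (uxx z) (- uxy z))"
    proof -
      have "uyy z = - uxx z" using h[OF z] by linarith
      then show ?thesis using sym[OF z] by (auto simp: complex_eq_iff)
    qed
    ultimately show ?thesis by (simp add: has_field_derivative_def)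
  qed
  then have "g holomorphic_on S"
    using assms(2) by (auto simp: holomorphic_on_open)
  moreover have "(u has_derivative (\<lambda>h. Re (g z * h))) (at z)" if "z \<in> S" for z
  proof -
    have "(\<lambda>h. Re (g z * h)) = (\<lambda>h. ux z * Re h + uy z * Im h)" by (auto simp: g_def)
    then show ?thesis using h[OF that] by simp
  qed
  ultimately show ?thesis using that by blast
qed

lemma has_derivative_Re_holomorphic:
  assumes "(k has_field_derivative D) (at z)"
  shows "((\<lambda>z. Re (k z)) has_derivative (\<lambda>h. Re (D * h))) (at z)"
    and "((\<lambda>z. Im (k z)) has_derivative (\<lambda>h. Im (D * h))) (at z)"
  using bounded_linear.has_derivative[OF bounded_linear_Re assms[unfolded has_field_derivative_def]]
    bounded_linear.has_derivative[OF bounded_linear_Im assms[unfolded has_field_derivative_def]] by blast+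

lemma harmonic_plane_Re:
  assumes "k holomorphic_on S" "open S" "\<And>z. z \<in> S \<Longrightarrow> u z = Re (k z)"
  shows "harmonic_plane u S"
proof -
  define k1 k2 where "k1 = deriv k" and "k2 = deriv k1"
  have hol: "k1 holomorphic_on S" "k2 holomorphic_on S"
    using assms(1,2) unfolding k1_def k2_def by (auto intro!: holomorphic_deriv)
  have dk: "(k has_field_derivative k1 z) (at z)" "(k1 has_field_derivative k2 z) (at z)" if "z \<in> S" for z
    using that assms(1,2) hol unfolding k1_def k2_def by (auto intro: holomorphic_derivI)
  have f1: "(u has_derivative (\<lambda>h. Re (k1 z) * Re h + (- Im (k1 z)) * Im h)) (at z)" if z: "z \<in> S" for z
  proof -
    have "((\<lambda>z. Re (k z)) has_derivative (\<lambda>h. Re (k1 z * h))) (at z)"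
      by (rule has_derivative_Re_holomorphic[OF dk(1)[OF z]])
    then have "(u has_derivative (\<lambda>h. Re (k1 z * h))) (at z)"
      by (rule has_derivative_transform_within_open[OF _ assms(2) z]) (simp add: assms(3))
    then show ?thesis by simp
  qed
  have f2: "((\<lambda>z. Re (k1 z)) has_derivative (\<lambda>h. Re (k2 z) * Re h + (- Im (k2 z)) * Im h)) (at z)" if z: "z \<in> S" for z
    using has_derivative_Re_holomorphic(1)[OF dk(2)[OF z]] by simp
  have f3: "((\<lambda>z. - Im (k1 z)) has_derivative (\<lambda>h. (- Im (k2 z)) * Re h + (- Re (k2 z)) * Im h)) (at z)" if z: "z \<in> S" for z
    using has_derivative_minus[OF has_derivative_Re_holomorphic(2)[OF dk(2)[OF z]]] by (simp add: algebra_simps)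
  have f4: "continuous_on S (\<lambda>z. Re (k2 z))" "continuous_on S (\<lambda>z. - Im (k2 z))" "continuous_on S (\<lambda>z. - Re (k2 z))"
    using holomorphic_on_imp_continuous_on[OF hol(2)] by (auto intro!: continuous_intros)
  show ?thesis
    unfolding harmonic_plane_def
    by (rule exI[of _ "\<lambda>z. Re (k1 z)"],
      rule exI[of _ "\<lambda>z. - Im (k1 z)"],
      rule exI[of _ "\<lambda>z. Re (k2 z)"],
      rule exI[of _ "\<lambda>z. - Im (k2 z)"],
      rule exI[of _ "\<lambda>z. - Im (k2 z)"],
      rule exI[of _ "\<lambda>z. - Re (k2 z)"],
      intro conjI ballI) (erule f1 f2 f3 | rule f4 | simp)+
qed

lemma Re_gradient_unique:
  assumes "(u has_derivative (\<lambda>h. Re (a * h))) (at z)" "(u has_derivative (\<lambda>h. Re (b * h))) (at z)"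
  shows "a = b"
proof -
  have "(\<lambda>h. Re (a * h)) = (\<lambda>h. Re (b * h))" using assms by (rule has_derivative_unique)
  then have "Re (a * 1) = Re (b * 1)" "Re (a * \<i>) = Re (b * \<i>)" by metis+
  then show ?thesis by (simp add: complex_eq_iff)
qed

text \<open>Charts give only local gradients. A real differential determines its complex gradient,
  so the local ones agree and form one holomorphic \<open>D\<close>; convexity of \<open>A\<close>
  yields a global primitive.\<close>

lemma locally_harmonic_imp_Re_holomorphic:
  assumes "open A" "convex A"
    and loc: "\<And>z. z \<in> A \<Longrightarrow> \<exists>V g. open V \<and> z \<in> V \<and> g holomorphic_on V \<and>
        (\<forall>w\<in>V. (U has_derivative (\<lambda>h. Re (g w * h))) (at w))"
  obtains H where "H holomorphic_on A" "\<And>z. z \<in> A \<Longrightarrow> U z = Re (H z)"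
    "\<And>z. z \<in> A \<Longrightarrow> (U has_derivative (\<lambda>h. Re (deriv H z * h))) (at z)"
proof -
  define D where "D = (\<lambda>z. THE a. (U has_derivative (\<lambda>h. Re (a * h))) (at z))"
  have D_eq: "D z = a" if "(U has_derivative (\<lambda>h. Re (a * h))) (at z)" for z a
    unfolding D_def using that Re_gradient_unique by blast
  have holD: "D holomorphic_on A"
    unfolding holomorphic_on_def
  proof
    fix z assume "z \<in> A"
    from loc[OF this] obtain V g where V: "open V" "z \<in> V" "g holomorphic_on V"
        "\<And>w. w \<in> V \<Longrightarrow> (U has_derivative (\<lambda>h. Re (g w * h))) (at w)" by blast
    have "D holomorphic_on V" using V(3) by (rule holomorphic_transform) (use D_eq V(4) in metis)
    then have "D field_differentiable at z" using V holomorphic_on_imp_differentiable_at by blast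
    then show "D field_differentiable at z within A" by (rule field_differentiable_at_within)
  qed
  have DU: "(U has_derivative (\<lambda>h. Re (D z * h))) (at z)" if "z \<in> A" for z
    using loc[OF that] D_eq by metis
  have "\<exists>H. \<forall>z\<in>A. (H has_field_derivative D z) (at z within A)"
    by (rule holomorphic_convex_primitive'[OF assms(2,1) holD]) blast
  then obtain H0 where "\<And>z. z \<in> A \<Longrightarrow> (H0 has_field_derivative D z) (at z within A)" by blast
  then have H0: "(H0 has_field_derivative D z) (at z)" if "z \<in> A" for z
    using that at_within_open[OF that assms(1)] by metis
  have "\<exists>c. \<forall>z\<in>A. U z - Re (H0 z) = c"
  proof (rule has_derivative_zero_constant[OF assms(2)])
    fix z assume z: "z \<in> A"
    have "((\<lambda>z. U z - Re (H0 z)) has_derivative (\<lambda>h. Re (D z * h) - Re (D z * h))) (at z)"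
      by (intro has_derivative_diff DU has_derivative_Re_holomorphic H0 z)
    then show "((\<lambda>z. U z - Re (H0 z)) has_derivative (\<lambda>h. 0)) (at z within A)"
      by (simp add: has_derivative_at_withinI)
  qed
  then obtain c where c: "\<And>z. z \<in> A \<Longrightarrow> U z - Re (H0 z) = c" by blast
  have H: "((\<lambda>z. H0 z + of_real c) has_field_derivative D z) (at z)" if "z \<in> A" for z
    using H0[OF that] by (auto intro!: derivative_eq_intros)
  show ?thesis
  proof (rule that[of "\<lambda>z. H0 z + of_real c"])
    show "(\<lambda>z. H0 z + of_real c) holomorphic_on A"
      using H assms(1) by (auto simp: holomorphic_on_open)
    show "U z = Re (H0 z + of_real c)" if "z \<in> A" for z using c[OF that] by simp
    show "(U has_derivative (\<lambda>h. Re (deriv (\<lambda>z. H0 z + of_real c) z * h))) (at z)" if "z \<in> A" for z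
      using DU[OF that] DERIV_imp_deriv[OF H[OF that]] by simp
  qed
qed

section \<open>Charts of the sphere and the inverse of a conformal map\<close>

lemma open_Some_vimage: "openin sphere_top D \<Longrightarrow> open (Some -` D)"
  using continuous_map_Some[of "euclidean :: complex topology"]
  by (auto simp: continuous_map_def vimage_def)

lemma inj_sphere_inv: "inj sphere_inv"
  by (auto simp: inj_def sphere_inv_def split: if_splits)

lemma open_sphere_inv_vimage:
  assumes "openin sphere_top D"
  shows "open (sphere_inv -` D)"
proof -
  have "continuous_on (- {0}) (\<lambda>w::complex. 1 / w)" by (auto intro!: continuous_intros)
  then have "open (- {0} \<inter> (\<lambda>w. 1 / w) -` (Some -` D))"
    by (rule continuous_open_preimage) (auto intro: open_Some_vimage[OF assms])
  moreover have "- {0} \<inter> (\<lambda>w. 1 / w) -` (Some -` D) = {w \<in> - {0}. 1 / w \<in> Some -` D}" by auto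
  ultimately have 1: "open {w \<in> - {0}. 1 / w \<in> Some -` D}" by simp
  show ?thesis
  proof (cases "infty \<in> D")
    case False
    then have "sphere_inv -` D = {w \<in> - {0}. 1 / w \<in> Some -` D}" by (auto simp: sphere_inv_def split: if_splits)
    then show ?thesis using 1 by simp
  next
    case True
    then obtain C where C: "compact C" "D = insert None (Some ` (- C))"
      using assms unfolding openin_Alexandroff_compactification by (auto simp: Compl_eq_Diff_UNIV)
    then obtain R where R: "R > 0" "\<And>z. z \<in> C \<Longrightarrow> norm z \<le> R"
      using compact_imp_bounded bounded_pos by metis
    \<comment> \<open>Neighbourhoods of infinity are complements of compact sets, and under
      inversion they contain a disc about 0.\<close>
    have b: "ball 0 (1 / R) \<subseteq> sphere_inv -` D"
    proof
      fix w :: complex assume w: "w \<in> ball 0 (1 / R)"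
      show "w \<in> sphere_inv -` D"
      proof (cases "w = 0")
        case False
        then have "norm (1 / w) > R" using w R(1) by (simp add: norm_divide field_simps)
        then have "1 / w \<notin> C" using R(2) by force
        then show ?thesis using False C by (simp add: sphere_inv_def)
      qed (simp add: sphere_inv_def C)
    qed
    have "sphere_inv -` D = {w \<in> - {0}. 1 / w \<in> Some -` D} \<union> ball 0 (1 / R)"
      using b R by (auto simp: sphere_inv_def split: if_splits)
    then show ?thesis using 1 by auto
  qed
qed

lemma conformal_chart:
  assumes conf: "conformal_into_sphere f A D" and "open A" "\<zeta> \<in> A"
  obtains c g V where "c = Some \<or> c = sphere_inv" "open V" "\<zeta> \<in> V" "V \<subseteq> A" "g holomorphic_on V"
    "\<And>w. w \<in> V \<Longrightarrow> f w = c (g w)"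
proof -
  obtain g where g: "g analytic_on {\<zeta>}"
      "(\<forall>\<^sub>F w in nhds \<zeta>. f w = Some (g w)) \<or> (\<forall>\<^sub>F w in nhds \<zeta>. f w = sphere_inv (g w))"
    using conf \<open>\<zeta> \<in> A\<close> unfolding conformal_into_sphere_def holomorphic_into_sphere_def by blast
  then obtain c where c: "c = Some \<or> c = sphere_inv" "\<forall>\<^sub>F w in nhds \<zeta>. f w = c (g w)" by blast
  obtain V1 where V1: "open V1" "\<zeta> \<in> V1" "g holomorphic_on V1"
    using g(1) unfolding analytic_at by blast
  obtain V2 where V2: "open V2" "\<zeta> \<in> V2" "\<And>w. w \<in> V2 \<Longrightarrow> f w = c (g w)"
    using c(2) unfolding eventually_nhds by blast
  show ?thesis
    by (rule that[OF c(1), of "A \<inter> V1 \<inter> V2" g])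
      (use V1 V2 assms(2,3) in \<open>auto intro: holomorphic_on_subset\<close>)
qed

text \<open>The chart in which \<open>f\<close> is described near \<zeta> need not be the desired
  one. If it is the other one, the coordinate at \<zeta> is nonzero, since the coordinate 0 belongs
  to a point missed by the desired chart; inverting the coordinate then changes the chart.\<close>

lemma conformal_given_chart:
  assumes conf: "conformal_into_sphere f A D" and "open A" "\<zeta> \<in> A"
    and c: "c = Some \<or> c = sphere_inv" and f\<zeta>: "f \<zeta> = c w0"
  obtains g V where "open V" "\<zeta> \<in> V" "V \<subseteq> A" "g holomorphic_on V" "\<And>w. w \<in> V \<Longrightarrow> f w = c (g w)"
proof -
  obtain c' g V where V: "c' = Some \<or> c' = sphere_inv" "open V" "\<zeta> \<in> V" "V \<subseteq> A" "g holomorphic_on V"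
    "\<And>w. w \<in> V \<Longrightarrow> f w = c' (g w)"
    by (rule conformal_chart[OF conf assms(2,3)]) blast
  show ?thesis
  proof (cases "c' = c")
    case True
    then show ?thesis using that[of V g] V by blast
  next
    case False
    have gne: "g \<zeta> \<noteq> 0"
    proof
      assume "g \<zeta> = 0"
      then have "c' 0 = c w0" using V(6)[OF V(3)] f\<zeta> by simp
      then show False using False c V(1)
        by (auto simp: sphere_inv_def split: if_splits)
    qed
    have cont: "continuous_on V g" by (rule holomorphic_on_imp_continuous_on[OF V(5)])
    have "open {w \<in> V. g w \<noteq> 0}"
      using continuous_open_preimage[OF cont V(2) open_Compl[OF closed_singleton[of 0]]] by (simp add: vimage_def Int_def)
    moreover have "c (1 / g w) = f w" if "w \<in> V" "g w \<noteq> 0" for w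
      using V(1) c False V(6)[OF that(1)] that(2) by (auto simp: sphere_inv_def)
    ultimately show ?thesis
      by (intro that[of "{w \<in> V. g w \<noteq> 0}" "\<lambda>w. 1 / g w"])
        (use V gne in \<open>auto intro!: holomorphic_intros intro: holomorphic_on_subset\<close>)
  qed
qed

text \<open>Read in the chart \<open>c\<close>, \<open>f\<close> is holomorphic and injective, so
  local images are open and the local inverses holomorphic.\<close>

lemma inverse_conformal_holomorphic:
  assumes conf: "conformal_into_sphere f A D" and "open A" and D: "openin sphere_top D"
    and c: "c = Some \<or> c = sphere_inv"
  shows "(\<lambda>w. inv_into A f (c w)) holomorphic_on (c -` D)"
  unfolding holomorphic_on_def
proof
  fix w0 assume "w0 \<in> c -` D"
  then have w0: "c w0 \<in> D" by simp
  have bij: "bij_betw f A D" using conf by (simp add: conformal_into_sphere_def)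
  define \<zeta> where "\<zeta> = inv_into A f (c w0)"
  have \<zeta>: "\<zeta> \<in> A" "f \<zeta> = c w0"
    using bij w0 by (auto simp: \<zeta>_def bij_betw_def inv_into_into f_inv_into_f)
  have injc: "inj c" using c inj_sphere_inv by auto
  obtain g V where V: "open V" "\<zeta> \<in> V" "V \<subseteq> A" "g holomorphic_on V" "\<And>w. w \<in> V \<Longrightarrow> f w = c (g w)"
    by (rule conformal_given_chart[OF conf assms(2) \<zeta>(1) c \<zeta>(2)]) blast
  have injf: "inj_on f A" using bij by (simp add: bij_betw_def)
  have injg: "inj_on g V"
    by (rule inj_onI) (metis V(3,5) injf inj_on_def subsetD)
  obtain h where h: "h holomorphic_on (g ` V)" "\<And>z. z \<in> V \<Longrightarrow> h (g z) = z"
    using holomorphic_has_inverse[OF V(4,1) injg] by metis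
  have op: "open (g ` V)" by (rule open_mapping_thm3[OF V(4,1) injg])
  have eq: "h w = inv_into A f (c w)" if w: "w \<in> g ` V" for w
  proof -
    from w obtain z where z: "z \<in> V" "w = g z" by blast
    then have "c w = f z" using V(5) by simp
    then show ?thesis using z h(2) injf V(3) by (simp add: inv_into_f_f subsetD)
  qed
  have "w0 = g \<zeta>" using V(5)[OF V(2)] \<zeta>(2) injc by (simp add: inj_eq)
  then have "w0 \<in> g ` V" using V(2) by blast
  moreover have "(\<lambda>w. inv_into A f (c w)) holomorphic_on (g ` V)"
    using h(1) by (rule holomorphic_transform) (rule eq)
  ultimately show "(\<lambda>w. inv_into A f (c w)) field_differentiable at w0 within c -` D"
    using op holomorphic_on_imp_differentiable_at field_differentiable_at_within by metis
qed

lemma harmonic_sphere_Re_inverse_conformal: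
  assumes conf: "conformal_into_sphere f A D" and "open A" and D: "openin sphere_top D"
    and k: "k holomorphic_on A" and u: "\<And>w. w \<in> D \<Longrightarrow> u w = Re (k (inv_into A f w))"
  shows "harmonic_sphere u D"
proof -
  have bij: "bij_betw f A D" using conf by (simp add: conformal_into_sphere_def)
  have "harmonic_plane (\<lambda>z. u (c z)) (c -` D)" if c: "c = Some \<or> c = sphere_inv" for c
  proof (rule harmonic_plane_Re)
    have "(\<lambda>w. inv_into A f (c w)) ` (c -` D) \<subseteq> A"
      using bij by (auto simp: bij_betw_def intro: inv_into_into)
    then show "(\<lambda>z. k (inv_into A f (c z))) holomorphic_on c -` D"
      using holomorphic_on_compose_gen[OF inverse_conformal_holomorphic[OF conf assms(2) D c] k] by (simp add: o_def)
    show "open (c -` D)" using c open_Some_vimage[OF D] open_sphere_inv_vimage[OF D] by auto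
  qed (use u in auto)
  then show ?thesis unfolding harmonic_sphere_def by blast
qed

text \<open>The gradient of the composition is formed in whichever chart fits, so that points where
  \<open>f\<close> is infinite are covered as well.\<close>

lemma harmonic_sphere_compose_conformal:
  assumes conf: "conformal_into_sphere f A D" and A: "open A" "convex A" and D: "openin sphere_top D"
    and u: "harmonic_sphere u D"
  obtains H where "H holomorphic_on A" "\<And>z. z \<in> A \<Longrightarrow> u (f z) = Re (H z)"
    "\<And>z. z \<in> A \<Longrightarrow> ((\<lambda>z. u (f z)) has_derivative (\<lambda>h. Re (deriv H z * h))) (at z)"
proof (rule locally_harmonic_imp_Re_holomorphic[OF A, of "\<lambda>z. u (f z)"])
  fix z assume z: "z \<in> A"
  have bij: "bij_betw f A D" using conf by (simp add: conformal_into_sphere_def)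
  obtain c g V where V: "c = Some \<or> c = sphere_inv" "open V" "z \<in> V" "V \<subseteq> A" "g holomorphic_on V"
    "\<And>w. w \<in> V \<Longrightarrow> f w = c (g w)"
    by (rule conformal_chart[OF conf A(1) z]) blast
  have harm: "harmonic_plane (\<lambda>z. u (c z)) (c -` D)" using u V(1) unfolding harmonic_sphere_def by auto
  have op: "open (c -` D)" using V(1) open_Some_vimage[OF D] open_sphere_inv_vimage[OF D] by auto
  obtain G where G: "G holomorphic_on c -` D"
    "\<And>z. z \<in> c -` D \<Longrightarrow> ((\<lambda>z. u (c z)) has_derivative (\<lambda>h. Re (G z * h))) (at z)"
    by (rule harmonic_plane_gradient[OF harm op]) blast
  have gD: "g ` V \<subseteq> c -` D"
    using V(4,6) bij by (auto simp: bij_betw_def) (metis imageI subsetD)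
  have "(\<lambda>w. G (g w) * deriv g w) holomorphic_on V"
    using holomorphic_on_compose_gen[OF V(5) G(1) gD] holomorphic_deriv[OF V(5,2)]
    by (auto simp: o_def intro!: holomorphic_on_mult)
  moreover have "((\<lambda>z. u (f z)) has_derivative (\<lambda>h. Re (G (g w) * deriv g w * h))) (at w)" if w: "w \<in> V" for w
  proof -
    have "(g has_derivative (*) (deriv g w)) (at w)"
      using holomorphic_derivI[OF V(5,2) w] unfolding has_field_derivative_def .
    from has_derivative_compose[OF this G(2)] gD w
    have "((\<lambda>z. u (c (g z))) has_derivative (\<lambda>h. Re (G (g w) * (deriv g w * h)))) (at w)" by blast
    then have "((\<lambda>z. u (f z)) has_derivative (\<lambda>h. Re (G (g w) * (deriv g w * h)))) (at w)"
      by (rule has_derivative_transform_within_open[OF _ V(2) w]) (simp add: V(6))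
    then show ?thesis by (simp only: mult.assoc)
  qed
  ultimately show "\<exists>V g. open V \<and> z \<in> V \<and> g holomorphic_on V \<and>
      (\<forall>w\<in>V. ((\<lambda>z. u (f z)) has_derivative (\<lambda>h. Re (g w * h))) (at w))"
    using V(2,3) by blast
qed (use that in blast)

text \<open>In the chart at infinity \<open>f\<close> has a zero at \<open>z0\<close>, isolated
  because \<open>f\<close> is finite elsewhere. This will keep preimages of bounded sets away from
  \<open>z0\<close>.\<close>

lemma conformal_pole:
  assumes conf: "conformal_into_sphere f A D" and A: "open A" and z0: "z0 \<in> A" "f z0 = infty"
    and F: "\<And>z. z \<in> A - {z0} \<Longrightarrow> f z = Some (F z)"
  shows "filterlim F at_infinity (at z0)"
proof -
  have "f z0 = sphere_inv 0" using z0 by (simp add: sphere_inv_def)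
  then obtain g V where V: "open V" "z0 \<in> V" "V \<subseteq> A" "g holomorphic_on V" "\<And>w. w \<in> V \<Longrightarrow> f w = sphere_inv (g w)"
    by (rule conformal_given_chart[OF conf A z0(1) disjI2[OF refl]]) blast
  have g0: "g z0 = 0" using V(5)[OF V(2)] z0(2) by (auto simp: sphere_inv_def split: if_splits)
  have eq: "g w \<noteq> 0 \<and> F w = inverse (g w)" if w: "w \<in> V" "w \<noteq> z0" for w
    using V(5)[OF w(1)] F[of w] w V(3) by (auto simp: sphere_inv_def inverse_eq_divide split: if_splits)
  have ev: "\<forall>\<^sub>F w in at z0. w \<in> V \<and> w \<noteq> z0"
    using V(1,2) by (auto simp: eventually_at_topological)
  have "filterlim g (at 0) (at z0)"
    unfolding filterlim_at
  proof
    have "isCont g z0"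
      using V holomorphic_on_imp_continuous_on continuous_on_eq_continuous_at by blast
    then show "(g \<longlongrightarrow> 0) (at z0)" using g0 by (simp add: isCont_def)
    show "\<forall>\<^sub>F w in at z0. g w \<in> UNIV \<and> g w \<noteq> 0" using ev by eventually_elim (use eq in auto)
  qed
  then have "filterlim (\<lambda>w. inverse (g w)) at_infinity (at z0)"
    by (rule filterlim_compose[OF filterlim_inverse_at_infinity])
  then show ?thesis
    by (rule filterlim_mono_eventually[OF _ order.refl order.refl])
      (use ev in \<open>eventually_elim, use eq in auto\<close>)
qed

lemma harmonic_sphere_tendsto_infty:
  assumes "harmonic_sphere u D" "openin sphere_top D" "infty \<in> D"
  shows "((\<lambda>z. u (Some z)) \<longlongrightarrow> u infty) at_infinity"
proof -
  have "harmonic_plane (\<lambda>w. u (sphere_inv w)) (sphere_inv -` D)" using assms by (simp add: harmonic_sphere_def)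
  then obtain g where g: "\<And>z. z \<in> sphere_inv -` D \<Longrightarrow> ((\<lambda>w. u (sphere_inv w)) has_derivative (\<lambda>h. Re (g z * h))) (at z)"
    by (rule harmonic_plane_gradient[OF _ open_sphere_inv_vimage[OF assms(2)]]) blast
  have "0 \<in> sphere_inv -` D" using assms(3) by (simp add: sphere_inv_def)
  then have "isCont (\<lambda>w. u (sphere_inv w)) 0" using g has_derivative_continuous by blast
  then have "((\<lambda>w. u (sphere_inv w)) \<longlongrightarrow> u infty) (at 0)" by (simp add: isCont_def sphere_inv_def)
  then have "((\<lambda>z. u (Some (inverse z))) \<longlongrightarrow> u infty) (at 0)"
    by (rule Lim_transform_eventually) (auto simp: eventually_at_filter sphere_inv_def inverse_eq_divide)
  then show ?thesis unfolding at_to_infinity filterlim_filtermap by simp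
qed

section \<open>The Schwarz--Christoffel integral up to the boundary\<close>

text \<open>The factor -i rotates the closed upper half plane onto the closed right half plane,
  which meets the cut of the power only in 0; this exhibits the continuity up to the real
  axis.\<close>

lemma powr_closed_upper_half_plane:
  fixes z :: complex and a :: real
  assumes "0 \<le> Im z"
  shows "z powr of_real a = (- \<i> * z) powr of_real a * exp (\<i> * of_real (a * pi / 2))"
proof (cases "z = 0")
  case False
  have "Ln (\<i> * (- \<i> * z)) = Ln (- \<i> * z) + \<i> * of_real pi / 2"
    using False assms Ln_times_ii[of "- \<i> * z"] by simp
  then have "Ln z = Ln (- \<i> * z) + \<i> * of_real pi / 2" by simp
  then show ?thesis using False by (simp add: powr_def exp_add[symmetric] algebra_simps)
qed simp

lemma continuous_on_powr_closed_upper_half_plane: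
  fixes a :: real
  assumes "a > 0"
  shows "continuous_on {z. 0 \<le> Im z} (\<lambda>z. z powr of_real a)"
proof -
  have "continuous_on {z. 0 \<le> Im z} (\<lambda>z. (- \<i> * z) powr of_real a * exp (\<i> * of_real (a * pi / 2)))"
    using assms by (intro continuous_intros continuous_on_powr_complex) auto
  then show ?thesis
    by (rule continuous_on_eq) (use powr_closed_upper_half_plane in simp)
qed

lemma powr_of_real_cis:
  fixes x a :: real
  shows "(of_real x :: complex) powr of_real a = of_real (\<bar>x\<bar> powr a) * (if x < 0 then cis (pi * a) else 1)"
proof (cases "x = 0")
  case False
  show ?thesis
  proof (cases "x < 0")
    case True
    have "Ln (of_real x) = of_real (ln (- x)) + \<i> * of_real pi"
      using Ln_minus[of "of_real (- x)"] Ln_of_real[of "- x"] True by simp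
    then show ?thesis using True
      by (simp add: powr_def exp_add[symmetric] cis_conv_exp exp_of_real[symmetric] algebra_simps)
  next
    case False
    then show ?thesis using \<open>x \<noteq> 0\<close> by (simp add: powr_of_real)
  qed
qed simp

text \<open>Positivity of \<open>m\<close> is asked only inside the interval: the integrand vanishes
  at 0, 1, t, which will be end points.\<close>

lemma straight_image_step:
  fixes \<phi> :: "real \<Rightarrow> complex"
  assumes "a < b" "continuous_on {a..b} \<phi>" "d \<noteq> 0"
    and der: "\<And>x. a < x \<Longrightarrow> x < b \<Longrightarrow> (\<phi> has_vector_derivative of_real (m x) * d) (at x) \<and> m x > 0"
  obtains s where "s > 0" "\<phi> b = \<phi> a + of_real s * d"
proof -
  let ?q = "\<lambda>x. \<phi> x / d"
  have dq: "(?q has_vector_derivative of_real (m x)) (at x)" if "a < x" "x < b" for x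
  proof -
    have "((\<lambda>x. \<phi> x / d) has_vector_derivative (of_real (m x) * d) / d) (at x)"
      using bounded_linear.has_vector_derivative[OF bounded_linear_divide[of d]] der[OF that] by blast
    then show ?thesis using assms(3) by simp
  qed
  have cont: "continuous_on {a..b} ?q" using assms(2,3) by (intro continuous_intros) auto
  have "Re (?q a) < Re (?q b)"
  proof (rule DERIV_pos_imp_increasing_open[OF assms(1), where f = "\<lambda>x. Re (?q x)"])
    fix x assume x: "a < x" "x < b"
    have "((\<lambda>x. Re (?q x)) has_real_derivative m x) (at x)"
      using bounded_linear.has_vector_derivative[OF bounded_linear_Re dq[OF x]]
      unfolding has_real_derivative_iff_has_vector_derivative by simp
    then show "\<exists>y. ((\<lambda>x. Re (?q x)) has_real_derivative y) (at x) \<and> 0 < y" using der[OF x] by blast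
  qed (intro continuous_intros cont)
  moreover have "Im (?q b) = Im (?q a)"
  proof (rule DERIV_isconst_end[OF assms(1), where f = "\<lambda>x. Im (?q x)"])
    show "((\<lambda>x. Im (?q x)) has_real_derivative 0) (at x)" if "a < x" "x < b" for x
      using bounded_linear.has_vector_derivative[OF bounded_linear_Im dq[OF that]]
      unfolding has_real_derivative_iff_has_vector_derivative by simp
  qed (intro continuous_intros cont)
  ultimately have s: "Re (?q b) - Re (?q a) > 0" "?q b = ?q a + of_real (Re (?q b) - Re (?q a))"
    by (auto simp: complex_eq_iff)
  have "\<phi> b = (?q a + of_real (Re (?q b) - Re (?q a))) * d"
    using s(2) assms(3) by (metis nonzero_eq_divide_eq)
  then have "\<phi> b = \<phi> a + of_real (Re (?q b) - Re (?q a)) * d" using assms(3) by (simp add: distrib_right)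
  then show ?thesis using that s(1) by blast
qed

lemma joinpaths_image_half_open:
  assumes "p ` {0<..1} \<subseteq> S" "path_image q \<subseteq> S"
  shows "(p +++ q) ` {0<..1} \<subseteq> S"
proof
  fix y assume "y \<in> (p +++ q) ` {0<..1}"
  then obtain x where x: "0 < x" "x \<le> 1" "y = (p +++ q) x" by auto
  show "y \<in> S"
  proof (cases "x \<le> 1/2")
    case True
    then have "y = p (2 * x)" "2 * x \<in> {0<..1}" using x by (auto simp: joinpaths_def)
    then show ?thesis using assms(1) by blast
  next
    case False
    then have "y = q (2 * x - 1)" "2 * x - 1 \<in> {0..1}" using x by (auto simp: joinpaths_def)
    then show ?thesis using assms(2) unfolding path_image_def by blast
  qed
qed

section \<open>The Schwarz-Christoffel map in the closed half plane\<close>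

locale sc_map =
  fixes \<alpha> \<beta> \<gamma> t :: real and z0 C z1 :: complex and f :: "complex \<Rightarrow> complex option"
  assumes exps: "0 < \<alpha>" "0 < \<beta>" "0 < \<gamma>" "\<alpha> + \<beta> + \<gamma> < 2" and t: "1 < t" and z0: "0 < Im z0"
    and formula: "\<And>z p. \<lbrakk>z \<in> upper_half_plane; z \<noteq> z0; valid_path p; pathstart p = 0; pathfinish p = z;
             p ` {0<..1} \<subseteq> upper_half_plane - {z0}\<rbrakk>
           \<Longrightarrow> f z = Some (C * contour_integral p (sc_integrand \<alpha> \<beta> \<gamma> t z0) + z1)"
begin

abbreviation "g \<equiv> sc_integrand \<alpha> \<beta> \<gamma> t z0"

lemma ne_cnj: "0 \<le> Im z \<Longrightarrow> z \<noteq> cnj z0"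
  using z0 by auto

lemma g_cont: "continuous_on ({z. 0 \<le> Im z} - {z0}) g"
proof -
  have p: "continuous_on ({z. 0 \<le> Im z} - {z0}) (\<lambda>z. (z - of_real c) powr of_real a)" if "a > 0" for a c :: real
    by (rule continuous_on_compose2[OF continuous_on_powr_closed_upper_half_plane[OF that]])
      (auto intro!: continuous_intros)
  have "continuous_on ({z. 0 \<le> Im z} - {z0}) (\<lambda>\<zeta>. (\<zeta> - of_real 0) powr of_real \<alpha> * (\<zeta> - of_real 1) powr of_real \<beta>
      * (\<zeta> - of_real t) powr of_real \<gamma> / ((\<zeta> - z0)^2 * (\<zeta> - cnj z0)^2))"
    using ne_cnj by (intro continuous_on_mult continuous_on_divide p exps) (auto intro!: continuous_intros)
  then show ?thesis by (simp add: sc_integrand_def[abs_def])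
qed

lemma g_holomorphic: "g holomorphic_on (upper_half_plane - {z0})"
proof -
  have "Im (\<zeta> - of_real c) \<noteq> 0" if "Im \<zeta> > 0" for \<zeta> c using that by simp
  then have *: "\<zeta> - of_real c \<notin> \<real>\<^sub>\<le>\<^sub>0" if "Im \<zeta> > 0" for \<zeta> and c :: real
    using that by (auto simp: complex_nonpos_Reals_iff)
  have p: "(\<lambda>z. (z - of_real c) powr of_real a) holomorphic_on (upper_half_plane - {z0})" for a c :: real
    by (intro holomorphic_intros) (use * in auto)
  have "(\<lambda>\<zeta>. (\<zeta> - of_real 0) powr of_real \<alpha> * (\<zeta> - of_real 1) powr of_real \<beta>
      * (\<zeta> - of_real t) powr of_real \<gamma> / ((\<zeta> - z0)^2 * (\<zeta> - cnj z0)^2)) holomorphic_on (upper_half_plane - {z0})"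
    using ne_cnj by (intro holomorphic_on_mult holomorphic_on_divide p) (auto intro!: holomorphic_intros)
  then show ?thesis by (simp add: sc_integrand_def[abs_def])
qed

lemma g_nonzero: "0 < Im z \<Longrightarrow> z \<noteq> z0 \<Longrightarrow> g z \<noteq> 0"
proof -
  assume z: "0 < Im z" "z \<noteq> z0"
  have "z - of_real c \<noteq> 0" for c using z by auto
  from this[of 0] this[of 1] this[of t] show ?thesis
    using z ne_cnj[of z] by (simp add: sc_integrand_def powr_eq_0_iff)
qed

lemma g_integrable: "closed_segment a b \<subseteq> {z. 0 \<le> Im z} - {z0} \<Longrightarrow> g contour_integrable_on linepath a b"
  by (intro contour_integrable_continuous_linepath continuous_on_subset[OF g_cont])

definition F :: "complex \<Rightarrow> complex" where "F z = the (f z)"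

text \<open>A contour integral has a meaningful value only if the integrand is integrable, so
  integrability is supplied along with the path. The straight segment serves unless it passes
  through \<open>z0\<close>.\<close>

lemma path_to:
  assumes w: "0 < Im w" "w \<noteq> z0"
  obtains p where "valid_path p" "pathstart p = 0" "pathfinish p = w"
    "p ` {0<..1} \<subseteq> upper_half_plane - {z0}" "g contour_integrable_on p"
proof -
  have lin: "linepath 0 v ` {0<..1} \<subseteq> upper_half_plane - {z0}" if "0 < Im v" "z0 \<notin> closed_segment 0 v" for v
  proof
    fix y assume "y \<in> linepath 0 v ` {0<..1}"
    then obtain x where x: "0 < x" "x \<le> 1" "y = of_real x * v" by (auto simp: linepath_def scaleR_conv_of_real)
    moreover have "y \<in> closed_segment 0 v"
      using x by (auto simp: closed_segment_def scaleR_conv_of_real intro!: exI[of _ x])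
    ultimately show "y \<in> upper_half_plane - {z0}" using that by auto
  qed
  have int: "g contour_integrable_on linepath 0 v" if "0 < Im v" "z0 \<notin> closed_segment 0 v" for v
  proof (rule g_integrable)
    have "closed_segment 0 v \<subseteq> {z. 0 \<le> Im z}"
      by (rule closed_segment_subset) (use that in \<open>auto simp: convex_halfspace_Im_ge\<close>)
    then show "closed_segment 0 v \<subseteq> {z. 0 \<le> Im z} - {z0}" using that by auto
  qed
  show ?thesis
  proof (cases "z0 \<in> closed_segment 0 w")
    case False
    then show ?thesis using that[of "linepath 0 w"] lin[OF w(1)] int[OF w(1)] by simp
  next
    case True
    then obtain x where x: "0 \<le> x" "x \<le> 1" "z0 = of_real x * w"
      by (auto simp: closed_segment_def scaleR_conv_of_real)
    have "x \<noteq> 1" using x w by auto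
    then have x1: "x < 1" using x by simp
    \<comment> \<open>A detour through a point at the height of \<open>z0\<close>: the first leg
      reaches this height only at its end, and the second, which rises, only at its start.\<close>
    define v where "v = z0 + 1"
    have v: "0 < Im v" using z0 by (simp add: v_def)
    have n1: "z0 \<notin> closed_segment 0 v"
    proof
      assume "z0 \<in> closed_segment 0 v"
      then obtain y where y: "z0 = of_real y * v" by (auto simp: closed_segment_def scaleR_conv_of_real)
      have "Im z0 = y * Im z0" using arg_cong[OF y, of Im] by (simp add: v_def)
      then have "y = 1" using z0 by simp
      then show False using y by (simp add: v_def)
    qed
    have n2: "z0 \<notin> closed_segment v w"
    proof
      assume "z0 \<in> closed_segment v w"
      then obtain y where y: "0 \<le> y" "y \<le> 1" "z0 = (1 - of_real y) * v + of_real y * w"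
        by (auto simp: closed_segment_def scaleR_conv_of_real)
      have i: "Im z0 = (1 - y) * Im z0 + y * Im w" using arg_cong[OF y(3), of Im] by (simp add: v_def algebra_simps)
      have "Im z0 = x * Im w" using arg_cong[OF x(3), of Im] by simp
      then have "Im z0 < Im w" using x1 w(1) by simp
      then have "y = 0" using i by (simp add: algebra_simps)
      then show False using y(3) by (simp add: v_def)
    qed
    have seg: "closed_segment v w \<subseteq> upper_half_plane - {z0}"
      using closed_segment_subset[of v upper_half_plane w] v w n2 by auto
    show ?thesis
    proof (rule that[of "linepath 0 v +++ linepath v w"])
      show "(linepath 0 v +++ linepath v w) ` {0<..1} \<subseteq> upper_half_plane - {z0}"
        using joinpaths_image_half_open[OF lin[OF v n1], of "linepath v w"] seg
        by (simp only: path_image_linepath)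
      have "g contour_integrable_on linepath v w"
        by (rule g_integrable) (use seg in \<open>auto intro: less_imp_le\<close>)
      then show "g contour_integrable_on (linepath 0 v +++ linepath v w)"
        using int[OF v n1] by (intro contour_integrable_joinI) auto
    qed auto
  qed
qed

lemma f_eq_F: "0 < Im w \<Longrightarrow> w \<noteq> z0 \<Longrightarrow> f w = Some (F w)"
  by (rule path_to[of w]) (use formula[of w] in \<open>auto simp: F_def\<close>)

lemma F_formula:
  assumes "0 < Im w" "w \<noteq> z0" "closed_segment 0 w \<subseteq> {z. 0 \<le> Im z} - {z0}"
  shows "F w = C * contour_integral (linepath 0 w) g + z1"
proof -
  have "linepath 0 w ` {0<..1} \<subseteq> upper_half_plane - {z0}"
  proof
    fix y assume "y \<in> linepath 0 w ` {0<..1}"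
    then obtain x where x: "0 < x" "x \<le> 1" "y = of_real x * w" by (auto simp: linepath_def scaleR_conv_of_real)
    moreover have "y \<in> closed_segment 0 w"
      using x by (auto simp: closed_segment_def scaleR_conv_of_real intro!: exI[of _ x])
    ultimately show "y \<in> upper_half_plane - {z0}" using assms by auto
  qed
  then show ?thesis using formula[of w "linepath 0 w"] assms by (simp add: F_def)
qed

text \<open>The formula holds for every admissible path, so path independence is built in: a path to
  \<open>w\<close> is prolonged by a segment.\<close>

lemma F_increment:
  assumes seg: "closed_segment w v \<subseteq> upper_half_plane - {z0}"
  shows "F v = F w + C * contour_integral (linepath w v) g"
proof -
  have w: "0 < Im w" "w \<noteq> z0" and v: "0 < Im v" "v \<noteq> z0" using seg by auto
  obtain p where p: "valid_path p" "pathstart p = 0" "pathfinish p = w"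
    "p ` {0<..1} \<subseteq> upper_half_plane - {z0}" "g contour_integrable_on p"
    by (rule path_to[OF w]) blast
  have int: "g contour_integrable_on linepath w v"
    by (rule g_integrable) (use seg in \<open>auto intro: less_imp_le\<close>)
  have "(p +++ linepath w v) ` {0<..1} \<subseteq> upper_half_plane - {z0}"
    by (rule joinpaths_image_half_open[OF p(4)]) (use seg in simp)
  then have "f v = Some (C * contour_integral (p +++ linepath w v) g + z1)"
    using p v by (intro formula) auto
  moreover have "f w = Some (C * contour_integral p g + z1)" using p w by (intro formula) auto
  ultimately show ?thesis
    using contour_integral_join[OF p(5) int p(1)] by (simp add: F_def algebra_simps)
qed

lemma F_deriv:
  assumes w: "0 < Im w" "w \<noteq> z0"
  shows "(F has_field_derivative C * g w) (at w)"
proof -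
  have "open (upper_half_plane - {z0})" by auto
  then obtain e where e: "e > 0" "ball w e \<subseteq> upper_half_plane - {z0}"
    using w open_contains_ball by (metis DiffI mem_upper_half_plane singletonD)
  have "\<exists>G. \<forall>z\<in>ball w e. (G has_field_derivative g z) (at z within ball w e)"
    by (rule holomorphic_convex_primitive'[OF convex_ball open_ball holomorphic_on_subset[OF g_holomorphic e(2)]]) blast
  then obtain G where G: "\<And>z. z \<in> ball w e \<Longrightarrow> (G has_field_derivative g z) (at z within ball w e)" by blast
  have eq: "F w + C * (G v - G w) = F v" if v: "v \<in> ball w e" for v
  proof -
    have seg: "closed_segment w v \<subseteq> ball w e" by (rule closed_segment_subset) (use v e in auto)
    have "(g has_contour_integral (G (pathfinish (linepath w v)) - G (pathstart (linepath w v)))) (linepath w v)"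
      by (rule contour_integral_primitive[OF G]) (use seg in auto)
    then have "contour_integral (linepath w v) g = G v - G w"
      using contour_integral_unique by fastforce
    then show ?thesis using F_increment[of w v] seg e(2) by auto
  qed
  have "(G has_field_derivative g w) (at w)" using G[of w] e(1) by (simp add: at_within_open[of w "ball w e"])
  then have "((\<lambda>v. F w + C * (G v - G w)) has_field_derivative C * g w) (at w)"
    by (auto intro!: derivative_eq_intros)
  then show ?thesis
    by (rule has_field_derivative_transform_within_open[OF _ open_ball, of _ _ _ w e]) (use e eq in auto)
qed


text \<open>The strip is convex, contains the real axis and stays below the pole, so a primitive
  exists on it up to the axis. It is determined up to a constant, and only differences are
  used.\<close>

definition G0 :: "complex \<Rightarrow> complex" where
  "G0 = (SOME G. \<forall>z\<in>{z. 0 \<le> Im z \<and> Im z < Im z0}. (G has_field_derivative g z) (at z within {z. 0 \<le> Im z \<and> Im z < Im z0}))"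

text \<open>The continuous extension of \<open>f\<close> to the real axis; its value at the pole \<open>z0\<close> is meaningless.\<close>

definition fb :: "complex \<Rightarrow> complex" where
  "fb z = (if 0 < Im z then F z else C * (G0 z - G0 0) + z1)"

abbreviation "strip \<equiv> {z. 0 \<le> Im z \<and> Im z < Im z0}"

lemma convex_strip: "convex strip"
proof -
  have "strip = {z. 0 \<le> Im z} \<inter> {z. Im z < Im z0}" by auto
  then show ?thesis by (simp add: convex_Int convex_halfspace_Im_ge convex_halfspace_Im_lt)
qed

lemma G0_deriv: "z \<in> strip \<Longrightarrow> (G0 has_field_derivative g z) (at z within strip)"
proof -
  have cont: "continuous_on strip g" by (rule continuous_on_subset[OF g_cont]) auto
  have "\<exists>G. \<forall>z\<in>strip. (G has_field_derivative g z) (at z within strip)"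
  proof (rule holomorphic_convex_primitive[OF convex_strip finite.emptyI cont])
    fix z assume z: "z \<in> interior strip - {}"
    \<comment> \<open>On the real axis only continuity of \<open>g\<close> is known; the existence
      theorem asks for differentiability just at interior points of the strip.\<close>
    have "Im z \<noteq> 0"
    proof
      assume "Im z = 0"
      obtain e where e: "e > 0" "ball z e \<subseteq> strip" using z by (metis Diff_empty mem_interior)
      have "z - \<i> * of_real (e/2) \<in> ball z e" using e by (simp add: dist_norm norm_mult)
      then have "z - \<i> * of_real (e/2) \<in> strip" using e by blast
      then show False using e(1) \<open>Im z = 0\<close> by simp
    qed
    moreover have "z \<in> strip" using z interior_subset by blast
    ultimately have "z \<in> upper_half_plane - {z0}" by auto
    then show "g field_differentiable at z"
      using g_holomorphic by (rule holomorphic_on_imp_differentiable_at[rotated 2]) auto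
  qed blast
  then have "\<forall>z\<in>strip. (G0 has_field_derivative g z) (at z within strip)"
    unfolding G0_def by (rule someI_ex)
  then show "z \<in> strip \<Longrightarrow> ?thesis" by blast
qed

text \<open>Below the height of \<open>z0\<close> the segment from 0 avoids the pole, so the path
  formula and the primitive agree.\<close>

lemma fb_strip: "z \<in> strip \<Longrightarrow> fb z = C * (G0 z - G0 0) + z1"
proof -
  assume z: "z \<in> strip"
  show ?thesis
  proof (cases "0 < Im z")
    case True
    have seg: "closed_segment 0 z \<subseteq> strip"
      by (rule closed_segment_subset[OF _ z convex_strip]) (use z0 in auto)
    have "(g has_contour_integral (G0 (pathfinish (linepath 0 z)) - G0 (pathstart (linepath 0 z)))) (linepath 0 z)"
      by (rule contour_integral_primitive[OF G0_deriv]) (use seg in auto)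
    then have "contour_integral (linepath 0 z) g = G0 z - G0 0"
      using contour_integral_unique by fastforce
    moreover have "F z = C * contour_integral (linepath 0 z) g + z1"
      by (rule F_formula) (use z True seg in auto)
    ultimately show ?thesis using True by (simp add: fb_def)
  qed (simp add: fb_def)
qed

lemma fb_upper: "0 < Im z \<Longrightarrow> z \<noteq> z0 \<Longrightarrow> f z = Some (fb z)"
  using f_eq_F by (simp add: fb_def)

lemma fb_deriv_strip: "z \<in> strip \<Longrightarrow> (fb has_field_derivative C * g z) (at z within strip)"
proof -
  assume z: "z \<in> strip"
  have "((\<lambda>z. C * (G0 z - G0 0) + z1) has_field_derivative C * g z) (at z within strip)"
    using G0_deriv[OF z] by (auto intro!: derivative_eq_intros)
  then show ?thesis
    by (rule has_field_derivative_transform_within[OF _ zero_less_one z]) (use fb_strip in simp)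
qed

lemma fb_deriv: "0 < Im z \<Longrightarrow> z \<noteq> z0 \<Longrightarrow> (fb has_field_derivative C * g z) (at z)"
  by (rule has_field_derivative_transform_within_open[OF F_deriv open_upper_half_plane])
    (auto simp: fb_def)

lemma fb_deriv_real: "((\<lambda>x. fb (of_real x)) has_vector_derivative C * g (of_real x)) (at x)"
proof -
  have "(fb has_field_derivative C * g (of_real x)) (at (of_real x) within of_real ` UNIV)"
    by (rule has_field_derivative_subset[OF fb_deriv_strip]) (use z0 in auto)
  moreover have "((\<lambda>x. of_real x :: complex) has_vector_derivative 1) (at x)"
    by (auto intro!: derivative_eq_intros)
  ultimately show ?thesis
    using field_vector_diff_chain_within[of "of_real :: real \<Rightarrow> complex" 1 x UNIV fb "C * g (of_real x)"]
    by (simp add: o_def)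
qed

lemma fb_cont: "continuous_on ({z. 0 \<le> Im z} - {z0}) fb"
  unfolding continuous_on_eq_continuous_within
proof
  fix z assume z: "z \<in> {z. 0 \<le> Im z} - {z0}"
  show "continuous (at z within {z. 0 \<le> Im z} - {z0}) fb"
  proof (cases "0 < Im z")
    case True
    then show ?thesis using fb_deriv[of z] z by (auto intro: continuous_at_imp_continuous_at_within DERIV_isCont)
  next
    case False
    then have zs: "z \<in> strip" using z z0 by auto
    have "continuous (at z within strip) fb" using fb_deriv_strip[OF zs] by (rule DERIV_continuous)
    moreover have "at z within strip = at z within {z. 0 \<le> Im z} - {z0}"
      by (rule at_within_nhd[of z "{z. Im z < Im z0}"]) (use zs in \<open>auto simp: open_halfspace_Im_lt\<close>)
    ultimately show ?thesis by simp
  qed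
qed

lemma fb_0: "fb 0 = z1"
  by (simp add: fb_def)

lemma contour_integral_01: "contour_integral (linepath 0 1) g = G0 1 - G0 0"
proof -
  have seg: "closed_segment 0 1 \<subseteq> strip"
    by (rule closed_segment_subset[OF _ _ convex_strip]) (use z0 in auto)
  have "(g has_contour_integral (G0 (pathfinish (linepath 0 1)) - G0 (pathstart (linepath 0 1)))) (linepath 0 1)"
    by (rule contour_integral_primitive[OF G0_deriv]) (use seg in auto)
  then show ?thesis using contour_integral_unique by fastforce
qed

lemma fb_1: "fb 1 = C * contour_integral (linepath 0 1) g + z1"
  by (simp add: contour_integral_01 fb_def)

lemma G0_deriv_real: "((\<lambda>x. G0 (of_real x)) has_vector_derivative g (of_real x)) (at x)"
proof -
  have "(G0 has_field_derivative g (of_real x)) (at (of_real x) within of_real ` UNIV)"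
    by (rule has_field_derivative_subset[OF G0_deriv]) (use z0 in auto)
  moreover have "((\<lambda>x. of_real x :: complex) has_vector_derivative 1) (at x)"
    by (auto intro!: derivative_eq_intros)
  ultimately show ?thesis
    using field_vector_diff_chain_within[of "of_real :: real \<Rightarrow> complex" 1 x UNIV G0 "g (of_real x)"]
    by (simp add: o_def)
qed

text \<open>The behaviour at infinity is read off after the substitution \<open>z = - 1 / w\<close>.\<close>

definition g1 :: "complex \<Rightarrow> complex" where
  "g1 w = (if w = 0 then 0 else g (- 1 / w) / w\<^sup>2)"

text \<open>The radius makes |-1/w| exceed |z0|, which keeps the pole out.\<close>

abbreviation "halfdisc \<equiv> ball 0 (1 / (1 + norm z0)) \<inter> {w. 0 \<le> Im w}"

lemma minus_inverse_halfdisc: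
  assumes "w \<in> halfdisc" "w \<noteq> 0"
  shows "- 1 / w \<in> {z. 0 \<le> Im z} - {z0}" "0 < Im w \<Longrightarrow> 0 < Im (- 1 / w)"
proof -
  have im: "Im (- 1 / w) = Im w / (norm w)\<^sup>2"
    by (simp add: Im_divide cmod_power2)
  have "norm w * (1 + norm z0) < 1" using assms(1) by (simp add: field_simps add_pos_nonneg)
  then have "norm w * norm z0 < 1" by (simp add: algebra_simps) (use norm_ge_zero[of w] in linarith)
  then have "- 1 / w \<noteq> z0" using assms(2) by (auto simp: norm_divide)
  moreover have "0 \<le> Im (- 1 / w)" unfolding im using assms by simp
  ultimately show "- 1 / w \<in> {z. 0 \<le> Im z} - {z0}" by blast
  show "0 < Im w \<Longrightarrow> 0 < Im (- 1 / w)" unfolding im using assms(2) by simp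
qed

text \<open>The powers of 2 stem from the bound 2 |\<zeta>| for |\<zeta> - 1| and |\<zeta> - t|, the
  factor 16 from a denominator of at least (|\<zeta>| / 2)^4.\<close>

lemma g_decay:
  assumes "2 * (1 + t + norm z0) \<le> norm \<zeta>"
  shows "norm (g \<zeta>) \<le> 16 * 2 powr \<beta> * 2 powr \<gamma> * norm \<zeta> powr (\<alpha> + \<beta> + \<gamma> - 4)"
proof -
  define n where "n = norm \<zeta>"
  have n1: "1 \<le> n" using assms t norm_ge_zero[of z0] unfolding n_def by (smt (verit))
  then have n: "n > 0" "1 \<le> n" by auto
  have "norm (\<zeta> - 1) \<le> 2 * n" using norm_triangle_ineq4[of \<zeta> 1] n by (simp add: n_def)
  then have b1: "norm (\<zeta> - 1) powr \<beta> \<le> (2 * n) powr \<beta>" using exps by (intro powr_mono2) auto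
  have "norm (\<zeta> - of_real t) \<le> 2 * n"
  proof -
    have "norm (\<zeta> - of_real t) \<le> n + t" using norm_triangle_ineq4[of \<zeta> "of_real t"] t by (simp add: n_def)
    moreover have "t \<le> n" using assms t norm_ge_zero[of z0] unfolding n_def by (smt (verit))
    ultimately show ?thesis by simp
  qed
  then have b2: "norm (\<zeta> - of_real t) powr \<gamma> \<le> (2 * n) powr \<gamma>" using exps by (intro powr_mono2) auto
  have "norm (\<zeta> - w) \<ge> n / 2" if "norm w = norm z0" for w
    using norm_triangle_ineq2[of \<zeta> w] assms t norm_ge_zero[of z0] that by (simp add: n_def)
  from this[of z0] this[of "cnj z0"]
  have "(n / 2)\<^sup>2 * (n / 2)\<^sup>2 \<le> (norm (\<zeta> - z0))\<^sup>2 * (norm (\<zeta> - cnj z0))\<^sup>2"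
    using n by (intro mult_mono power_mono) auto
  moreover have "(n / 2)\<^sup>2 * (n / 2)\<^sup>2 = n ^ 4 / 16" by (simp add: power2_eq_square power4_eq_xxxx)
  ultimately have den: "n ^ 4 / 16 \<le> (norm (\<zeta> - z0))\<^sup>2 * (norm (\<zeta> - cnj z0))\<^sup>2" by simp
  have "norm (g \<zeta>) = norm \<zeta> powr \<alpha> * norm (\<zeta> - 1) powr \<beta> * norm (\<zeta> - of_real t) powr \<gamma> /
      ((norm (\<zeta> - z0))\<^sup>2 * (norm (\<zeta> - cnj z0))\<^sup>2)"
    by (simp add: sc_integrand_def norm_mult norm_divide norm_power norm_powr_real_powr')
  also have "\<dots> \<le> n powr \<alpha> * (2 * n) powr \<beta> * (2 * n) powr \<gamma> / (n ^ 4 / 16)"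
    using den b1 b2 n by (intro frac_le mult_mono) (auto simp: n_def)
  also have "\<dots> = 16 * 2 powr \<beta> * 2 powr \<gamma> * (n powr \<alpha> * n powr \<beta> * n powr \<gamma> / n ^ 4)"
    using n by (simp add: powr_mult)
  also have "n powr \<alpha> * n powr \<beta> * n powr \<gamma> / n ^ 4 = n powr (\<alpha> + \<beta> + \<gamma> - 4)"
    using n by (simp add: powr_add powr_diff)
  finally show ?thesis by (simp add: n_def)
qed

lemma g1_cont: "continuous_on halfdisc g1"
  unfolding continuous_on_eq_continuous_within
proof
  fix w assume w: "w \<in> halfdisc"
  show "continuous (at w within halfdisc) g1"
  proof (cases "w = 0")
    case True
    define K where "K = 16 * 2 powr \<beta> * 2 powr \<gamma>"
    \<comment> \<open>The exponent of decay after the substitution: 4 - (\<alpha> + \<beta> +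
      \<gamma>) from \<open>g\<close>, less 2 from the derivative of -1/w. It is positive, which
      gives continuity at 0.\<close>
    define s where "s = 2 - (\<alpha> + \<beta> + \<gamma>)"
    have s: "s > 0" using exps by (simp add: s_def)
    have "(g1 \<longlongrightarrow> 0) (at 0 within halfdisc)"
    proof (rule Lim_null_comparison)
      have "((\<lambda>w. K * norm w powr s) \<longlongrightarrow> K * norm (0::complex) powr s) (at 0 within halfdisc)"
        using s by (intro tendsto_intros) auto
      then show "((\<lambda>w::complex. K * norm w powr s) \<longlongrightarrow> 0) (at 0 within halfdisc)" by simp
      show "\<forall>\<^sub>F w in at 0 within halfdisc. norm (g1 w) \<le> K * norm w powr s"
        unfolding eventually_at
      proof (intro exI conjI ballI impI)
        show "1 / (2 * (1 + t + norm z0)) > 0" using t by (simp add: add_pos_nonneg)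
        fix w assume w: "w \<in> halfdisc" "w \<noteq> 0 \<and> dist w 0 < 1 / (2 * (1 + t + norm z0))"
        define \<zeta> where "\<zeta> = - 1 / w"
        have n\<zeta>: "norm \<zeta> = 1 / norm w" by (simp add: \<zeta>_def norm_divide)
        have pos: "2 * (1 + t + norm z0) > 0" using t by (simp add: add_pos_nonneg)
        have "norm w * (2 * (1 + t + norm z0)) < 1" using w(2) pos by (simp only: dist_0_norm dist_commute pos_less_divide_eq)
        then have big: "2 * (1 + t + norm z0) \<le> norm \<zeta>" using w(2) by (simp add: n\<zeta> field_simps)
        have "g1 w = g \<zeta> / w\<^sup>2" using w(2) by (simp add: g1_def \<zeta>_def)
        then have "norm (g1 w) = norm (g \<zeta>) * (norm \<zeta>) powr 2"
          using w(2) by (simp add: norm_divide norm_power n\<zeta> powr_realpow power_divide)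
        also have "\<dots> \<le> K * norm \<zeta> powr (\<alpha> + \<beta> + \<gamma> - 4) * norm \<zeta> powr 2"
          unfolding K_def using g_decay[OF big] by (intro mult_right_mono) auto
        also have "\<dots> = K * norm \<zeta> powr (- s)"
        proof -
          have "(\<alpha> + \<beta> + \<gamma> - 4) + 2 = - s" by (simp add: s_def)
          then show ?thesis by (metis mult.assoc powr_add)
        qed
        also have "norm \<zeta> powr (- s) = norm w powr s"
          using w(2) by (simp add: n\<zeta> powr_divide powr_minus)
        finally show "norm (g1 w) \<le> K * norm w powr s" .
      qed
    qed
    then show ?thesis using True by (simp add: continuous_within g1_def)
  next
    case False
    have "continuous_on (halfdisc - {0}) (\<lambda>w. g (- 1 / w))"
    proof (rule continuous_on_compose2[OF g_cont])
      show "continuous_on (halfdisc - {0}) (\<lambda>w. - 1 / w)" by (intro continuous_intros) auto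
      show "(\<lambda>w. - 1 / w) ` (halfdisc - {0}) \<subseteq> {z. 0 \<le> Im z} - {z0}"
        using minus_inverse_halfdisc(1) by (intro image_subsetI) blast
    qed
    then have "continuous_on (halfdisc - {0}) (\<lambda>w. g (- 1 / w) / w\<^sup>2)"
      by (intro continuous_intros) auto
    then have "continuous_on (halfdisc - {0}) g1"
      by (rule continuous_on_eq) (simp add: g1_def)
    then have "continuous (at w within halfdisc - {0}) g1"
      using w False by (simp add: continuous_on_eq_continuous_within)
    moreover have "at w within halfdisc - {0} = at w within halfdisc"
      by (rule at_within_nhd[of w "- {0}"]) (use False in auto)
    ultimately show ?thesis by simp
  qed
qed

text \<open>A primitive of \<open>g1\<close> is continuous at 0, and up to a factor and a constant
  it is \<open>fb\<close> in the inverted variable. The limit is taken in the closed half plane, so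
  both ends of the real axis have the same image.\<close>

lemma fb_limit_infinity:
  obtains zinf where "\<And>e. e > 0 \<Longrightarrow> \<exists>R. \<forall>z. 0 \<le> Im z \<longrightarrow> R < norm z \<longrightarrow> norm (fb z - zinf) \<le> e"
proof -
  have cvx: "convex halfdisc" by (intro convex_Int convex_ball convex_halfspace_Im_ge)
  have "\<exists>G. \<forall>w\<in>halfdisc. (G has_field_derivative g1 w) (at w within halfdisc)"
  proof (rule holomorphic_convex_primitive[OF cvx finite.emptyI g1_cont])
    fix w assume w: "w \<in> interior halfdisc - {}"
    have "Im w \<noteq> 0"
    proof
      assume "Im w = 0"
      obtain e where e: "e > 0" "ball w e \<subseteq> halfdisc" using w by (metis Diff_empty mem_interior)
      have "w - \<i> * of_real (e/2) \<in> ball w e" using e by (simp add: dist_norm norm_mult)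
      then have "w - \<i> * of_real (e/2) \<in> halfdisc" using e by blast
      then show False using e(1) \<open>Im w = 0\<close> by simp
    qed
    moreover have wh: "w \<in> halfdisc" using w interior_subset by blast
    ultimately have w: "0 < Im w" "w \<noteq> 0" by auto
    have z: "- 1 / w \<in> upper_half_plane - {z0}" using minus_inverse_halfdisc[OF wh w(2)] w by auto
    have "(g has_field_derivative deriv g (- 1 / w)) (at (- 1 / w))"
      by (rule holomorphic_derivI[OF g_holomorphic _ z]) auto
    moreover have "((\<lambda>w. - 1 / w) has_field_derivative 1 / w\<^sup>2) (at w)"
      using w by (auto intro!: derivative_eq_intros simp: power2_eq_square)
    ultimately have "((\<lambda>w. g (- 1 / w)) has_field_derivative deriv g (- 1 / w) * (1 / w\<^sup>2)) (at w)"
      by (rule DERIV_chain2)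
    then have "(\<lambda>w. g (- 1 / w)) field_differentiable at w" unfolding field_differentiable_def by blast
    then have "(\<lambda>w. g (- 1 / w) / w\<^sup>2) field_differentiable at w"
      using w by (intro field_differentiable_divide) (auto intro!: derivative_intros field_differentiable_power field_differentiable_ident)
    then show "g1 field_differentiable at w"
      by (rule field_differentiable_transform_within[OF zero_less_norm_iff[THEN iffD2, OF w(2)] UNIV_I, rotated])
        (auto simp: g1_def)
  qed blast
  then obtain G1 where G1: "\<And>w. w \<in> halfdisc \<Longrightarrow> (G1 has_field_derivative g1 w) (at w within halfdisc)" by blast
  define T where "T = ball 0 (1 / (1 + norm z0)) \<inter> upper_half_plane"
  have T: "open T" "convex T" by (auto simp: T_def intro: convex_Int)
  have "\<exists>k. \<forall>w\<in>T. fb (- 1 / w) - C * G1 w = k"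
  proof (rule has_field_derivative_zero_constant[OF T(2)])
    fix w assume w: "w \<in> T"
    then have wh: "w \<in> halfdisc" "w \<noteq> 0" "0 < Im w" by (auto simp: T_def)
    have "(fb has_field_derivative C * g (- 1 / w)) (at (- 1 / w))"
      using minus_inverse_halfdisc[OF wh(1,2)] wh by (intro fb_deriv) auto
    moreover have "((\<lambda>w. - 1 / w) has_field_derivative 1 / w\<^sup>2) (at w)"
      using wh by (auto intro!: derivative_eq_intros simp: power2_eq_square)
    ultimately have "((\<lambda>w. fb (- 1 / w)) has_field_derivative C * g (- 1 / w) * (1 / w\<^sup>2)) (at w)"
      by (rule DERIV_chain2)
    moreover have "(G1 has_field_derivative g1 w) (at w)"
    proof -
      have "T \<subseteq> halfdisc" by (auto simp: T_def)
      then show ?thesis using has_field_derivative_subset[OF G1[OF wh(1)], of T] at_within_open[OF w T(1)] by simp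
    qed
    ultimately have "((\<lambda>w. fb (- 1 / w) - C * G1 w) has_field_derivative C * g (- 1 / w) * (1 / w\<^sup>2) - C * g1 w) (at w)"
      by (intro DERIV_diff DERIV_cmult)
    moreover have "C * g (- 1 / w) * (1 / w\<^sup>2) - C * g1 w = 0" using wh(2) by (simp add: g1_def)
    ultimately show "((\<lambda>w. fb (- 1 / w) - C * G1 w) has_field_derivative 0) (at w within T)"
      by (simp add: has_field_derivative_at_within)
  qed
  then obtain k where k: "\<And>w. w \<in> T \<Longrightarrow> fb (- 1 / w) - C * G1 w = k" by blast
  define zinf where "zinf = C * G1 0 + k"
  show ?thesis
  proof (rule that[of zinf])
    fix e :: real assume e: "e > 0"
    have 0: "0 \<in> halfdisc" by (simp add: add_pos_nonneg)
    have "continuous (at 0 within halfdisc) (\<lambda>w. C * G1 w)"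
      by (intro continuous_intros DERIV_continuous[OF G1[OF 0]])
    then obtain d where d: "d > 0" "\<And>w. w \<in> halfdisc \<Longrightarrow> dist w 0 < d \<Longrightarrow> dist (C * G1 w) (C * G1 0) < e"
      using e unfolding continuous_within_eps_delta by metis
    define R where "R = max (1 / d) (1 + norm z0)"
    have upper: "norm (fb z - zinf) \<le> e" if z: "0 < Im z" "R < norm z" for z
    proof -
      define w where "w = - 1 / z"
      have nw: "norm w = 1 / norm z" by (simp add: w_def norm_divide)
      have nz: "norm z > 0" using z by auto
      have "1 / d < norm z" "1 + norm z0 < norm z" using z by (auto simp: R_def)
      then have small: "norm w < d" "norm w < 1 / (1 + norm z0)"
        using nz d(1) by (auto simp: nw field_simps add_pos_nonneg)
      have "Im w > 0" using z nz by (simp add: w_def Im_divide cmod_power2[symmetric] divide_pos_pos)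
      then have "w \<in> T" "w \<in> halfdisc" using small by (auto simp: T_def)
      moreover have "- 1 / w = z" using nz by (simp add: w_def)
      ultimately have "fb z - zinf = C * G1 w - C * G1 0" "dist (C * G1 w) (C * G1 0) < e"
        using k[of w] d(2)[of w] small by (auto simp: zinf_def algebra_simps)
      then show ?thesis by (simp add: dist_norm)
    qed
    have "norm (fb z - zinf) \<le> e" if z: "0 \<le> Im z" "R < norm z" for z
    proof (cases "0 < Im z")
      case False
      \<comment> \<open>Real points were left out of the comparison with \<open>G1\<close>; the
        bound reaches them by continuity of \<open>fb\<close>.\<close>
      then have zr: "z = of_real (Re z)" using z by (simp add: complex_eq_iff)
      have "z \<in> {z. 0 \<le> Im z} - {z0}" using z z0 False by auto
      then have "(fb \<longlongrightarrow> fb z) (at z within {z. 0 \<le> Im z} - {z0})"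
        using fb_cont by (simp add: continuous_on_def)
      then have lim: "(fb \<longlongrightarrow> fb z) (at z within (- {z0} \<inter> upper_half_plane))"
        by (rule tendsto_within_subset) auto
      show ?thesis
      proof (rule tendsto_upperbound)
        show "((\<lambda>w. norm (fb w - zinf)) \<longlongrightarrow> norm (fb z - zinf)) (at z within (- {z0} \<inter> upper_half_plane))"
          by (intro tendsto_intros lim)
        show "at z within (- {z0} \<inter> upper_half_plane) \<noteq> bot"
          using at_within_upper_half_plane_neq_bot[of "- {z0}" "Re z"] zr z0 False by auto
        have "((\<lambda>w. norm w) \<longlongrightarrow> norm z) (at z within (- {z0} \<inter> upper_half_plane))"
          by (intro tendsto_intros)
        then have "\<forall>\<^sub>F w in at z within (- {z0} \<inter> upper_half_plane). R < norm w"
          using z(2) by (rule order_tendstoD)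
        moreover have "\<forall>\<^sub>F w in at z within (- {z0} \<inter> upper_half_plane). w \<in> - {z0} \<inter> upper_half_plane"
          by (simp add: eventually_at_filter)
        ultimately show "\<forall>\<^sub>F w in at z within (- {z0} \<inter> upper_half_plane). norm (fb w - zinf) \<le> e"
          by eventually_elim (use upper in auto)
      qed
    qed (use upper z in auto)
    then show "\<exists>R. \<forall>z. 0 \<le> Im z \<longrightarrow> R < norm z \<longrightarrow> norm (fb z - zinf) \<le> e" by blast
  qed
qed

end

section \<open>Boundary correspondence\<close>

text \<open>This form vanishes on the line through \<open>p\<close> and \<open>q\<close> and is negative to the right of it. Since
  the polygon is traversed with its exterior on the left, it lies to the right of each of its sides.\<close>

definition side_form :: "complex \<Rightarrow> complex \<Rightarrow> complex \<Rightarrow> real" where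
  "side_form p q z = Im ((z - p) * cnj (q - p))"

lemma side_form_ends [simp]: "side_form p q p = 0" "side_form p q q = 0"
  by (simp_all add: side_form_def algebra_simps)

lemma side_form_affine:
  "side_form p q ((1 - of_real u) * a + of_real u * b) = (1 - u) * side_form p q a + u * side_form p q b"
  by (simp add: side_form_def algebra_simps)

lemma side_form_add: "side_form p q (a + of_real u * (b - c)) = side_form p q a + u * (side_form p q b - side_form p q c)"
  by (simp add: side_form_def algebra_simps)

lemma side_form_segment:
  assumes "z \<in> closed_segment a b"
  obtains u where "0 \<le> u" "u \<le> 1" "z = (1 - of_real u) * a + of_real u * b"
    "\<And>p q. side_form p q z = (1 - u) * side_form p q a + u * side_form p q b"
proof -
  obtain u where "0 \<le> u" "u \<le> 1" "z = (1 - of_real u) * a + of_real u * b"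
    using assms by (auto simp: closed_segment_def scaleR_conv_of_real)
  then show ?thesis using that side_form_affine by blast
qed

lemma continuous_side_form [continuous_intros]: "continuous_on S h \<Longrightarrow> continuous_on S (\<lambda>x. side_form p q (h x))"
  unfolding side_form_def by (intro continuous_intros)

text \<open>The angle exceeds pi by less than pi, so its sine is negative and \<open>p\<close> lies
  to the right of the side from \<open>v\<close> to \<open>q\<close>. The form takes the same value
  for the other side at \<open>v\<close>.\<close>

lemma side_form_neg_of_angle:
  assumes "0 < \<kappa>" "\<kappa> < 1" "0 < \<rho>" "q \<noteq> v" and eq: "p - v = of_real \<rho> * cis ((1 + \<kappa>) * pi) * (q - v)"
  shows "side_form v q p < 0" "side_form p v q < 0"
proof -
  have s: "sin (\<kappa> * pi) > 0" using assms by (intro sin_gt_zero) auto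
  have c: "cis ((1 + \<kappa>) * pi) = - cis (\<kappa> * pi)"
    by (simp add: complex_eq_iff distrib_right sin_add cos_add)
  have n: "(q - v) * cnj (q - v) = of_real ((norm (q - v))\<^sup>2)" by (simp only: complex_norm_square)
  have "(p - v) * cnj (q - v) = of_real (\<rho> * (norm (q - v))\<^sup>2) * - cis (\<kappa> * pi)"
    unfolding eq c of_real_mult n[symmetric] by (simp only: mult_ac mult_minus_left mult_minus_right)
  then have e: "side_form v q p = - (\<rho> * (norm (q - v))\<^sup>2 * sin (\<kappa> * pi))"
    by (simp add: side_form_def)
  have "0 < (norm (q - v))\<^sup>2" using assms(4) by simp
  then show *: "side_form v q p < 0" using e s assms(3) by (simp add: mult_pos_pos)
  have "side_form p v q = side_form v q p" by (simp add: side_form_def algebra_simps)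
  then show "side_form p v q < 0" using * by simp
qed

section \<open>Directions of the sides and arguments of the integrand\<close>

locale sc_quad = sc_map \<alpha> \<beta> \<gamma> t z0 C z1 f
  for \<alpha> \<beta> \<gamma> t :: real and z0 C z1 :: complex and f :: "complex \<Rightarrow> complex option" +
  fixes D :: "complex option set" and z2 z3 z4 :: complex and \<delta> :: real
  assumes delta: "0 < \<delta>" "\<delta> < 1" and exps1: "\<alpha> < 1" "\<beta> < 1" "\<gamma> < 1"
    and openD: "openin sphere_top D"
    and frontierD: "sphere_top frontier_of D =
       Some ` (closed_segment z1 z2 \<union> closed_segment z2 z3 \<union> closed_segment z3 z4 \<union> closed_segment z4 z1)"
    and angle1: "z2 \<noteq> z1" "\<exists>\<rho>>0. z4 - z1 = of_real \<rho> * cis ((1 + \<alpha>) * pi) * (z2 - z1)"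
    and angle2: "z3 \<noteq> z2" "\<exists>\<rho>>0. z1 - z2 = of_real \<rho> * cis ((1 + \<beta>) * pi) * (z3 - z2)"
    and angle3: "z4 \<noteq> z3" "\<exists>\<rho>>0. z2 - z3 = of_real \<rho> * cis ((1 + \<gamma>) * pi) * (z4 - z3)"
    and angle4: "z1 \<noteq> z4" "\<exists>\<rho>>0. z3 - z4 = of_real \<rho> * cis ((1 + \<delta>) * pi) * (z1 - z4)"
    and C_def: "C = (z2 - z1) / contour_integral (linepath 0 1) (sc_integrand \<alpha> \<beta> \<gamma> t z0)"
    and conf: "conformal_into_sphere f upper_half_plane D" and f_z0: "f z0 = infty"
begin

abbreviation "polygon \<equiv> closed_segment z1 z2 \<union> closed_segment z2 z3 \<union> closed_segment z3 z4 \<union> closed_segment z4 z1"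

text \<open>Each inequality is the angle condition at one end of the side, applied to the
  neighbouring vertex; together they express strict convexity.\<close>

lemma side_forms:
  "side_form z1 z2 z3 < 0" "side_form z1 z2 z4 < 0"
  "side_form z2 z3 z4 < 0" "side_form z2 z3 z1 < 0"
  "side_form z3 z4 z1 < 0" "side_form z3 z4 z2 < 0"
  "side_form z4 z1 z2 < 0" "side_form z4 z1 z3 < 0"
proof -
  obtain \<rho>1 where 1: "\<rho>1 > 0" "z4 - z1 = of_real \<rho>1 * cis ((1 + \<alpha>) * pi) * (z2 - z1)" using angle1(2) by blast
  obtain \<rho>2 where 2: "\<rho>2 > 0" "z1 - z2 = of_real \<rho>2 * cis ((1 + \<beta>) * pi) * (z3 - z2)" using angle2(2) by blast
  obtain \<rho>3 where 3: "\<rho>3 > 0" "z2 - z3 = of_real \<rho>3 * cis ((1 + \<gamma>) * pi) * (z4 - z3)" using angle3(2) by blast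
  obtain \<rho>4 where 4: "\<rho>4 > 0" "z3 - z4 = of_real \<rho>4 * cis ((1 + \<delta>) * pi) * (z1 - z4)" using angle4(2) by blast
  note n = side_form_neg_of_angle[OF exps(1) exps1(1) 1(1) angle1(1) 1(2)]
    side_form_neg_of_angle[OF exps(2) exps1(2) 2(1) angle2(1) 2(2)]
    side_form_neg_of_angle[OF exps(3) exps1(3) 3(1) angle3(1) 3(2)]
    side_form_neg_of_angle[OF delta 4(1) angle4(1) 4(2)]
  show "side_form z1 z2 z3 < 0" "side_form z1 z2 z4 < 0" "side_form z2 z3 z4 < 0" "side_form z2 z3 z1 < 0"
    "side_form z3 z4 z1 < 0" "side_form z3 z4 z2 < 0" "side_form z4 z1 z2 < 0" "side_form z4 z1 z3 < 0"
    by (fact n)+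
qed

definition weight :: "real \<Rightarrow> real" where
  "weight x = \<bar>x\<bar> powr \<alpha> * \<bar>x - 1\<bar> powr \<beta> * \<bar>x - t\<bar> powr \<gamma> / ((norm (of_real x - z0))\<^sup>2)\<^sup>2"

lemma weight_pos: "x \<notin> {0, 1, t} \<Longrightarrow> 0 < weight x"
proof -
  assume "x \<notin> {0, 1, t}"
  moreover have "of_real x \<noteq> z0" using z0 by auto
  ultimately show ?thesis unfolding weight_def by (intro divide_pos_pos mult_pos_pos) auto
qed

text \<open>The unimodular factor of the integrand on the real axis, as a limit from above. Its
  values at 0, 1, t are immaterial, since \<open>weight\<close> vanishes there.\<close>

definition phase :: "real \<Rightarrow> complex" where
  "phase x = (if x < 0 then cis (pi * \<alpha>) else 1) * (if x < 1 then cis (pi * \<beta>) else 1) * (if x < t then cis (pi * \<gamma>) else 1)"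

lemma g_real: "g (of_real x) = of_real (weight x) * phase x"
proof -
  have "(of_real x - z0) * (of_real x - cnj z0) = of_real ((norm (of_real x - z0))\<^sup>2)"
    by (simp only: complex_norm_square complex_cnj_diff complex_cnj_complex_of_real)
  then have "(of_real x - z0)\<^sup>2 * (of_real x - cnj z0)\<^sup>2 = of_real (((norm (of_real x - z0))\<^sup>2)\<^sup>2)"
    by (metis of_real_power power_mult_distrib)
  moreover have "(of_real x :: complex) powr of_real \<alpha> = of_real (\<bar>x\<bar> powr \<alpha>) * (if x < 0 then cis (pi * \<alpha>) else 1)"
    by (rule powr_of_real_cis)
  moreover have "(of_real x - 1 :: complex) powr of_real \<beta> = of_real (\<bar>x - 1\<bar> powr \<beta>) * (if x < 1 then cis (pi * \<beta>) else 1)"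
    using powr_of_real_cis[of "x - 1" \<beta>] by simp
  moreover have "(of_real x - of_real t :: complex) powr of_real \<gamma> = of_real (\<bar>x - t\<bar> powr \<gamma>) * (if x < t then cis (pi * \<gamma>) else 1)"
    using powr_of_real_cis[of "x - t" \<gamma>] by simp
  moreover have "(a * A) * (b * B) * (c * G) / d = (a * b * c / d) * (A * B * G)" for a b c d A B G :: complex
    by (simp only: divide_inverse mult_ac)
  ultimately show ?thesis
    unfolding sc_integrand_def weight_def phase_def of_real_divide of_real_mult by (simp only:)
qed

lemma cis_pi_plus: "cis ((1 + \<kappa>) * pi) = - cis (pi * \<kappa>)"
proof -
  have "(1 + \<kappa>) * pi = pi * \<kappa> + pi" by (simp add: algebra_simps)
  then show ?thesis by (simp add: complex_eq_iff)
qed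

text \<open>The direction in which the boundary ought to be traversed; that the image turns exactly
  at the vertices has still to be shown.\<close>

definition dir :: "real \<Rightarrow> complex" where
  "dir x = (if x < 0 then z1 - z4 else if x < 1 then z2 - z1 else if x < t then z3 - z2 else z4 - z3)"

lemma dir_nonzero: "dir x \<noteq> 0"
  using angle1(1) angle2(1) angle3(1) angle4(1) by (simp add: dir_def)

text \<open>From 0 to 1 the choice of \<open>C\<close> fixes the direction. Past each of 0, 1, t the
  integrand loses a factor \<open>cis (pi * \<kappa>)\<close>, and the interior angle says that
  consecutive sides differ by this factor up to a positive number.\<close>

lemma C_phase: "\<exists>k>0. C * phase x = of_real k * dir x"
proof -
  \<comment> \<open>The integral in the denominator of \<open>C\<close> is a positive multiple of
    the phase, which is constant between 0 and 1.\<close>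
  have "\<exists>s>0. G0 1 = G0 0 + of_real s * phase 0"
  proof -
    have ne: "phase 0 \<noteq> 0" using t by (simp add: phase_def)
    have "continuous_on {0..1} (\<lambda>x. G0 (of_real x))"
      using G0_deriv_real by (meson continuous_at_imp_continuous_on has_vector_derivative_continuous)
    moreover have "((\<lambda>x. G0 (of_real x)) has_vector_derivative of_real (weight x) * phase 0) (at x) \<and> weight x > 0"
      if "0 < x" "x < 1" for x
    proof -
      have "phase x = phase 0" using that t by (simp add: phase_def)
      then show ?thesis using G0_deriv_real[of x] g_real[of x] weight_pos[of x] that t by simp
    qed
    ultimately obtain s where "s > 0" "G0 (of_real 1) = G0 (of_real 0) + of_real s * phase 0"
      using straight_image_step[of 0 1 "\<lambda>x. G0 (of_real x)" "phase 0" weight] ne by (metis zero_less_one)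
    then show ?thesis by auto
  qed
  then obtain s where s: "s > 0" "contour_integral (linepath 0 1) g = of_real s * phase 0"
    unfolding contour_integral_01 by auto
  have ph0: "phase 0 \<noteq> 0" using t by (simp add: phase_def)
  have k2: "C * phase 0 = of_real (1 / s) * (z2 - z1)"
    using s ph0 by (simp add: C_def)
  have p0: "phase 0 = cis (pi * \<beta>) * cis (pi * \<gamma>)" using t by (simp add: phase_def)
  obtain \<rho>1 \<rho>2 \<rho>3 where \<rho>: "\<rho>1 > 0" "z4 - z1 = of_real \<rho>1 * cis ((1 + \<alpha>) * pi) * (z2 - z1)"
     "\<rho>2 > 0" "z1 - z2 = of_real \<rho>2 * cis ((1 + \<beta>) * pi) * (z3 - z2)"
     "\<rho>3 > 0" "z2 - z3 = of_real \<rho>3 * cis ((1 + \<gamma>) * pi) * (z4 - z3)"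
    using angle1(2) angle2(2) angle3(2) by blast
  have e1: "z1 - z4 = of_real \<rho>1 * cis (pi * \<alpha>) * (z2 - z1)"
    using \<rho>(2) unfolding cis_pi_plus by (simp add: algebra_simps)
  have e2: "z2 - z1 = of_real \<rho>2 * cis (pi * \<beta>) * (z3 - z2)"
    using \<rho>(4) unfolding cis_pi_plus by (simp add: algebra_simps)
  have e3: "z3 - z2 = of_real \<rho>3 * cis (pi * \<gamma>) * (z4 - z3)"
    using \<rho>(6) unfolding cis_pi_plus by (simp add: algebra_simps)
  have c1: "C * cis (pi * \<gamma>) = of_real (\<rho>2 / s) * (z3 - z2)"
  proof -
    have "cis (pi * \<beta>) * (C * cis (pi * \<gamma>)) = cis (pi * \<beta>) * (of_real (\<rho>2 / s) * (z3 - z2))"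
      using k2 unfolding p0 e2 by (simp add: mult_ac)
    then show ?thesis by (metis cis_neq_zero mult_left_cancel)
  qed
  have c2: "C = of_real (\<rho>2 / s * \<rho>3) * (z4 - z3)"
  proof -
    have "cis (pi * \<gamma>) * C = cis (pi * \<gamma>) * (of_real (\<rho>2 / s * \<rho>3) * (z4 - z3))"
      using c1 unfolding e3 by (simp add: mult_ac)
    then show ?thesis by (metis cis_neq_zero mult_left_cancel)
  qed
  consider "x < 0" | "0 \<le> x" "x < 1" | "1 \<le> x" "x < t" | "t \<le> x" by linarith
  then show ?thesis
  proof cases
    case 1
    then have "phase x = cis (pi * \<alpha>) * phase 0" using t by (simp add: phase_def)
    then have "C * phase x = cis (pi * \<alpha>) * (of_real (1 / s) * (z2 - z1))" using k2 by (metis mult.left_commute)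
    also have "\<dots> = of_real (1 / (s * \<rho>1)) * (z1 - z4)" unfolding e1 using \<rho>(1) s by (simp add: field_simps)
    finally show ?thesis using 1 \<rho>(1) s(1) by (intro exI[of _ "1 / (s * \<rho>1)"]) (simp add: dir_def)
  next
    case 2
    then have "phase x = phase 0" using t by (simp add: phase_def)
    then show ?thesis using 2 k2 s(1) by (intro exI[of _ "1 / s"]) (simp add: dir_def)
  next
    case 3
    then have "phase x = cis (pi * \<gamma>)" by (simp add: phase_def)
    then show ?thesis using 3 c1 s(1) \<rho>(3) by (intro exI[of _ "\<rho>2 / s"]) (simp add: dir_def)
  next
    case 4
    then have "phase x = 1" using t by (simp add: phase_def)
    then show ?thesis using 4 c2 s(1) \<rho>(3,5) t by (intro exI[of _ "\<rho>2 / s * \<rho>3"]) (simp add: dir_def)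
  qed
qed

lemma fb'_dir:
  assumes "x \<notin> {0, 1, t}"
  obtains k where "k > 0" "C * g (of_real x) = of_real k * dir x"
proof -
  obtain k where k: "k > 0" "C * phase x = of_real k * dir x" using C_phase by blast
  have "C * g (of_real x) = of_real (weight x * k) * dir x"
    unfolding g_real of_real_mult using k(2) by (simp add: mult_ac)
  then show ?thesis using that[of "weight x * k"] weight_pos[OF assms] k(1) by simp
qed

lemma fb_real_cont: "continuous_on S (\<lambda>x. fb (of_real x))"
  using fb_deriv_real by (meson continuous_at_imp_continuous_on has_vector_derivative_continuous)

lemma fb_step:
  assumes "a < b" and d: "\<And>x. a < x \<Longrightarrow> x < b \<Longrightarrow> x \<notin> {0, 1, t} \<and> dir x = d"
  obtains s where "s > 0" "fb (of_real b) = fb (of_real a) + of_real s * d"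
proof -
  define m where "m = (\<lambda>x. SOME k. k > 0 \<and> C * g (of_real x) = of_real k * dir x)"
  have m: "m x > 0 \<and> C * g (of_real x) = of_real (m x) * dir x" if "x \<notin> {0, 1, t}" for x
    unfolding m_def by (rule someI_ex) (use fb'_dir[OF that] in metis)
  have "dir ((a + b) / 2) = d" using d[of "(a + b) / 2"] assms(1) by simp
  then have "d \<noteq> 0" using dir_nonzero by blast
  moreover have "((\<lambda>x. fb (of_real x)) has_vector_derivative of_real (m x) * d) (at x) \<and> m x > 0"
    if "a < x" "x < b" for x
    using fb_deriv_real[of x] m[of x] d[OF that] by auto
  ultimately show ?thesis
    using straight_image_step[OF assms(1) fb_real_cont, of d m] that by metis
qed

end

text \<open>The bound \<open>s0\<close> keeps the limit away from the starting point of the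
  ray.\<close>

lemma limit_on_ray:
  fixes \<phi> :: "real \<Rightarrow> complex"
  assumes F: "F \<noteq> bot" "(\<phi> \<longlongrightarrow> l) F" and "d \<noteq> 0" and "s0 > 0"
    and ev: "\<forall>\<^sub>F y in F. \<exists>s\<ge>s0. \<phi> y = a + of_real s * d"
  obtains s where "s > 0" "l = a + of_real s * d"
proof -
  have lim: "((\<lambda>y. (\<phi> y - a) / d) \<longlongrightarrow> (l - a) / d) F" using \<open>d \<noteq> 0\<close> by (intro tendsto_intros F) auto
  have ev': "\<forall>\<^sub>F y in F. s0 \<le> Re ((\<phi> y - a) / d) \<and> Im ((\<phi> y - a) / d) = 0"
    using ev by eventually_elim (use \<open>d \<noteq> 0\<close> in auto)
  have "s0 \<le> Re ((l - a) / d)"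
    by (rule tendsto_lowerbound[OF tendsto_Re[OF lim] _ F(1)]) (use ev' in \<open>auto elim: eventually_mono\<close>)
  moreover have "Im ((l - a) / d) = 0"
  proof (rule tendsto_unique[OF F(1) tendsto_Im[OF lim]])
    show "((\<lambda>y. Im ((\<phi> y - a) / d)) \<longlongrightarrow> 0) F"
      by (rule tendsto_eventually) (use ev' in \<open>auto elim: eventually_mono\<close>)
  qed
  ultimately have "(l - a) / d = of_real (Re ((l - a) / d))" "Re ((l - a) / d) > 0"
    using \<open>s0 > 0\<close> by (auto simp: complex_eq_iff)
  then have "l = a + of_real (Re ((l - a) / d)) * d"
    using \<open>d \<noteq> 0\<close> by (metis add.commute diff_add_cancel nonzero_eq_divide_eq)
  then show ?thesis using that \<open>Re ((l - a) / d) > 0\<close> by blast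
qed

section \<open>Images of the real axis, of \<open>t\<close> and of infinity\<close>

context sc_quad
begin

lemma bij_f: "bij_betw f upper_half_plane D"
  using conf by (simp add: conformal_into_sphere_def)

lemma C_nonzero: "C \<noteq> 0"
  using C_phase[of 0] dir_nonzero[of 0] by auto

lemma fb_inj: "0 < Im z \<Longrightarrow> z \<noteq> z0 \<Longrightarrow> 0 < Im w \<Longrightarrow> w \<noteq> z0 \<Longrightarrow> fb z = fb w \<Longrightarrow> z = w"
  using bij_f fb_upper by (metis bij_betw_def inj_on_def mem_upper_half_plane)

lemma fb_within_upper: "(fb \<longlongrightarrow> fb (of_real x)) (at (of_real x) within upper_half_plane)"
proof -
  have "of_real x \<in> {z. 0 \<le> Im z} - {z0}" using z0 by auto
  then have "(fb \<longlongrightarrow> fb (of_real x)) (at (of_real x) within {z. 0 \<le> Im z} - {z0})"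
    using fb_cont by (simp add: continuous_on_def)
  then have "(fb \<longlongrightarrow> fb (of_real x)) (at (of_real x) within upper_half_plane - {z0})"
    by (rule tendsto_within_subset) auto
  moreover have "at (of_real x) within upper_half_plane - {z0} = at (of_real x) within upper_half_plane"
    by (rule at_within_nhd[of _ "- {z0}"]) (use z0 in auto)
  ultimately show ?thesis by simp
qed

lemma eventually_upper: "\<forall>\<^sub>F z in at (of_real x) within upper_half_plane. 0 < Im z \<and> Im z < e" if "e > 0"
proof -
  have "((\<lambda>z. Im z) \<longlongrightarrow> Im (of_real x)) (at (of_real x) within upper_half_plane)" by (intro tendsto_intros)
  then have "\<forall>\<^sub>F z in at (of_real x) within upper_half_plane. Im z < e" using that by (intro order_tendstoD) auto
  moreover have "\<forall>\<^sub>F z in at (of_real x) within upper_half_plane. z \<in> upper_half_plane"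
    by (simp add: eventually_at_filter)
  ultimately show ?thesis by eventually_elim auto
qed

lemma upper_filter_nontrivial: "at (of_real x) within upper_half_plane \<noteq> bot"
  using at_within_upper_half_plane_neq_bot[of UNIV x] by simp

lemma eventually_fb_in:
  assumes "open T" "fb (of_real x) \<in> T" "e > 0"
  obtains z where "0 < Im z" "Im z < e" "z \<noteq> z0" "fb z \<in> T"
proof -
  have "\<forall>\<^sub>F z in at (of_real x) within upper_half_plane. fb z \<in> T"
    by (rule topological_tendstoD[OF fb_within_upper assms(1,2)])
  then have "\<forall>\<^sub>F z in at (of_real x) within upper_half_plane. fb z \<in> T \<and> 0 < Im z \<and> Im z < min e (Im z0)"
    using eventually_upper[of "min e (Im z0)" x] assms(3) z0 by (auto elim: eventually_elim2)
  then obtain z where "fb z \<in> T \<and> 0 < Im z \<and> Im z < min e (Im z0)"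
    using eventually_happens'[OF upper_filter_nontrivial] by blast
  then show ?thesis using that[of z] by auto
qed

text \<open>A boundary value in \<open>D\<close> is also attained at some \<zeta> above the axis,
  and by the open mapping theorem so are all values near it, close to \<zeta>. Points close to
  \<open>x\<close> attain such values too, against injectivity.\<close>

lemma fb_real_notin: "Some (fb (of_real x)) \<notin> D"
proof
  assume "Some (fb (of_real x)) \<in> D"
  then obtain \<zeta> where "0 < Im \<zeta>" "f \<zeta> = Some (fb (of_real x))"
    using bij_f by (auto simp: bij_betw_def)
  moreover from this have "\<zeta> \<noteq> z0" using f_z0 by auto
  ultimately have \<zeta>: "0 < Im \<zeta>" "\<zeta> \<noteq> z0" "fb \<zeta> = fb (of_real x)" using fb_upper[of \<zeta>] by simp_all
  \<comment> \<open>A region around \<zeta> that stays above the points to be chosen near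
    \<open>x\<close>.\<close>
  define B where "B = {z. Im \<zeta> / 2 < Im z} - {z0}"
  have B: "open B" "\<zeta> \<in> B"
    unfolding B_def using \<zeta> by (intro open_delete open_halfspace_Im_gt, simp)
  have up: "0 < Im z" "z \<noteq> z0" if "z \<in> B" for z using that \<zeta>(1) by (auto simp: B_def)
  have hol: "fb holomorphic_on B"
    unfolding holomorphic_on_open[OF B(1)] using fb_deriv up by blast
  have "inj_on fb B" by (rule inj_onI) (use fb_inj up in blast)
  then have "open (fb ` B)" using open_mapping_thm3[OF hol B(1)] by blast
  moreover have "fb (of_real x) \<in> fb ` B" using B(2) \<zeta>(3) by (metis imageI)
  ultimately obtain z where z: "0 < Im z" "Im z < Im \<zeta> / 2" "z \<noteq> z0" "fb z \<in> fb ` B"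
    using eventually_fb_in[of "fb ` B" x "Im \<zeta> / 2"] \<zeta>(1) by (metis half_gt_zero)
  then obtain z' where z': "z' \<in> B" "fb z = fb z'" by blast
  then have "z = z'" using fb_inj z up by blast
  then show False using z(2) z'(1) by (simp add: B_def)
qed

text \<open>Limits of values in \<open>D\<close> lie in its closure; not being in the open set
  \<open>D\<close>, they are frontier points.\<close>

lemma fb_real_polygon: "fb (of_real x) \<in> polygon"
proof -
  have "Some (fb (of_real x)) \<in> sphere_top closure_of D"
    unfolding in_closure_of
  proof (intro conjI allI impI)
    show "Some (fb (of_real x)) \<in> topspace sphere_top" by simp
    fix T assume T: "Some (fb (of_real x)) \<in> T \<and> openin sphere_top T"
    then obtain z where "0 < Im z" "z \<noteq> z0" "fb z \<in> Some -` T"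
      using eventually_fb_in[of "Some -` T" x 1] open_Some_vimage[of T] by (metis vimageI2 zero_less_one)
    then have "Some (fb z) \<in> D \<and> Some (fb z) \<in> T"
      using fb_upper[of z] bij_f by (metis bij_betwE mem_upper_half_plane vimageD)
    then show "\<exists>y. y \<in> D \<and> y \<in> T" by blast
  qed
  then have "Some (fb (of_real x)) \<in> sphere_top frontier_of D"
    using fb_real_notin[of x] interior_of_openin[OF openD] by (simp add: frontier_of_def)
  then show ?thesis using frontierD by auto
qed

definition zinf :: complex where
  "zinf = (SOME w. \<forall>e>0. \<exists>R. \<forall>z. 0 \<le> Im z \<longrightarrow> R < norm z \<longrightarrow> norm (fb z - w) \<le> e)"

lemma zinf: "e > 0 \<Longrightarrow> \<exists>R. \<forall>z. 0 \<le> Im z \<longrightarrow> R < norm z \<longrightarrow> norm (fb z - zinf) \<le> e"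
proof -
  have "\<exists>w. \<forall>e>0. \<exists>R. \<forall>z. 0 \<le> Im z \<longrightarrow> R < norm z \<longrightarrow> norm (fb z - w) \<le> e"
    by (rule fb_limit_infinity) blast
  then have "\<forall>e>0. \<exists>R. \<forall>z. 0 \<le> Im z \<longrightarrow> R < norm z \<longrightarrow> norm (fb z - zinf) \<le> e"
    unfolding zinf_def by (rule someI_ex)
  then show "e > 0 \<Longrightarrow> ?thesis" by blast
qed

lemma fb_at_top: "((\<lambda>x. fb (of_real x)) \<longlongrightarrow> zinf) at_top"
proof (rule tendstoI)
  fix e :: real assume "e > 0"
  then obtain R where R: "\<And>z. 0 \<le> Im z \<Longrightarrow> R < norm z \<Longrightarrow> norm (fb z - zinf) \<le> e / 2"
    using zinf[of "e / 2"] by auto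
  have "\<forall>\<^sub>F x in at_top. \<bar>R\<bar> < (x::real)" by (rule eventually_gt_at_top)
  then show "\<forall>\<^sub>F x in at_top. dist (fb (of_real x)) zinf < e"
  proof eventually_elim
    case (elim x)
    then have "norm (fb (of_real x) - zinf) \<le> e / 2" by (intro R) auto
    then show ?case using \<open>e > 0\<close> by (simp add: dist_norm)
  qed
qed

lemma fb_at_bot: "((\<lambda>x. fb (of_real x)) \<longlongrightarrow> zinf) at_bot"
proof (rule tendstoI)
  fix e :: real assume "e > 0"
  then obtain R where R: "\<And>z. 0 \<le> Im z \<Longrightarrow> R < norm z \<Longrightarrow> norm (fb z - zinf) \<le> e / 2"
    using zinf[of "e / 2"] by auto
  have "\<forall>\<^sub>F x in at_bot. (x::real) < - \<bar>R\<bar>" by (rule eventually_gt_at_bot)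
  then show "\<forall>\<^sub>F x in at_bot. dist (fb (of_real x)) zinf < e"
  proof eventually_elim
    case (elim x)
    then have "norm (fb (of_real x) - zinf) \<le> e / 2" by (intro R) auto
    then show ?case using \<open>e > 0\<close> by (simp add: dist_norm)
  qed
qed

text \<open>The image of an unbounded interval runs along a ray, and so does its limit; a first step
  of fixed length prevents the limit from falling back to the start.\<close>

lemma ray_right:
  assumes "t \<le> x"
  obtains s where "s > 0" "zinf = fb (of_real x) + of_real s * (z4 - z3)"
proof -
  have st: "\<exists>s>0. fb (of_real b) = fb (of_real a) + of_real s * (z4 - z3)" if "t \<le> a" "a < b" for a b
    by (rule fb_step[OF that(2), of "z4 - z3"]) (use that t in \<open>auto simp: dir_def\<close>)
  obtain s0 where s0: "s0 > 0" "fb (of_real (x + 1)) = fb (of_real x) + of_real s0 * (z4 - z3)"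
    using st[of x "x + 1"] assms by auto
  have "\<forall>\<^sub>F y in at_top. \<exists>s\<ge>s0. fb (of_real y) = fb (of_real x) + of_real s * (z4 - z3)"
    using eventually_gt_at_top[of "x + 1"]
  proof eventually_elim
    case (elim y)
    then obtain s1 where "s1 > 0" "fb (of_real y) = fb (of_real (x + 1)) + of_real s1 * (z4 - z3)"
      using st[of "x + 1" y] assms by auto
    then show ?case using s0 by (intro exI[of _ "s0 + s1"]) (simp add: algebra_simps)
  qed
  then show ?thesis
    by (rule limit_on_ray[OF trivial_limit_at_top_linorder fb_at_top _ s0(1), rotated 1]) (use angle3 that in auto)
qed

lemma ray_left:
  assumes "x \<le> 0"
  obtains s where "s > 0" "zinf = fb (of_real x) + of_real s * (z4 - z1)"
proof -
  have st: "\<exists>s>0. fb (of_real a) = fb (of_real b) + of_real s * (z4 - z1)" if b0: "b \<le> 0" and ab: "a < b" for a b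
  proof -
    obtain s where "s > 0" "fb (of_real b) = fb (of_real a) + of_real s * (z1 - z4)"
      by (rule fb_step[OF ab, of "z1 - z4"]) (use b0 t in \<open>auto simp: dir_def\<close>)
    then show ?thesis by (intro exI[of _ s]) (simp add: algebra_simps)
  qed
  obtain s0 where s0: "s0 > 0" "fb (of_real (x - 1)) = fb (of_real x) + of_real s0 * (z4 - z1)"
    using st[of x "x - 1"] assms by auto
  have "\<forall>\<^sub>F y in at_bot. \<exists>s\<ge>s0. fb (of_real y) = fb (of_real x) + of_real s * (z4 - z1)"
    using eventually_gt_at_bot[of "x - 1"]
  proof eventually_elim
    case (elim y)
    then obtain s1 where "s1 > 0" "fb (of_real y) = fb (of_real (x - 1)) + of_real s1 * (z4 - z1)"
      using st[of "x - 1" y] assms by auto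
    then show ?case using s0 by (intro exI[of _ "s0 + s1"]) (simp add: algebra_simps)
  qed
  then show ?thesis
    by (rule limit_on_ray[OF trivial_limit_at_bot_linorder fb_at_bot _ s0(1), rotated 1]) (use angle4 that in auto)
qed

lemma fb_1_eq: "fb 1 = z2"
proof -
  have "contour_integral (linepath 0 1) g \<noteq> 0" using C_nonzero C_def by auto
  then have "C * contour_integral (linepath 0 1) g = z2 - z1" using C_def nonzero_eq_divide_eq by blast
  then show ?thesis by (simp add: fb_1)
qed

lemma side_form_polygon_zero:
  assumes "z \<in> polygon"
  shows "side_form z1 z2 z = 0 \<or> side_form z2 z3 z = 0 \<or> side_form z3 z4 z = 0 \<or> side_form z4 z1 z = 0"
  using assms by (auto elim!: side_form_segment)

text \<open>From z2 the image moves straight towards z3 until \<open>t\<close>. Turning later than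
  z3 would mean leaving the polygon; turning earlier, towards the direction of z4 - z3, would lead
  into its interior.\<close>

lemma fb_t: "fb (of_real t) = z3"
proof -
  obtain a where a: "a > 0" "fb (of_real t) = z2 + of_real a * (z3 - z2)"
  proof (rule fb_step[OF t, of "z3 - z2"])
    show "x \<notin> {0, 1, t} \<and> dir x = z3 - z2" if "1 < x" "x < t" for x using that by (auto simp: dir_def)
  qed (use fb_1_eq in auto)
  have L: "side_form p q (fb (of_real t)) = side_form p q z2 + a * (side_form p q z3 - side_form p q z2)" for p q
    by (simp add: a(2) side_form_add)
  have L23: "side_form z2 z3 (fb (of_real t)) = 0" by (simp add: L)
  \<comment> \<open>By strict convexity the line through z2 and z3 meets the other sides at most in
    z2 or z3.\<close>
  have "a \<le> 1"
  proof -
    have z: "z2 + of_real a * (z3 - z2) \<in> polygon" using fb_real_polygon[of t] a(2) by simp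
    have co: "b = a" if "z2 + of_real a * (z3 - z2) = z2 + of_real b * (z3 - z2)" for b
      using that angle2(1) by simp
    from z consider "z2 + of_real a * (z3 - z2) \<in> closed_segment z1 z2" | "z2 + of_real a * (z3 - z2) \<in> closed_segment z2 z3"
      | "z2 + of_real a * (z3 - z2) \<in> closed_segment z3 z4" | "z2 + of_real a * (z3 - z2) \<in> closed_segment z4 z1" by blast
    then show ?thesis
    proof cases
      case 1
      then obtain u where u: "0 \<le> u" "u \<le> 1" "z2 + of_real a * (z3 - z2) = (1 - of_real u) * z1 + of_real u * z2"
        "\<And>p q. side_form p q (z2 + of_real a * (z3 - z2)) = (1 - u) * side_form p q z1 + u * side_form p q z2"
        by (rule side_form_segment) blast
      have "(1 - u) * side_form z2 z3 z1 = 0" using u(4)[of z2 z3] L23 a(2) by simp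
      then have "u = 1" using side_forms(4) by simp
      then have "a = 0" using u(3) angle2(1) by simp
      then show ?thesis by simp
    next
      case 2
      then obtain u where u: "0 \<le> u" "u \<le> 1" "z2 + of_real a * (z3 - z2) = (1 - of_real u) * z2 + of_real u * z3"
        by (rule side_form_segment) blast
      then have "u = a" by (intro co) (simp add: algebra_simps)
      then show ?thesis using u by simp
    next
      case 3
      then obtain u where u: "0 \<le> u" "u \<le> 1" "z2 + of_real a * (z3 - z2) = (1 - of_real u) * z3 + of_real u * z4"
        "\<And>p q. side_form p q (z2 + of_real a * (z3 - z2)) = (1 - u) * side_form p q z3 + u * side_form p q z4"
        by (rule side_form_segment) blast
      have "u * side_form z2 z3 z4 = 0" using u(4)[of z2 z3] L23 a(2) by simp
      then have "u = 0" using side_forms(3) by simp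
      then have "1 = a" using u(3) by (intro co) simp
      then show ?thesis by simp
    next
      case 4
      then obtain u where u: "0 \<le> u" "u \<le> 1"
        "\<And>p q. side_form p q (z2 + of_real a * (z3 - z2)) = (1 - u) * side_form p q z4 + u * side_form p q z1"
        by (rule side_form_segment) blast
      have "(1 - u) * side_form z2 z3 z4 + u * side_form z2 z3 z1 = 0" using u(3)[of z2 z3] L23 a(2) by simp
      moreover have "(1 - u) * side_form z2 z3 z4 \<le> 0" "u * side_form z2 z3 z1 \<le> 0"
        using u side_forms(3,4) by (auto intro!: mult_nonneg_nonpos)
      ultimately have "(1 - u) * side_form z2 z3 z4 = 0" "u * side_form z2 z3 z1 = 0" by linarith+
      then show ?thesis using side_forms(3,4) by auto
    qed
  qed
  \<comment> \<open>At an inner point of the side the other three forms are negative and remain so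
    just after \<open>t\<close>, while the turn makes the fourth negative; but at each point of the
    polygon some form vanishes.\<close>
  moreover have "\<not> a < 1"
  proof
    assume a1: "a < 1"
    have neg: "side_form z1 z2 (fb (of_real t)) < 0" "side_form z3 z4 (fb (of_real t)) < 0" "side_form z4 z1 (fb (of_real t)) < 0"
    proof -
      show "side_form z1 z2 (fb (of_real t)) < 0" unfolding L using a(1) side_forms(1) by (simp add: mult_pos_neg)
      have "(1 - a) * side_form z3 z4 z2 < 0" using a1 side_forms(6) by (simp add: mult_pos_neg)
      then show "side_form z3 z4 (fb (of_real t)) < 0" unfolding L by (simp add: algebra_simps)
      have "(1 - a) * side_form z4 z1 z2 < 0" "a * side_form z4 z1 z3 < 0" using a a1 side_forms(7,8) by (auto simp: mult_pos_neg)
      then show "side_form z4 z1 (fb (of_real t)) < 0" unfolding L by (simp add: algebra_simps)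
    qed
    have ev: "\<forall>\<^sub>F x in at_right t. side_form p q (fb (of_real x)) < 0" if "side_form p q (fb (of_real t)) < 0" for p q
    proof -
      have "continuous_on UNIV (\<lambda>x. side_form p q (fb (of_real x)))" by (intro continuous_intros fb_real_cont)
      then have "((\<lambda>x. side_form p q (fb (of_real x))) \<longlongrightarrow> side_form p q (fb (of_real t))) (at_right t)"
        unfolding continuous_on_def by (meson UNIV_I subset_UNIV tendsto_within_subset)
      then show ?thesis using that by (rule order_tendstoD)
    qed
    have "\<forall>\<^sub>F x in at_right t. side_form z2 z3 (fb (of_real x)) < 0"
      using eventually_at_right_less[of t]
    proof eventually_elim
      case (elim x)
      obtain s where s: "s > 0" "fb (of_real x) = fb (of_real t) + of_real s * (z4 - z3)"
        by (rule fb_step[OF elim, of "z4 - z3"]) (use elim t in \<open>auto simp: dir_def\<close>)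
      then have "side_form z2 z3 (fb (of_real x)) = s * side_form z2 z3 z4" by (simp add: side_form_add L23)
      then show ?case using s(1) side_forms(3) by (simp add: mult_pos_neg)
    qed
    then have "\<forall>\<^sub>F x in at_right t. False"
      using ev[OF neg(1)] ev[OF neg(2)] ev[OF neg(3)]
    proof eventually_elim
      case (elim x)
      then show ?case using side_form_polygon_zero[OF fb_real_polygon[of x]] by linarith
    qed
    then show False by simp
  qed
  ultimately have "a = 1" by simp
  then show ?thesis using a(2) by simp
qed

text \<open>The unbounded intervals yield rays from z3 and from z1, both directed towards z4, and
  these meet only there.\<close>

lemma zinf_eq: "zinf = z4"
proof -
  obtain b where b: "b > 0" "zinf = z3 + of_real b * (z4 - z3)" by (rule ray_right[of t]) (use fb_t in auto)
  obtain e where e: "e > 0" "zinf = z1 + of_real e * (z4 - z1)" by (rule ray_left[of 0]) (use fb_0 in auto)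
  have "side_form z4 z1 zinf = 0" unfolding e(2) side_form_add by simp
  moreover have "side_form z4 z1 zinf = (1 - b) * side_form z4 z1 z3" unfolding b(2) side_form_add by (simp add: algebra_simps)
  ultimately have "b = 1" using side_forms(8) by simp
  then show ?thesis using b(2) by simp
qed


definition side_start :: "real \<Rightarrow> complex" where
  "side_start x = (if x < 0 then z4 else if x < 1 then z1 else if x < t then z2 else z3)"

lemma side_start_dir: "side_start x + dir x = (if x < 0 then z1 else if x < 1 then z2 else if x < t then z3 else z4)"
  by (simp add: side_start_def dir_def)

text \<open>The parameter is positive by the step from the start of the interval and below 1 by the
  step to its end. On an unbounded interval one of the steps is a ray ending in \<open>zinf\<close>,
  which is z4.\<close>

lemma fb_side:
  assumes "x \<notin> {0, 1, t}"
  shows "\<exists>s. 0 < s \<and> s < 1 \<and> fb (of_real x) = side_start x + of_real s * dir x"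
proof -
  have *: "\<exists>s. 0 < s \<and> s < 1 \<and> q = a + of_real s * d"
    if "s > 0" "q = a + of_real s * d" "s' > 0" "a + d = q + of_real s' * d" "d \<noteq> 0" for s s' :: real and q a d :: complex
  proof -
    have "(1 - of_real s - of_real s') * d = 0" using that(2,4) by (simp add: algebra_simps)
    then have "of_real (1 - s - s') = (0::complex)" using that(5) by simp
    then have "s < 1" using that(3) unfolding of_real_eq_0_iff by linarith
    then show ?thesis using that by blast
  qed
  have fin: "\<exists>s. 0 < s \<and> s < 1 \<and> fb (of_real x) = fb (of_real a) + of_real s * dir x"
    if "a < x" "x < b" and that': "\<And>y. a < y \<Longrightarrow> y < b \<Longrightarrow> y \<notin> {0, 1, t} \<and> dir y = dir x"
      and "fb (of_real a) + dir x = fb (of_real b)" for a b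
  proof -
    have "\<exists>s>0. fb (of_real x) = fb (of_real a) + of_real s * dir x"
    proof (rule fb_step[OF that(1), of "dir x"])
      show "y \<notin> {0, 1, t} \<and> dir y = dir x" if "a < y" "y < x" for y
        by (rule that') (use that \<open>x < b\<close> in auto)
    qed blast
    then obtain s where s: "s > 0" "fb (of_real x) = fb (of_real a) + of_real s * dir x" by blast
    have "\<exists>s>0. fb (of_real b) = fb (of_real x) + of_real s * dir x"
    proof (rule fb_step[OF that(2), of "dir x"])
      show "y \<notin> {0, 1, t} \<and> dir y = dir x" if "x < y" "y < b" for y
        by (rule that') (use that \<open>a < x\<close> in auto)
    qed blast
    then obtain s' where s': "s' > 0" "fb (of_real b) = fb (of_real x) + of_real s' * dir x" by blast
    show ?thesis by (rule *[OF s s'(1) _ dir_nonzero]) (use s'(2) that(4) in simp)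
  qed
  consider "x < 0" | "0 < x" "x < 1" | "1 < x" "x < t" | "t < x" using assms by fastforce
  then show ?thesis
  proof cases
    case 1
    have d: "dir x = z1 - z4" "side_start x = z4" using 1 by (auto simp: dir_def side_start_def)
    have "\<exists>s>0. fb (of_real 0) = fb (of_real x) + of_real s * dir x"
      by (rule fb_step[of x 0 "dir x"]) (use 1 t in \<open>auto simp: dir_def\<close>)
    then obtain s where s: "s > 0" "z1 = fb (of_real x) + of_real s * dir x" using fb_0 by auto
    obtain s' where s': "s' > 0" "z4 = fb (of_real x) + of_real s' * (z4 - z1)"
      by (rule ray_left[of x]) (use 1 zinf_eq in auto)
    have e1: "fb (of_real x) = z4 + of_real s' * dir x" using s'(2) by (simp add: d algebra_simps)
    have "z4 + dir x = fb (of_real x) + of_real s * dir x" using s(2) by (simp add: d)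
    from *[OF s'(1) e1 s(1) this dir_nonzero] show ?thesis unfolding d(2) .
  next
    case 2
    have d: "dir x = z2 - z1" "side_start x = z1" using 2 by (auto simp: dir_def side_start_def)
    show ?thesis using fin[of 0 1] 2 t d fb_0 fb_1_eq by (simp add: dir_def)
  next
    case 3
    have d: "dir x = z3 - z2" "side_start x = z2" using 3 by (auto simp: dir_def side_start_def)
    show ?thesis using fin[of 1 t] 3 t d fb_t fb_1_eq by (simp add: dir_def)
  next
    case 4
    have d: "dir x = z4 - z3" "side_start x = z3" using 4 t by (auto simp: dir_def side_start_def)
    have "\<exists>s>0. fb (of_real x) = fb (of_real t) + of_real s * dir x"
      by (rule fb_step[of t x "dir x"]) (use 4 t in \<open>auto simp: dir_def\<close>)
    then obtain s where s: "s > 0" "fb (of_real x) = z3 + of_real s * dir x" using fb_t by auto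
    obtain s' where s': "s' > 0" "z4 = fb (of_real x) + of_real s' * (z4 - z3)"
      by (rule ray_right[of x]) (use 4 zinf_eq in auto)
    have "z3 + dir x = fb (of_real x) + of_real s' * dir x" using s'(2) by (simp add: d)
    from *[OF s s'(1) this dir_nonzero] show ?thesis unfolding d(2) .
  qed
qed

lemma side_form_on_side:
  assumes "0 < s" "s < 1"
  shows "side_form p q (side_start x + of_real s * dir x) =
    (1 - s) * side_form p q (side_start x) + s * side_form p q (side_start x + dir x)"
proof -
  have "side_start x + of_real s * dir x = (1 - of_real s) * side_start x + of_real s * (side_start x + dir x)"
    by (simp add: algebra_simps)
  then show ?thesis by (simp only: side_form_affine)
qed

text \<open>The form of the side of \<open>x\<close> vanishes at the common image and is nonpositive
  at the vertices, so it vanishes at both ends of the side of \<open>y\<close>. Both points thus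
  belong to one interval, on which the image moves strictly forward.\<close>

lemma fb_real_inj:
  assumes x: "x \<notin> {0, 1, t}" and eq: "fb (of_real y) = fb (of_real x)"
  shows "y = x"
proof -
  define L where "L = side_form (side_start x) (side_start x + dir x)"
  obtain s where s: "0 < s" "s < 1" "fb (of_real x) = side_start x + of_real s * dir x" using fb_side[OF x] by blast
  have Lfb: "L (fb (of_real y)) = 0" unfolding eq s(3) L_def side_form_on_side[OF s(1,2)] by simp
  have L_vertex: "L z1 \<le> 0 \<and> L z2 \<le> 0 \<and> L z3 \<le> 0 \<and> L z4 \<le> 0"
    using side_forms unfolding L_def side_start_dir unfolding side_start_def by (auto intro: less_imp_le)
  have zero: "v \<in> {side_start x, side_start x + dir x}" if "L v = 0" "v \<in> {z1, z2, z3, z4}" for v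
    using that side_forms unfolding L_def side_start_dir unfolding side_start_def by (auto split: if_splits)
  have ne: "fb (of_real x) \<notin> {side_start x, side_start x + dir x}"
  proof -
    have "side_start x + of_real s * dir x \<noteq> side_start x" using s(1) dir_nonzero by simp
    moreover have "side_start x + of_real s * dir x \<noteq> side_start x + dir x"
    proof
      assume "side_start x + of_real s * dir x = side_start x + dir x"
      then have "(of_real s - 1) * dir x = 0" by (simp add: algebra_simps)
      then show False using s(2) dir_nonzero by simp
    qed
    ultimately show ?thesis using s(3) by simp
  qed
  have y: "y \<notin> {0, 1, t}"
  proof
    assume "y \<in> {0, 1, t}"
    then have "fb (of_real y) \<in> {z1, z2, z3, z4}" using fb_0 fb_1_eq fb_t by auto
    then show False using zero[OF Lfb] ne eq by simp
  qed
  obtain s' where s': "0 < s'" "s' < 1" "fb (of_real y) = side_start y + of_real s' * dir y" using fb_side[OF y] by blast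
  have "(1 - s') * L (side_start y) + s' * L (side_start y + dir y) = 0"
    using Lfb unfolding s'(3) L_def side_form_on_side[OF s'(1,2)] .
  moreover have vy: "side_start y \<in> {z1, z2, z3, z4}" "side_start y + dir y \<in> {z1, z2, z3, z4}"
    unfolding side_start_dir by (auto simp: side_start_def)
  moreover have "L (side_start y) \<le> 0" "L (side_start y + dir y) \<le> 0" using vy L_vertex by auto
  moreover from this have "(1 - s') * L (side_start y) \<le> 0" "s' * L (side_start y + dir y) \<le> 0"
    using s' by (auto intro: mult_nonneg_nonpos)
  ultimately have "(1 - s') * L (side_start y) = 0" "s' * L (side_start y + dir y) = 0" by linarith+
  then have L0: "L (side_start y) = 0" "L (side_start y + dir y) = 0" using s' by auto
  have same: "(x < 0 \<longleftrightarrow> y < 0) \<and> (x < 1 \<longleftrightarrow> y < 1) \<and> (x < t \<longleftrightarrow> y < t)"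
  proof -
    consider "x < 0" | "0 \<le> x" "x < 1" | "1 \<le> x" "x < t" | "t \<le> x" by linarith
    then show ?thesis
      by cases (use L0[unfolded L_def side_start_dir, unfolded side_start_def] t side_forms in
          \<open>auto split: if_splits\<close>)
  qed
  have step: False if "a < b" "fb (of_real a) = fb (of_real b)" "a \<notin> {0, 1, t}"
    "(a < 0 \<longleftrightarrow> b < 0) \<and> (a < 1 \<longleftrightarrow> b < 1) \<and> (a < t \<longleftrightarrow> b < t)" for a b
  proof -
    have "\<exists>s>0. fb (of_real b) = fb (of_real a) + of_real s * dir a"
      by (rule fb_step[OF that(1), of "dir a"]) (use that(3,4) in \<open>auto simp: dir_def\<close>)
    then show False using that(2) dir_nonzero by auto
  qed
  show ?thesis using step[of x y] step[of y x] same x y eq by (metis linorder_neqE_linordered_idom)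
qed

section \<open>Covering of the sides and continuity of the inverse at the boundary\<close>

lemma side_IVT:
  assumes "X < Y" and side: "\<And>x. X < x \<Longrightarrow> x < Y \<Longrightarrow> x \<notin> {0, 1, t} \<and> side_start x = A \<and> dir x = d"
    and \<tau>: "Re ((fb (of_real X) - A) / d) < \<tau>" "\<tau> < Re ((fb (of_real Y) - A) / d)"
  shows "\<exists>x. X < x \<and> x < Y \<and> fb (of_real x) = A + of_real \<tau> * d"
proof -
  have d: "d \<noteq> 0" using side[of "(X + Y) / 2"] assms(1) dir_nonzero[of "(X + Y) / 2"] by auto
  have "\<exists>x\<ge>X. x \<le> Y \<and> Re ((fb (of_real x) - A) / d) = \<tau>"
    by (rule IVT') (use \<tau> assms(1) d in \<open>auto intro!: continuous_intros fb_real_cont\<close>)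
  then obtain x where x: "X \<le> x" "x \<le> Y" "Re ((fb (of_real x) - A) / d) = \<tau>" by blast
  then have x': "X < x" "x < Y" using \<tau> by (auto simp: less_le)
  obtain s where "fb (of_real x) = A + of_real s * d" using fb_side[of x] side[OF x'] by auto
  then show ?thesis using x(3) x' d by auto
qed

text \<open>The intermediate value theorem for the parameter along the side. An unbounded interval
  is first cut off at a point whose image is close enough to z4.\<close>

lemma fb_onto_side:
  assumes "x0 \<notin> {0, 1, t}" "0 < \<tau>" "\<tau> < 1"
  shows "\<exists>x. x \<notin> {0, 1, t} \<and> side_start x = side_start x0 \<and> dir x = dir x0 \<and> (x < 0 \<longleftrightarrow> x0 < 0) \<and> (x < 1 \<longleftrightarrow> x0 < 1) \<and> (x < t \<longleftrightarrow> x0 < t)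
     \<and> fb (of_real x) = side_start x0 + of_real \<tau> * dir x0"
proof -
  have main: ?thesis
    if XY: "X < Y" "\<And>x. X < x \<Longrightarrow> x < Y \<Longrightarrow> x \<notin> {0, 1, t} \<and> (x < 0 \<longleftrightarrow> x0 < 0) \<and> (x < 1 \<longleftrightarrow> x0 < 1) \<and> (x < t \<longleftrightarrow> x0 < t)"
      "Re ((fb (of_real X) - side_start x0) / dir x0) < \<tau>" "\<tau> < Re ((fb (of_real Y) - side_start x0) / dir x0)" for X Y
  proof -
    have "x \<notin> {0, 1, t} \<and> side_start x = side_start x0 \<and> dir x = dir x0" if "X < x" "x < Y" for x
      using XY(2)[OF that] by (simp add: side_start_def dir_def)
    from side_IVT[OF XY(1) this XY(3,4)] this XY(2) show ?thesis by blast
  qed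
  have lim: "((\<lambda>x. Re ((fb (of_real x) - side_start x0) / dir x0)) \<longlongrightarrow> Re ((z4 - side_start x0) / dir x0)) G"
    if "((\<lambda>x. fb (of_real x)) \<longlongrightarrow> zinf) G" for G
    using that dir_nonzero[of x0] unfolding zinf_eq by (intro tendsto_intros) auto
  consider "x0 < 0" | "0 < x0" "x0 < 1" | "1 < x0" "x0 < t" | "t < x0" using assms by fastforce
  then show ?thesis
  proof cases
    case 1
    have d: "dir x0 = z1 - z4" "side_start x0 = z4" using 1 by (auto simp: dir_def side_start_def)
    have "\<forall>\<^sub>F x in at_bot. Re ((fb (of_real x) - side_start x0) / dir x0) < \<tau>"
      by (rule order_tendstoD(2)[OF lim[OF fb_at_bot]]) (use assms d in simp)
    from eventually_conj[OF eventually_gt_at_bot[of 0] this]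
    obtain X where "X < 0" "Re ((fb (of_real X) - side_start x0) / dir x0) < \<tau>"
      using eventually_happens'[OF trivial_limit_at_bot_linorder] by blast
    then show ?thesis using 1 t assms angle4(1) d fb_0 by (intro main[of X 0]) auto
  next
    case 2
    then have d: "dir x0 = z2 - z1" "side_start x0 = z1" by (auto simp: dir_def side_start_def)
    show ?thesis using 2 t assms angle1(1) d fb_0 fb_1_eq by (intro main[of 0 1]) auto
  next
    case 3
    then have d: "dir x0 = z3 - z2" "side_start x0 = z2" by (auto simp: dir_def side_start_def)
    show ?thesis using 3 t assms angle2(1) d fb_t fb_1_eq by (intro main[of 1 t]) auto
  next
    case 4
    then have d: "dir x0 = z4 - z3" "side_start x0 = z3" using t by (auto simp: dir_def side_start_def)
    have "\<forall>\<^sub>F x in at_top. \<tau> < Re ((fb (of_real x) - side_start x0) / dir x0)"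
      by (rule order_tendstoD(1)[OF lim[OF fb_at_top]]) (use assms d angle3(1) in simp)
    from eventually_conj[OF eventually_gt_at_top[of t] this]
    obtain Y where "t < Y" "\<tau> < Re ((fb (of_real Y) - side_start x0) / dir x0)"
      using eventually_happens'[OF trivial_limit_at_top_linorder] by blast
    then show ?thesis using 4 t assms angle3(1) d fb_t by (intro main[of t Y]) auto
  qed
qed

lemma open_segment_side:
  assumes "p \<in> open_segment (side_start x0) (side_start x0 + dir x0)" "x0 \<notin> {0, 1, t}"
  obtains x where "x \<notin> {0, 1, t}" "dir x = dir x0" "x < 0 \<longleftrightarrow> x0 < 0" "x < 1 \<longleftrightarrow> x0 < 1" "x < t \<longleftrightarrow> x0 < t" "fb (of_real x) = p"
proof -
  obtain \<tau> where \<tau>: "0 < \<tau>" "\<tau> < 1" "p = (1 - \<tau>) *\<^sub>R side_start x0 + \<tau> *\<^sub>R (side_start x0 + dir x0)"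
    using assms(1) by (auto simp: in_segment)
  then have "p = side_start x0 + of_real \<tau> * dir x0" by (simp add: scaleR_conv_of_real algebra_simps)
  then show ?thesis using fb_onto_side[OF assms(2) \<tau>(1,2)] that by auto
qed

lemma fb_pole: "filterlim fb at_infinity (at z0)"
  by (rule conformal_pole[OF conf open_upper_half_plane]) (use z0 f_z0 fb_upper in auto)

text \<open>A compactness argument: preimages of points near \<open>p\<close> cannot approach the
  pole, where \<open>fb\<close> is large, nor infinity, where \<open>fb\<close> is near z4. On the
  compact rest outside a disc about \<open>x0\<close>, the value \<open>p\<close> is not
  attained.\<close>

lemma inverse_tendsto:
  assumes x0: "x0 \<notin> {0, 1, t}"
  shows "filterlim (\<lambda>w. inv_into upper_half_plane f (Some w)) (at (of_real x0) within upper_half_plane)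
    (at (fb (of_real x0)) within Some -` D)"
  unfolding filterlim_at
proof
  define p where "p = fb (of_real x0)"
  have inv: "0 < Im (inv_into upper_half_plane f (Some w)) \<and> inv_into upper_half_plane f (Some w) \<noteq> z0 \<and>
      fb (inv_into upper_half_plane f (Some w)) = w" if w: "w \<in> Some -` D" for w
  proof -
    have "inv_into upper_half_plane f (Some w) \<in> upper_half_plane" "f (inv_into upper_half_plane f (Some w)) = Some w"
      using w bij_f by (auto simp only: bij_betw_def vimage_eq intro!: inv_into_into f_inv_into_f)
    then show ?thesis using f_z0 fb_upper by (metis mem_upper_half_plane option.distinct(1) option.inject)
  qed
  show "\<forall>\<^sub>F w in at (fb (of_real x0)) within Some -` D. inv_into upper_half_plane f (Some w) \<in> upper_half_plane \<and>
      inv_into upper_half_plane f (Some w) \<noteq> of_real x0"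
    unfolding eventually_at_filter using inv by (intro always_eventually) (metis Im_complex_of_real less_irrefl mem_upper_half_plane)
  \<comment> \<open>z4 is the image of infinity; that \<open>p\<close> differs from it keeps the
    preimages bounded.\<close>
  have p_ne: "p \<noteq> z4"
  proof
    assume p4: "p = z4"
    obtain s where s: "0 < s" "s < 1" "p = side_start x0 + of_real s * dir x0" using fb_side[OF x0] by (auto simp: p_def)
    consider "x0 < 0" | "0 \<le> x0" "x0 < 1" | "1 \<le> x0" "x0 < t" | "t \<le> x0" by linarith
    then show False
    proof cases
      case 1
      then have "of_real s * (z1 - z4) = 0" using s(3) p4 by (simp add: side_start_def dir_def)
      then show False using s angle4(1) by simp
    next
      case 2
      then have "side_form z1 z2 p = 0" unfolding s(3) by (simp add: side_start_def dir_def side_form_add)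
      then show False using side_forms(2) p4 by simp
    next
      case 3
      then have "side_form z2 z3 p = 0" unfolding s(3) by (simp add: side_start_def dir_def side_form_add)
      then show False using side_forms(3) p4 by simp
    next
      case 4
      then have "(1 - of_real s) * (z4 - z3) = 0" using s(3) p4 t by (simp add: side_start_def dir_def algebra_simps)
      then show False using s angle3(1) by simp
    qed
  qed
  show "((\<lambda>w. inv_into upper_half_plane f (Some w)) \<longlongrightarrow> of_real x0) (at (fb (of_real x0)) within Some -` D)"
    unfolding p_def[symmetric]
  proof (rule tendstoI)
    fix e :: real assume e: "e > 0"
    define e1 where "e1 = norm (p - z4) / 2"
    have e1: "e1 > 0" using p_ne by (simp add: e1_def)
    obtain R where R: "\<And>z. 0 \<le> Im z \<Longrightarrow> R < norm z \<Longrightarrow> norm (fb z - z4) \<le> e1"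
      using zinf[OF e1] unfolding zinf_eq by blast
    have "\<forall>\<^sub>F z in at z0. norm p + 1 \<le> norm (fb z)"
      using fb_pole by (rule eventually_compose_filterlim[rotated]) (auto simp: eventually_at_infinity)
    then obtain \<delta>0 where \<delta>0: "\<delta>0 > 0" "\<And>z. z \<noteq> z0 \<Longrightarrow> dist z z0 < \<delta>0 \<Longrightarrow> norm p + 1 \<le> norm (fb z)"
      unfolding eventually_at by auto
    \<comment> \<open>What is left after removing neighbourhoods of infinity, of the pole and of
      \<open>x0\<close>. Its image is compact and misses \<open>p\<close>, hence has positive
      distance from it.\<close>
    define K where "K = (cball 0 R \<inter> {z. 0 \<le> Im z}) - ball (of_real x0) e - ball z0 \<delta>0"
    have "compact K"
      unfolding K_def by (intro compact_diff compact_Int_closed compact_cball closed_halfspace_Im_ge open_ball)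
    moreover have "K \<subseteq> {z. 0 \<le> Im z} - {z0}" using \<delta>0(1) by (auto simp: K_def)
    ultimately have "compact (fb ` K)" using compact_continuous_image continuous_on_subset[OF fb_cont] by blast
    moreover have "p \<notin> fb ` K"
    proof
      assume "p \<in> fb ` K"
      then obtain z where z: "z \<in> K" "fb z = p" by blast
      then have "0 \<le> Im z" "z \<noteq> z0" using \<open>K \<subseteq> _\<close> by auto
      show False
      proof (cases "Im z = 0")
        case True
        then have zr: "z = of_real (Re z)" by (simp add: complex_eq_iff)
        then have "fb (of_real (Re z)) = fb (of_real x0)" using z(2) by (simp add: p_def)
        then have "Re z = x0" by (rule fb_real_inj[OF x0])
        then show False using zr z(1) e by (simp add: K_def)
      next
        case False
        then have "0 < Im z" using \<open>0 \<le> Im z\<close> by simp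
        then have "f z = Some p" "f z \<in> D"
          using \<open>z \<noteq> z0\<close> z(2) fb_upper[of z] bij_betwE[OF bij_f] by (blast, meson mem_upper_half_plane)
        then show False using fb_real_notin[of x0] by (simp add: p_def)
      qed
    qed
    ultimately obtain d where d: "d > 0" "\<And>q. q \<in> fb ` K \<Longrightarrow> d \<le> dist p q"
      using separate_point_closed compact_imp_closed by metis
    have "\<forall>\<^sub>F w in at p within Some -` D. dist w p < min d (min e1 1)"
      unfolding eventually_at using d(1) e1 by (intro exI[of _ "min d (min e1 1)"]) auto
    moreover have "\<forall>\<^sub>F w in at p within Some -` D. w \<in> Some -` D" by (simp add: eventually_at_filter)
    ultimately show "\<forall>\<^sub>F w in at p within Some -` D. dist (inv_into upper_half_plane f (Some w)) (of_real x0) < e"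
    proof eventually_elim
      case (elim w)
      define z where "z = inv_into upper_half_plane f (Some w)"
      have z: "0 < Im z" "z \<noteq> z0" "fb z = w" using inv[OF elim(2)] by (auto simp: z_def)
      have "z \<notin> K" using d(2)[of w] z(3) elim(1) by (force simp: dist_commute)
      moreover have "norm z \<le> R"
      proof (rule ccontr)
        assume "\<not> norm z \<le> R"
        then have "norm (w - z4) \<le> e1" using R[of z] z by simp
        moreover have "norm (p - z4) \<le> norm (p - w) + norm (w - z4)" by (metis diff_add_cancel add_diff_eq norm_triangle_ineq)
        moreover have "norm (p - w) < e1" using elim(1) by (simp add: dist_norm norm_minus_commute)
        ultimately show False by (simp add: e1_def)
      qed
      moreover have "z \<notin> ball z0 \<delta>0"
      proof
        assume "z \<in> ball z0 \<delta>0"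
        then have "norm p + 1 \<le> norm w" using \<delta>0(2)[OF z(2)] z(3) by (simp add: dist_commute)
        moreover have "norm w \<le> norm p + norm (w - p)" by (metis add_diff_cancel_left' diff_add_cancel norm_triangle_ineq add.commute)
        ultimately show False using elim(1) by (simp add: dist_norm)
      qed
      ultimately have "z \<in> ball (of_real x0) e" using z(1) by (auto simp: K_def)
      then show ?case by (simp add: z_def dist_commute)
    qed
  qed
qed

end

section \<open>The mixed boundary value problem\<close>

lemma elliptic_primitive_exists:
  assumes "0 < r" "r < 1"
  obtains P where "elliptic_primitive r P"
proof -
  obtain P where "P 0 = 0" "\<And>z. z \<in> F_strip r \<Longrightarrow> (P has_field_derivative F_integrand r z) (at z within F_strip r)"
    by (rule F_primitive[OF assms]) blast
  then show ?thesis using that[of P] assms by (simp add: elliptic_primitive_def)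
qed

text \<open>\<open>Im H\<close> is not bounded, so Cauchy's estimate is applied to the exponential,
  whose modulus lies between 1 and e; the lower bound permits dividing by it again. The radius is
  half the distance to the axis, whence the factor 2.\<close>

lemma deriv_bound_of_Re_bounds:
  assumes H: "H holomorphic_on upper_half_plane"
    and bd: "\<And>z. 0 < Im z \<Longrightarrow> 0 < Re (H z) \<and> Re (H z) < 1" and z: "0 < Im z"
  shows "norm (deriv H z) \<le> 2 * exp 1 / Im z"
proof -
  define E where "E = (\<lambda>z. exp (H z))"
  have E: "E holomorphic_on upper_half_plane" unfolding E_def by (intro holomorphic_intros H)
  have sub: "cball z (Im z / 2) \<subseteq> upper_half_plane"
  proof
    fix w assume "w \<in> cball z (Im z / 2)"
    then have "\<bar>Im z - Im w\<bar> \<le> Im z / 2" using abs_Im_le_cmod[of "z - w"] by (simp add: dist_norm)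
    then have "Im z - Im w \<le> Im z / 2" by linarith
    then show "w \<in> upper_half_plane" using z by simp
  qed
  have "norm ((deriv ^^ 1) E z) \<le> fact 1 * exp 1 / (Im z / 2) ^ 1"
  proof (rule Cauchy_inequality)
    have "E holomorphic_on cball z (Im z / 2)" by (rule holomorphic_on_subset[OF E sub])
    then show "E holomorphic_on ball z (Im z / 2)" "continuous_on (cball z (Im z / 2)) E"
      using ball_subset_cball by (blast intro: holomorphic_on_subset holomorphic_on_imp_continuous_on)+
    fix x assume "norm (z - x) = Im z / 2"
    then have "x \<in> cball z (Im z / 2)" by (simp add: dist_norm)
    then have "Re (H x) < 1" using sub bd by auto
    then show "norm (E x) \<le> exp 1" by (simp add: E_def)
  qed (use z in auto)
  then have "norm (deriv E z) \<le> 2 * exp 1 / Im z" by (simp add: mult.commute)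
  moreover have "(E has_field_derivative exp (H z) * deriv H z) (at z)"
    unfolding E_def using holomorphic_derivI[OF H open_upper_half_plane, of z] z by (auto intro!: derivative_eq_intros)
  ultimately have "norm (exp (H z) * deriv H z) \<le> 2 * exp 1 / Im z" using DERIV_imp_deriv by metis
  moreover have "1 * norm (deriv H z) \<le> norm (exp (H z) * deriv H z)"
    unfolding norm_mult using bd[OF z] by (intro mult_right_mono) auto
  ultimately show ?thesis by simp
qed

section \<open>Existence and uniqueness of the potential function\<close>

locale sc_final = sc_quad \<alpha> \<beta> \<gamma> t z0 C z1 f D z2 z3 z4 \<delta>
  for \<alpha> \<beta> \<gamma> t :: real and z0 C z1 :: complex and f :: "complex \<Rightarrow> complex option"
    and D :: "complex option set" and z2 z3 z4 :: complex and \<delta> :: real +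
  fixes r :: real
  assumes r01: "0 < r" "r < 1" and t_eq: "t = 1 / r\<^sup>2"
begin

abbreviation "finv \<equiv> inv_into upper_half_plane f"

lemma finv: "w \<in> D \<Longrightarrow> 0 < Im (finv w) \<and> f (finv w) = w"
proof -
  assume "w \<in> D"
  then have "w \<in> f ` upper_half_plane" using bij_f by (simp add: bij_betw_def)
  then show ?thesis using inv_into_into[of w f upper_half_plane] f_inv_into_f[of w f upper_half_plane] by simp
qed

lemma finv_Some: "w \<in> Some -` D \<Longrightarrow> finv (Some w) \<noteq> z0 \<and> fb (finv (Some w)) = w"
  using finv[of "Some w"] fb_upper[of "finv (Some w)"] f_z0 by (metis option.distinct(1) option.inject vimageD)

lemma finv_Some_deriv:
  assumes w: "w \<in> Some -` D"
  shows "((\<lambda>w. finv (Some w)) has_field_derivative 1 / (C * g (finv (Some w)))) (at w)"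
proof -
  have op: "open (Some -` D)" by (rule open_Some_vimage[OF openD])
  have hol: "(\<lambda>w. finv (Some w)) holomorphic_on Some -` D"
    by (rule inverse_conformal_holomorphic[OF conf open_upper_half_plane openD]) simp
  define k where "k = deriv (\<lambda>w. finv (Some w)) w"
  have dk: "((\<lambda>w. finv (Some w)) has_field_derivative k) (at w)"
    unfolding k_def by (rule holomorphic_derivI[OF hol op w])
  have up: "0 < Im (finv (Some w))" "finv (Some w) \<noteq> z0" using finv[of "Some w"] finv_Some[OF w] w by auto
  have "((\<lambda>w. fb (finv (Some w))) has_field_derivative C * g (finv (Some w)) * k) (at w)"
    by (rule DERIV_chain2[OF fb_deriv[OF up] dk])
  then have "((\<lambda>w. w) has_field_derivative C * g (finv (Some w)) * k) (at w)"
    by (rule has_field_derivative_transform_within_open[OF _ op w]) (simp add: finv_Some)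
  then have "C * g (finv (Some w)) * k = 1" using DERIV_unique DERIV_ident by blast
  then have "k = 1 / (C * g (finv (Some w)))" using g_nonzero[OF up] C_nonzero by (simp add: field_simps)
  then show ?thesis using dk by simp
qed

text \<open>One sample point in each of the four intervals, for naming the sides by their
  vertices.\<close>

lemma side_values:
  "side_start (-1) = z4" "side_start (-1) + dir (-1) = z1"
  "side_start (1/2) = z1" "side_start (1/2) + dir (1/2) = z2" "dir (1/2) = z2 - z1"
  "side_start ((1 + t) / 2) = z2" "side_start ((1 + t) / 2) + dir ((1 + t) / 2) = z3"
  "side_start (t + 1) = z3" "side_start (t + 1) + dir (t + 1) = z4" "dir (t + 1) = z4 - z3"
  using t by (auto simp: side_start_def dir_def)

lemma psi_holomorphic: "psi r holomorphic_on upper_half_plane"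
proof -
  obtain P where "elliptic_primitive r P" by (rule elliptic_primitive_exists[OF r01])
  then interpret E: elliptic_primitive r P .
  show ?thesis
    unfolding holomorphic_on_open[OF open_upper_half_plane]
    using E.psi_has_field_derivative by (meson mem_upper_half_plane)
qed

lemma g_within_upper: "(g \<longlongrightarrow> g (of_real x)) (at (of_real x) within upper_half_plane)"
proof -
  have "of_real x \<in> {z. 0 \<le> Im z} - {z0}" using z0 by auto
  then have "(g \<longlongrightarrow> g (of_real x)) (at (of_real x) within {z. 0 \<le> Im z} - {z0})"
    using g_cont by (simp add: continuous_on_def)
  then have "(g \<longlongrightarrow> g (of_real x)) (at (of_real x) within upper_half_plane - {z0})"
    by (rule tendsto_within_subset) auto
  moreover have "at (of_real x) within upper_half_plane - {z0} = at (of_real x) within upper_half_plane"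
    by (rule at_within_nhd[of _ "- {z0}"]) (use z0 in auto)
  ultimately show ?thesis by simp
qed

text \<open>Continuity of the inverse of \<open>f\<close> at the sides carries over the boundary
  values of \<open>psi\<close>. For the normal derivative the chain rule adds the derivative of that
  inverse, whose argument is constant along a side.\<close>

lemma potential_of_psi:
  assumes u: "\<And>w. w \<in> D \<Longrightarrow> u w = Re (psi r (finv w))"
  shows "potential_function D z1 z2 z3 z4 u"
proof -
  obtain P where "elliptic_primitive r P" by (rule elliptic_primitive_exists[OF r01])
  then interpret E: elliptic_primitive r P .
  have dirichlet: "((\<lambda>z. u (Some z)) \<longlongrightarrow> l) (at (fb (of_real x)) within Some -` D)"
    if "x \<notin> {0, 1, t}" "((\<lambda>z. Re (psi r z)) \<longlongrightarrow> l) (at (of_real x) within upper_half_plane)" for x l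
  proof (rule Lim_transform_eventually)
    show "((\<lambda>z. Re (psi r (finv (Some z)))) \<longlongrightarrow> l) (at (fb (of_real x)) within Some -` D)"
      by (rule filterlim_compose[OF that(2) inverse_tendsto[OF that(1)]])
    show "\<forall>\<^sub>F z in at (fb (of_real x)) within Some -` D. Re (psi r (finv (Some z))) = u (Some z)"
      using u by (simp add: eventually_at_filter)
  qed
  have neumann: "((\<lambda>z. frechet_derivative (\<lambda>z. u (Some z)) (at z) (\<i> * (b - a))) \<longlongrightarrow> 0) (at (fb (of_real x)) within Some -` D)"
    if x: "x \<notin> {0, 1, t}" "0 < x" "x < 1 \<or> t < x" and d: "dir x = b - a" for x a b
  proof -
    obtain c where c: "(psi_deriv r \<longlongrightarrow> of_real c) (at (of_real x) within upper_half_plane)"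
      using E.psi_deriv_tendsto[OF x(2)] x(3) t_eq by blast
    obtain k where k: "k > 0" "C * g (of_real x) = of_real k * (b - a)" using fb'_dir[OF x(1)] d by metis
    have ba: "b - a \<noteq> 0" using d dir_nonzero[of x] by auto
    have "((\<lambda>\<zeta>. Re (psi_deriv r \<zeta> / (C * g \<zeta>) * (\<i> * (b - a)))) \<longlongrightarrow> Re (of_real c / (C * g (of_real x)) * (\<i> * (b - a))))
        (at (of_real x) within upper_half_plane)"
      using k ba by (intro tendsto_intros c g_within_upper) auto
    \<comment> \<open>\<open>C * g x\<close> is a positive multiple of \<open>b - a\<close> and
      \<open>c\<close> is real, so only the factor i remains besides a real number.\<close>
    moreover have "of_real c / (C * g (of_real x)) * (\<i> * (b - a)) = of_real (c / k) * \<i>"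
      unfolding k(2) using k(1) ba by (simp add: field_simps)
    then have "Re (of_real c / (C * g (of_real x)) * (\<i> * (b - a))) = 0" by simp
    ultimately have lim: "((\<lambda>\<zeta>. Re (psi_deriv r \<zeta> / (C * g \<zeta>) * (\<i> * (b - a)))) \<longlongrightarrow> 0) (at (of_real x) within upper_half_plane)"
      by simp
    show ?thesis
    proof (rule Lim_transform_eventually)
      show "((\<lambda>z. Re (psi_deriv r (finv (Some z)) / (C * g (finv (Some z))) * (\<i> * (b - a)))) \<longlongrightarrow> 0)
          (at (fb (of_real x)) within Some -` D)"
        by (rule filterlim_compose[OF lim inverse_tendsto[OF x(1)]])
      show "\<forall>\<^sub>F z in at (fb (of_real x)) within Some -` D.
          Re (psi_deriv r (finv (Some z)) / (C * g (finv (Some z))) * (\<i> * (b - a))) =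
          frechet_derivative (\<lambda>z. u (Some z)) (at z) (\<i> * (b - a))"
        unfolding eventually_at_filter
      proof (intro always_eventually allI impI)
        fix w assume w: "w \<in> Some -` D"
        let ?D = "psi_deriv r (finv (Some w)) * (1 / (C * g (finv (Some w))))"
        have "((\<lambda>w. psi r (finv (Some w))) has_field_derivative ?D) (at w)"
          by (rule DERIV_chain2[OF E.psi_has_field_derivative finv_Some_deriv[OF w]]) (use finv w in auto)
        then have "((\<lambda>w. Re (psi r (finv (Some w)))) has_derivative (\<lambda>h. Re (?D * h))) (at w)"
          by (rule has_derivative_Re_holomorphic)
        then have "((\<lambda>w. u (Some w)) has_derivative (\<lambda>h. Re (?D * h))) (at w)"
          by (rule has_derivative_transform_within_open[OF _ open_Some_vimage[OF openD] w]) (use u in auto)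
        from frechet_derivative_at[OF this]
        show "Re (psi_deriv r (finv (Some w)) / (C * g (finv (Some w))) * (\<i> * (b - a))) =
          frechet_derivative (\<lambda>z. u (Some z)) (at w) (\<i> * (b - a))"
          by (metis (no_types, lifting) divide_inverse inverse_eq_divide)
      qed
    qed
  qed
  have "harmonic_sphere u D"
    by (rule harmonic_sphere_Re_inverse_conformal[OF conf open_upper_half_plane openD psi_holomorphic u])
  moreover have "0 < u w \<and> u w < 1" if "w \<in> D" for w
    using E.psi_bounds[of "finv w"] finv[OF that] u[OF that] by simp
  moreover have "((\<lambda>z. u (Some z)) \<longlongrightarrow> 0) (at p within Some -` D)" if p: "p \<in> open_segment z4 z1" for p
  proof -
    obtain x where x: "x \<notin> {0, 1, t}" "x < 0" "fb (of_real x) = p"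
      by (rule open_segment_side[of p "-1"]) (use p side_values t in auto)
    show ?thesis using dirichlet[OF x(1) E.psi_tendsto_0[OF x(2)]] x(3) by simp
  qed
  moreover have "((\<lambda>z. u (Some z)) \<longlongrightarrow> 1) (at p within Some -` D)" if p: "p \<in> open_segment z2 z3" for p
  proof -
    obtain x where x: "x \<notin> {0, 1, t}" "1 \<le> x" "x < t" "fb (of_real x) = p"
      by (rule open_segment_side[of p "(1 + t) / 2"]) (use p side_values t in auto)
    then have "1 < x" "x < 1 / r\<^sup>2" using t_eq by auto
    then show ?thesis using dirichlet[OF x(1) E.psi_tendsto_1] x(4) by simp
  qed
  moreover have "((\<lambda>z. frechet_derivative (\<lambda>z. u (Some z)) (at z) (\<i> * (z2 - z1))) \<longlongrightarrow> 0) (at p within Some -` D)"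
    if p: "p \<in> open_segment z1 z2" for p
  proof -
    obtain x where x: "x \<notin> {0, 1, t}" "dir x = z2 - z1" "0 \<le> x" "x < 1" "fb (of_real x) = p"
      by (rule open_segment_side[of p "1/2"]) (use p side_values t in auto)
    then show ?thesis using neumann[of x z2 z1] by auto
  qed
  moreover have "((\<lambda>z. frechet_derivative (\<lambda>z. u (Some z)) (at z) (\<i> * (z4 - z3))) \<longlongrightarrow> 0) (at p within Some -` D)"
    if p: "p \<in> open_segment z3 z4" for p
  proof -
    obtain x where x: "x \<notin> {0, 1, t}" "dir x = z4 - z3" "t \<le> x" "fb (of_real x) = p"
      by (rule open_segment_side[of p "t + 1"]) (use p side_values t in auto)
    then show ?thesis using neumann[of x z4 z3] t by auto
  qed
  ultimately show ?thesis unfolding potential_function_def by auto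
qed


text \<open>The converse of \<open>inverse_tendsto\<close>: it carries conditions on
  \<open>u\<close> at the sides over to the half plane.\<close>

lemma fb_filterlim: "filterlim fb (at (fb (of_real x)) within Some -` D) (at (of_real x) within upper_half_plane)"
  unfolding filterlim_at
proof
  show "(fb \<longlongrightarrow> fb (of_real x)) (at (of_real x) within upper_half_plane)" by (rule fb_within_upper)
  have "fb z \<in> Some -` D \<and> fb z \<noteq> fb (of_real x)" if z: "0 < Im z" "Im z < Im z0" for z
  proof -
    have "f z = Some (fb z)" using z by (intro fb_upper) auto
    then have "Some (fb z) \<in> D" using bij_betwE[OF bij_f] z(1) by (metis mem_upper_half_plane)
    then show ?thesis using fb_real_notin[of x] by auto
  qed
  then show "\<forall>\<^sub>F z in at (of_real x) within upper_half_plane. fb z \<in> Some -` D \<and> fb z \<noteq> fb (of_real x)"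
    using eventually_upper[OF z0, of x] by (auto elim: eventually_mono)
qed

lemma fb_open_segment:
  assumes x: "x \<notin> {0, 1, t}"
  shows "fb (of_real x) \<in> open_segment (side_start x) (side_start x + dir x)"
proof -
  obtain s where s: "0 < s" "s < 1" "fb (of_real x) = side_start x + of_real s * dir x" using fb_side[OF x] by blast
  have "side_start x \<noteq> side_start x + dir x" using dir_nonzero[of x] by auto
  moreover have "side_start x + of_real s * dir x = (1 - s) *\<^sub>R side_start x + s *\<^sub>R (side_start x + dir x)"
    by (simp add: scaleR_conv_of_real algebra_simps)
  ultimately show ?thesis using s unfolding in_segment by auto
qed

lemma psi_of_potential:
  assumes pot: "potential_function D z1 z2 z3 z4 u" and w: "w \<in> D"
  shows "u w = Re (psi r (finv w))"
proof -
  obtain P where "elliptic_primitive r P" by (rule elliptic_primitive_exists[OF r01])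
  then interpret E: elliptic_primitive r P .
  have harm: "harmonic_sphere u D" and u01: "\<And>w. w \<in> D \<Longrightarrow> 0 < u w \<and> u w < 1"
    and d0: "\<And>p. p \<in> open_segment z4 z1 \<Longrightarrow> ((\<lambda>z. u (Some z)) \<longlongrightarrow> 0) (at p within Some -` D)"
    and d1: "\<And>p. p \<in> open_segment z2 z3 \<Longrightarrow> ((\<lambda>z. u (Some z)) \<longlongrightarrow> 1) (at p within Some -` D)"
    and n1: "\<And>p. p \<in> open_segment z1 z2 \<Longrightarrow>
      ((\<lambda>z. frechet_derivative (\<lambda>z. u (Some z)) (at z) (\<i> * (z2 - z1))) \<longlongrightarrow> 0) (at p within Some -` D)"
    and n2: "\<And>p. p \<in> open_segment z3 z4 \<Longrightarrow>
      ((\<lambda>z. frechet_derivative (\<lambda>z. u (Some z)) (at z) (\<i> * (z4 - z3))) \<longlongrightarrow> 0) (at p within Some -` D)"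
    using pot unfolding potential_function_def by auto
  obtain H where H: "H holomorphic_on upper_half_plane" "\<And>z. z \<in> upper_half_plane \<Longrightarrow> u (f z) = Re (H z)"
    "\<And>z. z \<in> upper_half_plane \<Longrightarrow> ((\<lambda>z. u (f z)) has_derivative (\<lambda>h. Re (deriv H z * h))) (at z)"
    by (rule harmonic_sphere_compose_conformal[OF conf open_upper_half_plane convex_upper_half_plane openD harm]) blast
  define h where "h = deriv H"
  have holh: "h holomorphic_on upper_half_plane" unfolding h_def using H(1) by (rule holomorphic_deriv) auto
  have dH: "(H has_field_derivative h z) (at z)" if "0 < Im z" for z
    unfolding h_def by (rule holomorphic_derivI[OF H(1)]) (use that in auto)
  have H01: "0 < Re (H z) \<and> Re (H z) < 1" if "0 < Im z" for z
    using u01[of "f z"] H(2)[of z] bij_betwE[OF bij_f] that by auto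
  have ufb: "u (Some (fb z)) = Re (H z)" if "0 < Im z" "z \<noteq> z0" for z
    using fb_upper[OF that] H(2)[of z] that by simp
  have dirichlet: "((\<lambda>z. Re (H z)) \<longlongrightarrow> l) (at (of_real x) within upper_half_plane)"
    if "((\<lambda>z. u (Some z)) \<longlongrightarrow> l) (at (fb (of_real x)) within Some -` D)" for x l
  proof (rule Lim_transform_eventually)
    show "((\<lambda>z. u (Some (fb z))) \<longlongrightarrow> l) (at (of_real x) within upper_half_plane)"
      by (rule filterlim_compose[OF that fb_filterlim])
    show "\<forall>\<^sub>F z in at (of_real x) within upper_half_plane. u (Some (fb z)) = Re (H z)"
      using eventually_upper[OF z0, of x] by eventually_elim (auto intro!: ufb)
  qed
  have lim0: "((\<lambda>z. Re (H z)) \<longlongrightarrow> 0) (at (of_real x) within upper_half_plane)" if x: "x < 0" for x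
  proof -
    have "fb (of_real x) \<in> open_segment z4 z1"
      using fb_open_segment[of x] x t by (auto simp: side_start_dir) (auto simp: side_start_def)
    then show ?thesis by (intro dirichlet d0)
  qed
  have lim1: "((\<lambda>z. Re (H z)) \<longlongrightarrow> 1) (at (of_real x) within upper_half_plane)" if x: "1 < x" "x < t" for x
  proof -
    have "fb (of_real x) \<in> open_segment z2 z3"
      using fb_open_segment[of x] x by (auto simp: side_start_dir) (auto simp: side_start_def)
    then show ?thesis by (intro dirichlet d1)
  qed
  have ext: "\<exists>\<rho>>0. \<exists>N. continuous_on (ball (of_real x) \<rho> \<inter> {z. 0 \<le> Im z}) N \<and>
        (\<forall>z\<in>ball (of_real x) \<rho>. Im z > 0 \<longrightarrow> N z = h z) \<and>
        Im ((N (of_real x))\<^sup>2) = 0 \<and> 0 \<le> Re ((N (of_real x))\<^sup>2) * (x * (x - 1) * (x - t))"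
    if x: "x \<notin> {0, 1, t}" for x
  proof -
    \<comment> \<open>Within this distance of \<open>x\<close> no exceptional point is met, so a
      single boundary condition holds throughout.\<close>
    define R where "R = min \<bar>x\<bar> (min \<bar>x - 1\<bar> \<bar>x - t\<bar>)"
    have R: "R > 0" using x by (auto simp: R_def)
    have same: "y \<notin> {0, 1, t} \<and> (y < 0 \<longleftrightarrow> x < 0) \<and> (y < 1 \<longleftrightarrow> x < 1) \<and> (y < t \<longleftrightarrow> x < t)" if "\<bar>y - x\<bar> < R" for y
      using that by (auto simp: R_def)
    show ?thesis
    proof (cases "x < 0 \<or> 1 < x \<and> x < t")
      case True
      txt \<open>On a Dirichlet interval \<open>\<i> * (H - l)\<close> is reflected, and \<open>h\<close> becomes purely imaginary.\<close>
      define l :: real where "l = (if x < 0 then 0 else 1)"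
      define m where "m = (\<lambda>z. \<i> * (H z - of_real l))"
      have holm: "m holomorphic_on upper_half_plane" unfolding m_def by (intro holomorphic_intros H)
      have "((\<lambda>z. Im (m z)) \<longlongrightarrow> 0) (at (of_real y) within upper_half_plane)" if y: "\<bar>y - x\<bar> < R" for y
      proof -
        have "((\<lambda>z. Re (H z)) \<longlongrightarrow> l) (at (of_real y) within upper_half_plane)"
          using lim0[of y] lim1[of y] same[OF y] True by (auto simp: l_def not_less le_less)
        then have "((\<lambda>z. Re (H z) - l) \<longlongrightarrow> l - l) (at (of_real y) within upper_half_plane)" by (intro tendsto_intros)
        then show ?thesis by (simp add: m_def)
      qed
      then have "\<exists>N \<rho>. \<rho> > 0 \<and> \<rho> \<le> R \<and> N holomorphic_on ball (of_real x) \<rho> \<and>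
          (\<forall>z\<in>ball (of_real x) \<rho>. Im z > 0 \<longrightarrow> N z = m z) \<and>
          (\<forall>y. of_real y \<in> ball (of_real x :: complex) \<rho> \<longrightarrow> Im (N (of_real y)) = 0)"
        by (rule schwarz_reflection_Im[OF R holm, of x]) blast+
      then obtain N \<rho> where N: "\<rho> > 0" "\<rho> \<le> R" "N holomorphic_on ball (of_real x) \<rho>"
        "\<And>z. z \<in> ball (of_real x) \<rho> \<Longrightarrow> Im z > 0 \<Longrightarrow> N z = m z"
        "\<And>y. of_real y \<in> ball (of_real x :: complex) \<rho> \<Longrightarrow> Im (N (of_real y)) = 0"
        by blast
      have holN': "(\<lambda>z. - \<i> * deriv N z) holomorphic_on ball (of_real x) \<rho>"
        by (intro holomorphic_intros holomorphic_deriv N(3)) auto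
      have im: "Im (deriv N (of_real x)) = 0" by (rule deriv_in_Reals[OF N(3)]) (use N in auto)
      have eq: "- \<i> * deriv N z = h z" if z: "z \<in> ball (of_real x) \<rho>" "0 < Im z" for z
      proof -
        have "(m has_field_derivative \<i> * h z) (at z)"
          unfolding m_def using dH[OF z(2)] by (auto intro!: derivative_eq_intros)
        then have "(N has_field_derivative \<i> * h z) (at z)"
          by (rule has_field_derivative_transform_within_open[of _ _ _ "ball (of_real x) \<rho> \<inter> upper_half_plane"])
            (use z N(4) in auto)
        then have "deriv N z = \<i> * h z" by (rule DERIV_imp_deriv)
        then show ?thesis by simp
      qed
      \<comment> \<open>On the Dirichlet intervals the cubic is nonpositive, which matches the
        negative square of an imaginary value.\<close>
      have sgn: "x * (x - 1) * (x - t) \<le> 0"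
        using True t by (auto intro!: mult_nonpos_nonneg mult_nonneg_nonpos simp: mult_nonneg_nonpos mult_nonpos_nonpos)
      have sq: "(- \<i> * deriv N (of_real x))\<^sup>2 = - of_real ((Re (deriv N (of_real x)))\<^sup>2)"
        using im by (simp add: power_mult_distrib complex_eq_iff power2_eq_square)
      show ?thesis
      proof (intro exI[of _ \<rho>] exI[of _ "\<lambda>z. - \<i> * deriv N z"] conjI ballI impI)
        show "continuous_on (ball (of_real x) \<rho> \<inter> {z. 0 \<le> Im z}) (\<lambda>z. - \<i> * deriv N z)"
          using holomorphic_on_imp_continuous_on[OF holN'] by (rule continuous_on_subset) auto
        show "0 \<le> Re ((- \<i> * deriv N (of_real x))\<^sup>2) * (x * (x - 1) * (x - t))"
          unfolding sq using sgn by (simp add: mult_nonneg_nonpos)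
      qed (use N(1) eq sq in auto)
    next
      case False
      then have xn: "0 < x \<and> x < 1 \<or> t < x" using x by auto
      txt \<open>On a Neumann interval the normal derivative is the imaginary part of \<open>h\<close> divided by the
        derivative of \<open>f\<close>, up to a constant.\<close>
      define d where "d = dir x"
      have d: "d \<noteq> 0" by (simp add: d_def dir_nonzero)
      \<comment> \<open>The reciprocal of \<open>g\<close> is written out because it is holomorphic
        also at the double pole \<open>z0\<close> of \<open>g\<close>; so \<open>m\<close> is
        holomorphic in the whole half plane.\<close>
      define m where "m = (\<lambda>z. h z * d / C * ((z - z0)\<^sup>2 * (z - cnj z0)\<^sup>2 /
        (z powr of_real \<alpha> * (z - 1) powr of_real \<beta> * (z - of_real t) powr of_real \<gamma>)))"
      have m_eq: "m z = h z * d / (C * g z)" for z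
        by (simp add: m_def sc_integrand_def)
      have holm: "m holomorphic_on upper_half_plane"
      proof -
        have ne: "z - of_real c \<noteq> 0" "z - of_real c \<notin> \<real>\<^sub>\<le>\<^sub>0" if "0 < Im z" for z and c :: real
          using that by (auto simp: complex_nonpos_Reals_iff complex_eq_iff)
        show ?thesis
          unfolding m_def
          by (intro holomorphic_intros holh)
            (use C_nonzero ne[of _ 0] ne[of _ 1] ne[of _ t] in \<open>auto simp: powr_eq_0_iff\<close>)
      qed
      have "((\<lambda>z. Im (m z)) \<longlongrightarrow> 0) (at (of_real y) within upper_half_plane)" if y: "\<bar>y - x\<bar> < R" for y
      proof -
        have yx: "y \<notin> {0, 1, t}" "dir y = d" using same[OF y] by (auto simp: d_def dir_def)
        have seg: "fb (of_real y) \<in> open_segment z1 z2 \<and> d = z2 - z1 \<or> fb (of_real y) \<in> open_segment z3 z4 \<and> d = z4 - z3"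
          using fb_open_segment[OF yx(1)] same[OF y] xn t unfolding side_start_dir
          by (auto simp: side_start_def d_def dir_def split: if_splits)
        then have lim: "((\<lambda>z. frechet_derivative (\<lambda>z. u (Some z)) (at z) (\<i> * d)) \<longlongrightarrow> 0) (at (fb (of_real y)) within Some -` D)"
          using n1 n2 by auto
        have "((\<lambda>z. frechet_derivative (\<lambda>z. u (Some z)) (at (fb z)) (\<i> * d)) \<longlongrightarrow> 0) (at (of_real y) within upper_half_plane)"
          by (rule filterlim_compose[OF lim fb_filterlim])
        \<comment> \<open>The sign anticipates Re (i w) = - Im w.\<close>
        then have "((\<lambda>z. - frechet_derivative (\<lambda>z. u (Some z)) (at (fb z)) (\<i> * d)) \<longlongrightarrow> - 0) (at (of_real y) within upper_half_plane)"
          by (rule tendsto_minus)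
        then have lim': "((\<lambda>z. - frechet_derivative (\<lambda>z. u (Some z)) (at (fb z)) (\<i> * d)) \<longlongrightarrow> 0) (at (of_real y) within upper_half_plane)"
          by simp
        show ?thesis
        proof (rule Lim_transform_eventually[OF lim'])
          show "\<forall>\<^sub>F z in at (of_real y) within upper_half_plane.
              - frechet_derivative (\<lambda>z. u (Some z)) (at (fb z)) (\<i> * d) = Im (m z)"
            using eventually_upper[OF z0, of y]
          proof eventually_elim
            case (elim z)
            then have z: "0 < Im z" "z \<noteq> z0" by auto
            have wD: "fb z \<in> Some -` D"
              using fb_upper[OF z] bij_betwE[OF bij_f] z(1) by (metis mem_upper_half_plane vimageI2)
            have "harmonic_plane (\<lambda>z. u (Some z)) (Some -` D)" using harm by (simp add: harmonic_sphere_def)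
            then obtain G where G: "\<And>z. z \<in> Some -` D \<Longrightarrow> ((\<lambda>z. u (Some z)) has_derivative (\<lambda>h. Re (G z * h))) (at z)"
              by (rule harmonic_plane_gradient[OF _ open_Some_vimage[OF openD]]) blast
            have "((\<lambda>z. u (Some (fb z))) has_derivative (\<lambda>h. Re (G (fb z) * (C * g z * h)))) (at z)"
              by (rule has_derivative_compose[OF fb_deriv[OF z, unfolded has_field_derivative_def] G[OF wD]])
            then have "((\<lambda>z. u (f z)) has_derivative (\<lambda>h. Re (G (fb z) * (C * g z * h)))) (at z)"
              by (rule has_derivative_transform_within_open[of _ _ _ _ "upper_half_plane - {z0}"])
                (use z fb_upper in auto)
            then have "((\<lambda>z. u (f z)) has_derivative (\<lambda>h. Re ((G (fb z) * (C * g z)) * h))) (at z)"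
              by (simp only: mult.assoc)
            then have "G (fb z) * (C * g z) = h z"
              using H(3)[of z] z(1) unfolding h_def by (intro Re_gradient_unique) auto
            then have Gm: "G (fb z) * d = m z"
              unfolding m_eq using C_nonzero g_nonzero[OF z] by (simp add: field_simps)
            have "frechet_derivative (\<lambda>z. u (Some z)) (at (fb z)) = (\<lambda>h. Re (G (fb z) * h))"
              using frechet_derivative_at[OF G[OF wD]] by simp
            then have "frechet_derivative (\<lambda>z. u (Some z)) (at (fb z)) (\<i> * d) = Re (\<i> * (G (fb z) * d))"
              by (simp only: mult.left_commute)
            then show ?case unfolding Gm by simp
          qed
        qed
      qed
      then have "\<exists>N \<rho>. \<rho> > 0 \<and> \<rho> \<le> R \<and> N holomorphic_on ball (of_real x) \<rho> \<and>
          (\<forall>z\<in>ball (of_real x) \<rho>. Im z > 0 \<longrightarrow> N z = m z) \<and>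
          (\<forall>y. of_real y \<in> ball (of_real x :: complex) \<rho> \<longrightarrow> Im (N (of_real y)) = 0)"
        by (rule schwarz_reflection_Im[OF R holm, of x]) blast+
      then obtain N \<rho>0 where N: "\<rho>0 > 0" "\<rho>0 \<le> R" "N holomorphic_on ball (of_real x) \<rho>0"
        "\<And>z. z \<in> ball (of_real x) \<rho>0 \<Longrightarrow> Im z > 0 \<Longrightarrow> N z = m z"
        "\<And>y. of_real y \<in> ball (of_real x :: complex) \<rho>0 \<Longrightarrow> Im (N (of_real y)) = 0"
        by blast
      \<comment> \<open>The bound by \<open>Im z0\<close> keeps the pole of \<open>g\<close> out of
        the disc.\<close>
      define \<rho> where "\<rho> = min \<rho>0 (Im z0)"
      have \<rho>: "\<rho> > 0" "\<rho> \<le> \<rho>0" "\<rho> \<le> Im z0" using N(1) z0 by (auto simp: \<rho>_def)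
      have nz0: "z \<noteq> z0" if "z \<in> ball (of_real x) \<rho>" for z
        using that \<rho>(3) abs_Im_le_cmod[of "of_real x - z"] z0 by (auto simp: dist_norm)
      define N1 where "N1 = (\<lambda>z. N z * (C * g z) / d)"
      obtain k where k: "k > 0" "C * g (of_real x) = of_real k * d" using fb'_dir[OF x] unfolding d_def by blast
      \<comment> \<open>Undoing the division by \<open>g\<close> at a real point multiplies by the
        positive number \<open>k\<close>, so the value is real and its square nonnegative.\<close>
      have N1x: "N1 (of_real x) = of_real (Re (N (of_real x)) * k)"
      proof -
        have "N (of_real x) = of_real (Re (N (of_real x)))" using N(5)[of x] N(1) by (simp add: complex_eq_iff)
        moreover have "N1 (of_real x) = N (of_real x) * of_real k" unfolding N1_def k(2) using d by simp
        ultimately show ?thesis by (metis of_real_mult)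
      qed
      have "0 \<le> x * (x - 1) * (x - t)"
      proof (cases "x < 1")
        case True
        then show ?thesis using xn t by (intro mult_nonpos_nonpos mult_nonneg_nonpos) auto
      qed (use xn t in auto)
      then have nonneg: "0 \<le> (Re (N (of_real x)) * k)\<^sup>2 * (x * (x - 1) * (x - t))" by simp
      show ?thesis
      proof (intro exI[of _ \<rho>] exI[of _ N1] conjI ballI impI)
        have "continuous_on (ball (of_real x) \<rho> \<inter> {z. 0 \<le> Im z}) N"
          by (rule continuous_on_subset[OF holomorphic_on_imp_continuous_on[OF N(3)]]) (use \<rho>(2) in auto)
        moreover have "continuous_on (ball (of_real x) \<rho> \<inter> {z. 0 \<le> Im z}) g"
          by (rule continuous_on_subset[OF g_cont]) (use nz0 in blast)
        ultimately show "continuous_on (ball (of_real x) \<rho> \<inter> {z. 0 \<le> Im z}) N1"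
          unfolding N1_def using d by (intro continuous_intros) auto
        show "N1 z = h z" if z: "z \<in> ball (of_real x) \<rho>" "0 < Im z" for z
        proof -
          have "N z = m z" by (rule N(4)) (use z \<rho>(2) in auto)
          then show ?thesis
            unfolding N1_def m_eq using C_nonzero g_nonzero[OF z(2) nz0[OF z(1)]] d by (simp add: field_simps)
        qed
        show "Im ((N1 (of_real x))\<^sup>2) = 0" unfolding N1x by (simp flip: of_real_power)
        show "0 \<le> Re ((N1 (of_real x))\<^sup>2) * (x * (x - 1) * (x - t))"
          unfolding N1x using nonneg by (simp only: of_real_power[symmetric] Re_complex_of_real)
      qed (use \<rho> in auto)
    qed
  qed
  have hb: "norm (h z) \<le> 2 * exp 1 / Im z" if "0 < Im z" for z
    using deriv_bound_of_Re_bounds[OF H(1) H01 that] by (simp add: h_def)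
  have "\<exists>b\<ge>0. \<forall>z. Im z > 0 \<longrightarrow> (h z)\<^sup>2 * (z * (z - 1) * (z - of_real t)) = of_real b"
    by (rule square_eq_const_by_reflection[OF t holh hb ext]) blast+
  then obtain b where b: "b \<ge> 0" "\<And>z. Im z > 0 \<Longrightarrow> (h z)\<^sup>2 * (z * (z - 1) * (z - of_real t)) = of_real b"
    by blast
  define \<kappa> where "\<kappa> = 1 / (2 * ellK r * r)\<^sup>2"
  have \<kappa>: "\<kappa> > 0" using E.ellK_pos r01 by (simp add: \<kappa>_def)
  \<comment> \<open>Only the squares of \<open>h\<close> and \<open>psi_deriv\<close> are known to
    be proportional; the quotient is holomorphic with constant square, hence constant.\<close>
  define q where "q = (\<lambda>z. h z / psi_deriv r z)"
  have q2: "(q z)\<^sup>2 = of_real (b / \<kappa>)" if z: "0 < Im z" for z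
  proof -
    have "z \<noteq> 0" "z \<noteq> 1" "z \<noteq> of_real t" using z by auto
    then have p: "z * (z - 1) * (z - of_real t) \<noteq> 0" by simp
    have "(psi_deriv r z)\<^sup>2 * (z * (z - 1) * (z - of_real t)) = of_real \<kappa>"
      using E.psi_deriv_square[OF z] by (simp only: t_eq \<kappa>_def)
    then have "(h z)\<^sup>2 / (psi_deriv r z)\<^sup>2 = of_real b / of_real \<kappa>"
      using b(2)[OF z] p by (metis mult_divide_mult_cancel_right)
    then show ?thesis by (simp add: q_def power_divide)
  qed
  have psi_deriv_hol: "psi_deriv r holomorphic_on upper_half_plane"
  proof -
    have "deriv (psi r) holomorphic_on upper_half_plane" by (rule holomorphic_deriv[OF psi_holomorphic]) auto
    then show ?thesis
      by (rule holomorphic_transform) (use E.psi_has_field_derivative DERIV_imp_deriv in auto)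
  qed
  have q_hol: "q holomorphic_on upper_half_plane"
    unfolding q_def using E.psi_deriv_nonzero by (intro holomorphic_intros holh psi_deriv_hol) auto
  have "\<exists>c. \<forall>z\<in>upper_half_plane. q z = c"
  proof (rule has_field_derivative_zero_constant[OF convex_upper_half_plane])
    fix z assume "z \<in> upper_half_plane"
    then have z: "0 < Im z" by simp
    have dq: "(q has_field_derivative deriv q z) (at z)" by (rule holomorphic_derivI[OF q_hol]) (use z in auto)
    have "((\<lambda>z. (q z)\<^sup>2) has_field_derivative 2 * q z * deriv q z) (at z)"
      using dq by (auto intro!: derivative_eq_intros)
    then have "((\<lambda>z. of_real (b / \<kappa>)) has_field_derivative 2 * q z * deriv q z) (at z)"
      by (rule has_field_derivative_transform_within_open[OF _ open_upper_half_plane]) (use z q2 in auto)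
    then have "2 * q z * deriv q z = 0" using DERIV_unique DERIV_const by blast
    \<comment> \<open>Where \<open>q\<close> vanishes the equation says nothing about the
      derivative; but then \<open>b = 0\<close> and \<open>q\<close> vanishes identically.\<close>
    then have "deriv q z = 0"
    proof (cases "q z = 0")
      case True
      then have "b = 0" using q2[OF z] \<kappa> by simp
      then have "q v = 0" if "0 < Im v" for v using q2[OF that] by simp
      then have "((\<lambda>z. 0) has_field_derivative deriv q z) (at z)"
        using z by (intro has_field_derivative_transform_within_open[OF dq open_upper_half_plane]) auto
      then show ?thesis using DERIV_unique DERIV_const by blast
    qed simp
    then show "(q has_field_derivative 0) (at z within upper_half_plane)"
      using dq by (simp add: has_field_derivative_at_within)
  qed
  then obtain c where c: "\<And>z. 0 < Im z \<Longrightarrow> q z = c" by auto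
  have "c\<^sup>2 = of_real (b / \<kappa>)" using q2[of \<i>] c[of \<i>] by simp
  then have "Im (c\<^sup>2) = 0" "0 \<le> Re (c\<^sup>2)" using b(1) \<kappa> by simp_all
  \<comment> \<open>A number with real nonnegative square is real, so \<open>Re H\<close> depends on
    \<open>Re psi\<close> only.\<close>
  then have cr: "Im c = 0" by (auto simp: Re_power2 Im_power2)
  have "\<exists>c0. \<forall>z\<in>upper_half_plane. H z - c * psi r z = c0"
  proof (rule has_field_derivative_zero_constant[OF convex_upper_half_plane])
    fix z assume "z \<in> upper_half_plane"
    then have z: "0 < Im z" by simp
    have "h z - c * psi_deriv r z = 0" using c[OF z] E.psi_deriv_nonzero[OF z] by (simp add: q_def field_simps)
    moreover have "((\<lambda>z. H z - c * psi r z) has_field_derivative h z - c * psi_deriv r z) (at z)"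
      by (intro DERIV_diff DERIV_cmult dH E.psi_has_field_derivative z)
    ultimately show "((\<lambda>z. H z - c * psi r z) has_field_derivative 0) (at z within upper_half_plane)"
      by (simp add: has_field_derivative_at_within)
  qed
  then obtain c0 where c0: "\<And>z. 0 < Im z \<Longrightarrow> H z - c * psi r z = c0" by auto
  have Re_H: "Re (H z) = Re c * Re (psi r z) + Re c0" if "0 < Im z" for z
  proof -
    have "H z = c * psi r z + c0" using c0[OF that] by (simp add: algebra_simps)
    then show ?thesis using cr by simp
  qed
  have limit_eq: "l = Re c * l' + Re c0"
    if l: "((\<lambda>z. Re (H z)) \<longlongrightarrow> l) (at (of_real x) within upper_half_plane)"
      "((\<lambda>z. Re (psi r z)) \<longlongrightarrow> l') (at (of_real x) within upper_half_plane)" for l l' x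
  proof (rule tendsto_unique[OF upper_filter_nontrivial l(1)])
    have "((\<lambda>z. Re c * Re (psi r z) + Re c0) \<longlongrightarrow> Re c * l' + Re c0) (at (of_real x) within upper_half_plane)"
      by (intro tendsto_intros l)
    then show "((\<lambda>z. Re (H z)) \<longlongrightarrow> Re c * l' + Re c0) (at (of_real x) within upper_half_plane)"
      by (rule Lim_transform_eventually) (use Re_H in \<open>auto simp: eventually_at_filter\<close>)
  qed
  \<comment> \<open>One point on each Dirichlet interval: -1 determines the additive constant, the
    midpoint of 1 and t the factor.\<close>
  have "Re c0 = 0" using limit_eq[OF lim0 E.psi_tendsto_0, of "-1"] by simp
  moreover have "Re c = 1"
    using limit_eq[OF lim1 E.psi_tendsto_1, of "(1 + t) / 2"] t \<open>Re c0 = 0\<close> by (simp add: t_eq[symmetric])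
  ultimately show ?thesis using Re_H[of "finv w"] finv[OF w] H(2)[of "finv w"] by simp
qed

end

text \<open>The equivalence expresses existence and uniqueness of the potential function at once;
  values of \<open>u\<close> outside \<open>D\<close> are left free, since only those in
  \<open>D\<close> have a meaning.\<close>

theorem corollary4p6:
  fixes D :: "ecomplex set" and z1 z2 z3 z4 z0 C :: complex
    and \<alpha> \<beta> \<gamma> \<delta> r t :: real and f :: "complex \<Rightarrow> ecomplex"
    and u :: "ecomplex \<Rightarrow> real"
  assumes "convex_polygon_exterior D z1 z2 z3 z4"
    and "\<alpha> \<in> {0<..<1}" and "\<beta> \<in> {0<..<1}" and "\<gamma> \<in> {0<..<1}" and "\<delta> \<in> {0<..<1}"
    and "\<alpha> + \<beta> + \<gamma> + \<delta> = 2"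
    and "interior_angle D z4 z1 z2 ((1 + \<alpha>) * pi)"
    and "interior_angle D z1 z2 z3 ((1 + \<beta>) * pi)"
    and "interior_angle D z2 z3 z4 ((1 + \<gamma>) * pi)"
    and "interior_angle D z3 z4 z1 ((1 + \<delta>) * pi)"
    and "r \<in> {0<..<1}"
    and "quad_modulus D z1 z2 z3 z4 = ellK (sqrt (1 - r^2)) / ellK r"
    and "t = 1 / r^2"
    and "z0 \<in> upper_half_plane"
    and "of_real \<alpha> / z0 + of_real \<beta> / (z0 - 1) + of_real \<gamma> / (z0 - of_real t)
           = 1 / (\<i> * of_real (Im z0))"
    and "C = (z2 - z1) / contour_integral (linepath 0 1) (sc_integrand \<alpha> \<beta> \<gamma> t z0)"
    and "conformal_into_sphere f upper_half_plane D"
    and "f z0 = infty"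
    and "\<And>z p. \<lbrakk>z \<in> upper_half_plane; z \<noteq> z0; valid_path p; pathstart p = 0; pathfinish p = z;
             p ` {0<..1} \<subseteq> upper_half_plane - {z0}\<rbrakk>
           \<Longrightarrow> f z = Some (C * contour_integral p (sc_integrand \<alpha> \<beta> \<gamma> t z0) + z1)"
  shows "(potential_function D z1 z2 z3 z4 u \<longleftrightarrow>
            (\<forall>w\<in>D. u w = Re (psi r (inv_into upper_half_plane f w)))) \<and>
         (potential_function D z1 z2 z3 z4 u \<longrightarrow>
            ((\<lambda>z. u (Some z)) \<longlongrightarrow> u infty) at_infinity \<and> u infty = Re (psi r z0))"
proof -
  from assms(1) have D: "openin sphere_top D" "infty \<in> D"
    "sphere_top frontier_of D = Some ` (closed_segment z1 z2 \<union> closed_segment z2 z3 \<union> closed_segment z3 z4 \<union> closed_segment z4 z1)"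
    unfolding convex_polygon_exterior_def Let_def by blast+
  have r: "0 < r" "r < 1" using assms(11) by auto
  have t: "1 < t" using r by (simp add: assms(13) power_less_one_iff)
  interpret sc_final \<alpha> \<beta> \<gamma> t z0 C z1 f D z2 z3 z4 \<delta> r
  proof unfold_locales
    show "f z = Some (C * contour_integral p (sc_integrand \<alpha> \<beta> \<gamma> t z0) + z1)"
      if "z \<in> upper_half_plane" "z \<noteq> z0" "valid_path p" "pathstart p = 0" "pathfinish p = z"
        "p ` {0<..1} \<subseteq> upper_half_plane - {z0}" for z p
      by (rule assms(19)[OF that])
    show "z2 \<noteq> z1" "\<exists>\<rho>>0. z4 - z1 = of_real \<rho> * cis ((1 + \<alpha>) * pi) * (z2 - z1)"
      using assms(7) unfolding interior_angle_def by blast+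
    show "z3 \<noteq> z2" "\<exists>\<rho>>0. z1 - z2 = of_real \<rho> * cis ((1 + \<beta>) * pi) * (z3 - z2)"
      using assms(8) unfolding interior_angle_def by blast+
    show "z4 \<noteq> z3" "\<exists>\<rho>>0. z2 - z3 = of_real \<rho> * cis ((1 + \<gamma>) * pi) * (z4 - z3)"
      using assms(9) unfolding interior_angle_def by blast+
    show "z1 \<noteq> z4" "\<exists>\<rho>>0. z3 - z4 = of_real \<rho> * cis ((1 + \<delta>) * pi) * (z1 - z4)"
      using assms(10) unfolding interior_angle_def by blast+
    show "0 < Im z0" using assms(14) by simp
  qed (use assms(2-6,13,16-18) D r t in auto)
  have iff: "potential_function D z1 z2 z3 z4 u \<longleftrightarrow> (\<forall>w\<in>D. u w = Re (psi r (finv w)))"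
    using potential_of_psi psi_of_potential by blast
  \<comment> \<open>Elsewhere in the half plane \<open>f\<close> is finite.\<close>
  have "finv infty = z0"
    using finv[OF D(2)] fb_upper[of "finv infty"] by (metis option.distinct(1))
  moreover have "((\<lambda>z. u (Some z)) \<longlongrightarrow> u infty) at_infinity" if "potential_function D z1 z2 z3 z4 u"
    by (rule harmonic_sphere_tendsto_infty[OF _ D(1,2)]) (use that in \<open>simp add: potential_function_def\<close>)
  ultimately show ?thesis using iff D(2) by auto
qed

end
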